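(* Let $\alpha\ge0$ be fixed and let $u^1_p$ be the positive least energy radial solution of $-\Delta u=|x|^{\alpha}|u|^{p-1}u$ in $B$, $u=0$ on $\partial B$. Then there exists $p^\star=p^\star(\alpha)>1$ such that for every $p>p^\star$ $$m(u^1_p)=1+2\left\lceil\frac{\alpha}{2}\right\rceil .$$
   Context: $B$ is the open unit disc of $\mathbb R^2$. The least energy radial solution is a minimizer of $\mathcal E(u)=\frac12\int_B|\nabla u|^2-\frac1{p+1}\int_B|x|^\alpha|u|^{p+1}$ on the radial Nehari set $\{v\in H^1_0(B)\text{ radial}, v\ne0,\int_B|\nabla v|^2=\int_B|x|^\alpha|v|^{p+1}\}$. The Morse index $m(u)$ of a solution $u$ is the maximal dimension of a subspace of $H^1_0(B)$ on which the quadratic form $Q_u(\psi)=\int_B\big(|\nabla\psi|^2-p|x|^\alpha|u|^{p-1}\psi^2\big)dx$ is negative definite. $\lceil t\rceil=\min\{k\in\mathbb Z: k\ge t\}$. *)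

theory Defs
  imports "HOL-Analysis.Analysis"
begin

definition B :: "(real^2) set" where
  "B = ball 0 1"

definition cgrad :: "(real^2 \<Rightarrow> real) \<Rightarrow> real^2 \<Rightarrow> real^2" where
  "cgrad \<phi> x = (\<chi> i. frechet_derivative \<phi> (at x) (axis i 1))"

definition test_fun :: "(real^2 \<Rightarrow> real) \<Rightarrow> bool" where
  "test_fun \<phi> \<longleftrightarrow> (\<forall>x. \<phi> differentiable (at x)) \<and> continuous_on UNIV (cgrad \<phi>)
      \<and> compact (closure {x. \<phi> x \<noteq> 0}) \<and> closure {x. \<phi> x \<noteq> 0} \<subseteq> B"

text \<open>psi belongs to H^1_0(B) with (weak) gradient G: psi, G are in L^2(B) and
  psi is the H^1-limit of test functions, i.e. H^1_0(B) is the closure of C^1_c(B) in H^1(B).\<close>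
definition H10_grad :: "(real^2 \<Rightarrow> real) \<Rightarrow> (real^2 \<Rightarrow> real^2) \<Rightarrow> bool" where
  "H10_grad \<psi> G \<longleftrightarrow>
     set_borel_measurable lborel B \<psi> \<and> set_integrable lborel B (\<lambda>x. (\<psi> x)\<^sup>2) \<and>
     set_borel_measurable lborel B G \<and> set_integrable lborel B (\<lambda>x. (norm (G x))\<^sup>2) \<and>
     (\<exists>\<phi> :: nat \<Rightarrow> real^2 \<Rightarrow> real. (\<forall>n. test_fun (\<phi> n)) \<and>
        (\<lambda>n. \<integral>x\<in>B. (\<phi> n x - \<psi> x)\<^sup>2 \<partial>lborel) \<longlonglongrightarrow> 0 \<and>
        (\<lambda>n. \<integral>x\<in>B. (norm (cgrad (\<phi> n) x - G x))\<^sup>2 \<partial>lborel) \<longlonglongrightarrow> 0)"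

definition H10 :: "(real^2 \<Rightarrow> real) \<Rightarrow> bool" where
  "H10 \<psi> \<longleftrightarrow> (\<exists>G. H10_grad \<psi> G)"

text \<open>The (weak) gradient of an H^1_0 function (unique up to null sets).\<close>
definition wgrad :: "(real^2 \<Rightarrow> real) \<Rightarrow> real^2 \<Rightarrow> real^2" where
  "wgrad \<psi> = (SOME G. H10_grad \<psi> G)"

definition radial :: "(real^2 \<Rightarrow> real) \<Rightarrow> bool" where
  "radial \<psi> \<longleftrightarrow> (\<forall>x\<in>B. \<forall>y\<in>B. norm x = norm y \<longrightarrow> \<psi> x = \<psi> y)"

definition nonzero :: "(real^2 \<Rightarrow> real) \<Rightarrow> bool" where
  "nonzero \<psi> \<longleftrightarrow> \<not> (AE x in lborel. x \<in> B \<longrightarrow> \<psi> x = 0)"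

definition energy :: "real \<Rightarrow> real \<Rightarrow> (real^2 \<Rightarrow> real) \<Rightarrow> real" where
  "energy \<alpha> p \<psi> = (1/2) * (\<integral>x\<in>B. (norm (wgrad \<psi> x))\<^sup>2 \<partial>lborel)
      - (1/(p+1)) * (\<integral>x\<in>B. norm x powr \<alpha> * \<bar>\<psi> x\<bar> powr (p+1) \<partial>lborel)"

definition radial_nehari :: "real \<Rightarrow> real \<Rightarrow> (real^2 \<Rightarrow> real) set" where
  "radial_nehari \<alpha> p = {v. H10 v \<and> radial v \<and> nonzero v \<and>
      (\<integral>x\<in>B. (norm (wgrad v x))\<^sup>2 \<partial>lborel) =
      (\<integral>x\<in>B. norm x powr \<alpha> * \<bar>v x\<bar> powr (p+1) \<partial>lborel)}"

definition weak_solution :: "real \<Rightarrow> real \<Rightarrow> (real^2 \<Rightarrow> real) \<Rightarrow> bool" where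
  "weak_solution \<alpha> p u \<longleftrightarrow> H10 u \<and>
     (\<forall>\<phi>. test_fun \<phi> \<longrightarrow>
        (\<integral>x\<in>B. wgrad u x \<bullet> cgrad \<phi> x \<partial>lborel) =
        (\<integral>x\<in>B. norm x powr \<alpha> * \<bar>u x\<bar> powr (p-1) * u x * \<phi> x \<partial>lborel))"

definition pos_least_energy_radial :: "real \<Rightarrow> real \<Rightarrow> (real^2 \<Rightarrow> real) \<Rightarrow> bool" where
  "pos_least_energy_radial \<alpha> p u \<longleftrightarrow>
     weak_solution \<alpha> p u \<and> (AE x in lborel. x \<in> B \<longrightarrow> u x > 0) \<and>
     u \<in> radial_nehari \<alpha> p \<and> (\<forall>v\<in>radial_nehari \<alpha> p. energy \<alpha> p u \<le> energy \<alpha> p v)"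

definition Qform :: "real \<Rightarrow> real \<Rightarrow> (real^2 \<Rightarrow> real) \<Rightarrow> (real^2 \<Rightarrow> real) \<Rightarrow> real" where
  "Qform \<alpha> p u \<psi> = (\<integral>x\<in>B. (norm (wgrad \<psi> x))\<^sup>2 \<partial>lborel)
      - p * (\<integral>x\<in>B. norm x powr \<alpha> * \<bar>u x\<bar> powr (p-1) * (\<psi> x)\<^sup>2 \<partial>lborel)"

text \<open>Morse index: the maximal dimension k of a subspace of H^1_0(B) (spanned by
  f_0,...,f_(k-1)) on which Q_u is negative definite (as extended natural number).\<close>
definition morse_index :: "real \<Rightarrow> real \<Rightarrow> (real^2 \<Rightarrow> real) \<Rightarrow> enat" where
  "morse_index \<alpha> p u = Sup {enat k | k. \<exists>f :: nat \<Rightarrow> real^2 \<Rightarrow> real.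
      (\<forall>i<k. H10 (f i)) \<and>
      (\<forall>c :: nat \<Rightarrow> real. (\<exists>i<k. c i \<noteq> 0) \<longrightarrow>
          Qform \<alpha> p u (\<lambda>x. \<Sum>i<k. c i * f i x) < 0)}"

end

theory Submission
  imports Defs
begin

text \<open>
  Put x = exp(-t) (cos th, sin th), m = 1 + alpha/2 and u(x) = w(t). The equation becomes
  -w'' = exp(-2mt) w^p on (0, oo) with w(0) = 0 and w'(oo) = 0, and
  Q(psi) = int_0^oo int (psi_t^2 + psi_th^2 - V psi^2) dth dt with V = p exp(-2mt) w^(p-1).
  Two explicit solutions of linearised equations control Q. First, z = exp(mt) w' > 0 satisfies
  -z'' - V z = -m^2 z, so Q is nonnegative on the angular modes k \<ge> m. Second,
  y = 2m/(p-1) w - w', coming from the scaling symmetry, satisfies -y'' - V y = 0, is increasing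
  and has exactly one zero t0, so Q is nonnegative on every lower mode that vanishes at t0. Since
  ceil(alpha/2) < m \<le> ceil(alpha/2) + 1, the Morse index is at most 1 + 2 ceil(alpha/2) for all p.
  For large p the potential pushes the mass of z far away from t = 0, so cutting z off near t = 0
  costs little, and -d^2/dt^2 - V takes values below -k^2 for every k < m; this gives the lower bound.
\<close>

section \<open>Square-integrable functions and their limits\<close>

text \<open>Two obstacles shape the argument. First, u is only an H^1 limit of test functions,
  positive almost everywhere, and its gradient is one chosen among many. The profile w is therefore
  obtained as the circular mean of u, computed by pairing the weak gradient with an explicit field;
  testing the equation with regularised truncations of -ln |x| turns w into a Green potential on the
  half line, and all smoothness is read off that formula. Second, y has a zero, so dividing by it is
  singular at t0. The comparison runs through the Riccati quotients z'/z on modes of frequency above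
  n = ceil(\<alpha>/2) and y'/y on the 2n+1 others, whose angular energy is discarded; the pole is
  harmless once these 2n+1 modes vanish at t0, and that many linear conditions are what the upper
  bound counts. They are imposed on approximating test functions and carried to H^1_0 by compactness
  of normalised coefficients. In the lower bound the same quotient z'/z shows that a cutoff of z is
  charged only for the slope of the cutoff, so an explicit plateau length T, and with it p > 1 + 4
  m^2 T^2, suffices.\<close>

definition L2 :: "'a measure \<Rightarrow> ('a \<Rightarrow> 'b::euclidean_space) \<Rightarrow> bool" where
  "L2 M f \<longleftrightarrow> f \<in> borel_measurable M \<and> integrable M (\<lambda>x. (norm (f x))\<^sup>2)"

text \<open>Membership in L2 is part of the notion: the Bochner integral of a non-integrable
  function is 0, so the vanishing of the integrals alone would carry no information.\<close>

definition L2lim :: "'a measure \<Rightarrow> (nat \<Rightarrow> 'a \<Rightarrow> 'b::euclidean_space) \<Rightarrow> ('a \<Rightarrow> 'b) \<Rightarrow> bool" where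
  "L2lim M F f \<longleftrightarrow> L2 M f \<and> (\<forall>n. L2 M (F n)) \<and> (\<lambda>n. \<integral>x. (norm (F n x - f x))\<^sup>2 \<partial>M) \<longlonglongrightarrow> 0"

lemma tendsto_zero_squeeze:
  fixes a b :: "nat \<Rightarrow> real"
  assumes "b \<longlonglongrightarrow> 0" "\<And>n. a n \<le> b n" "\<And>n. 0 \<le> a n"
  shows "a \<longlonglongrightarrow> 0"
  by (rule tendsto_sandwich[where f="\<lambda>_. 0" and h=b]) (use assms in simp_all)

lemma L2_inner:
  assumes "L2 M f" "L2 M g"
  shows "integrable M (\<lambda>x. f x \<bullet> g x)"
proof -
  have [measurable]: "f \<in> borel_measurable M" "g \<in> borel_measurable M"
    using assms by (auto simp: L2_def)
  have "integrable M (\<lambda>x. (norm (f x))\<^sup>2 + (norm (g x))\<^sup>2)"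
    using assms by (auto simp: L2_def)
  then show ?thesis
  proof (rule Bochner_Integration.integrable_bound)
    have "\<bar>f x \<bullet> g x\<bar> \<le> (norm (f x))\<^sup>2 + (norm (g x))\<^sup>2" for x
    proof -
      have "\<bar>f x \<bullet> g x\<bar> \<le> norm (f x) * norm (g x)" by (rule Cauchy_Schwarz_ineq2)
      moreover have "2 * (norm (f x) * norm (g x)) \<le> (norm (f x))\<^sup>2 + (norm (g x))\<^sup>2"
        using sum_squares_bound[of "norm (f x)" "norm (g x)"] by (simp add: mult.assoc)
      moreover have "0 \<le> norm (f x) * norm (g x)" by simp
      ultimately show ?thesis by linarith
    qed
    then show "AE x in M. norm (f x \<bullet> g x) \<le> norm ((norm (f x))\<^sup>2 + (norm (g x))\<^sup>2)"
      by auto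
  qed measurable
qed

lemma L2_scaleR: "L2 M f \<Longrightarrow> L2 M (\<lambda>x. (c::real) *\<^sub>R f x)"
  by (auto simp: L2_def power_mult_distrib)

lemma L2_zero: "L2 M (\<lambda>x. 0)"
  by (auto simp: L2_def)

lemma L2_add:
  assumes "L2 M f" "L2 M g"
  shows "L2 M (\<lambda>x. f x + g x)"
proof -
  have "(norm (f x + g x))\<^sup>2 = (norm (f x))\<^sup>2 + 2 * (f x \<bullet> g x) + (norm (g x))\<^sup>2" for x
    by (simp add: power2_norm_eq_inner inner_add inner_commute)
  then show ?thesis
    using assms L2_inner[OF assms] by (auto simp: L2_def)
qed

lemma L2_diff:
  assumes "L2 M f" "L2 M g"
  shows "L2 M (\<lambda>x. f x - g x)"
  using L2_add[OF assms(1) L2_scaleR[OF assms(2), of "-1"]] by simp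

text \<open>The integral of |a f - b g|^2 is a nonnegative quadratic form in (a, b); it is evaluated
  at a = \<open>?G\<close>, b = \<open>?I\<close>. If \<open>?G\<close> is 0, the form with a = 1 is
  affine in b, which forces the mixed integral to vanish.\<close>

lemma L2_cauchy_schwarz:
  assumes "L2 M f" "L2 M g"
  shows "(\<integral>x. f x \<bullet> g x \<partial>M)\<^sup>2 \<le> (\<integral>x. (norm (f x))\<^sup>2 \<partial>M) * (\<integral>x. (norm (g x))\<^sup>2 \<partial>M)"
proof -
  let ?F = "\<integral>x. (norm (f x))\<^sup>2 \<partial>M" and ?G = "\<integral>x. (norm (g x))\<^sup>2 \<partial>M" and ?I = "\<integral>x. f x \<bullet> g x \<partial>M"
  have i: "integrable M (\<lambda>x. (norm (f x))\<^sup>2)" "integrable M (\<lambda>x. (norm (g x))\<^sup>2)" "integrable M (\<lambda>x. f x \<bullet> g x)"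
    using assms L2_inner[OF assms] by (auto simp: L2_def)
  have q: "0 \<le> a\<^sup>2 * ?F - 2 * a * b * ?I + b\<^sup>2 * ?G" for a b :: real
  proof -
    have "0 \<le> (\<integral>x. (norm (a *\<^sub>R f x - b *\<^sub>R g x))\<^sup>2 \<partial>M)" by simp
    also have "(\<lambda>x. (norm (a *\<^sub>R f x - b *\<^sub>R g x))\<^sup>2) =
        (\<lambda>x. a\<^sup>2 * (norm (f x))\<^sup>2 - 2 * a * b * (f x \<bullet> g x) + b\<^sup>2 * (norm (g x))\<^sup>2)"
      unfolding power2_norm_eq_inner
      by (auto simp: inner_diff inner_commute algebra_simps power2_eq_square fun_eq_iff)
    finally show ?thesis using i by simp
  qed
  have F: "0 \<le> ?F" and G: "0 \<le> ?G" by simp_all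
  show ?thesis
  proof (cases "?G = 0")
    case False
    then have "?G > 0" using G by linarith
    moreover have "0 \<le> ?G * (?F * ?G - ?I\<^sup>2)"
      using q[of ?G ?I] by (simp add: algebra_simps power2_eq_square)
    ultimately show ?thesis by (simp add: zero_le_mult_iff)
  next
    case True
    have "?I = 0"
    proof (rule ccontr)
      assume "?I \<noteq> 0"
      have "0 \<le> ?F - 2 * b * ?I" for b using q[of 1 b] True by simp
      \<comment> \<open>The value of b at which the affine function equals -1.\<close>
      from this[of "(?F + 1) / (2 * ?I)"] show False using \<open>?I \<noteq> 0\<close> by simp
    qed
    then show ?thesis using True by simp
  qed
qed

lemma L2limD: "L2lim M F f \<Longrightarrow> L2 M f" "L2lim M F f \<Longrightarrow> L2 M (F n)"
  by (auto simp: L2lim_def)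

lemma L2lim_const: "L2 M f \<Longrightarrow> L2lim M (\<lambda>_. f) f"
  by (auto simp: L2lim_def)

lemma L2lim_add:
  assumes "L2lim M F f" "L2lim M G g"
  shows "L2lim M (\<lambda>n x. F n x + G n x) (\<lambda>x. f x + g x)"
proof -
  note L = L2limD[OF assms(1)] L2limD[OF assms(2)]
  have "(\<lambda>n. 2 * (\<integral>x. (norm (F n x - f x))\<^sup>2 \<partial>M) + 2 * (\<integral>x. (norm (G n x - g x))\<^sup>2 \<partial>M)) \<longlonglongrightarrow> 0"
    using assms by (intro tendsto_eq_intros) (auto simp: L2lim_def)
  moreover have "(\<integral>x. (norm (F n x + G n x - (f x + g x)))\<^sup>2 \<partial>M) \<le>
      2 * (\<integral>x. (norm (F n x - f x))\<^sup>2 \<partial>M) + 2 * (\<integral>x. (norm (G n x - g x))\<^sup>2 \<partial>M)" for n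
  proof -
    have l: "L2 M (\<lambda>x. F n x - f x)" "L2 M (\<lambda>x. G n x - g x)" 
       "L2 M (\<lambda>x. F n x + G n x - (f x + g x))" using L by (auto intro!: L2_diff L2_add)
    have "(\<integral>x. (norm (F n x + G n x - (f x + g x)))\<^sup>2 \<partial>M) \<le>
       (\<integral>x. 2 * (norm (F n x - f x))\<^sup>2 + 2 * (norm (G n x - g x))\<^sup>2 \<partial>M)"
    proof (rule integral_mono)
      fix x
      have "norm (F n x + G n x - (f x + g x)) \<le> norm (F n x - f x) + norm (G n x - g x)"
        using norm_triangle_ineq[of "F n x - f x" "G n x - g x"] by (simp add: algebra_simps)
      then have "(norm (F n x + G n x - (f x + g x)))\<^sup>2 \<le> (norm (F n x - f x) + norm (G n x - g x))\<^sup>2"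
        by (intro power_mono) auto
      also have "\<dots> \<le> 2 * (norm (F n x - f x))\<^sup>2 + 2 * (norm (G n x - g x))\<^sup>2"
        using sum_squares_bound[of "norm (F n x - f x)" "norm (G n x - g x)"] by (simp add: power2_sum)
      finally show "(norm (F n x + G n x - (f x + g x)))\<^sup>2 \<le> 2 * (norm (F n x - f x))\<^sup>2 + 2 * (norm (G n x - g x))\<^sup>2" .
    qed (use l in \<open>auto simp: L2_def\<close>)
    also have "\<dots> = 2 * (\<integral>x. (norm (F n x - f x))\<^sup>2 \<partial>M) + 2 * (\<integral>x. (norm (G n x - g x))\<^sup>2 \<partial>M)"
      using l by (auto simp: L2_def)
    finally show ?thesis .
  qed
  ultimately have "(\<lambda>n. \<integral>x. (norm (F n x + G n x - (f x + g x)))\<^sup>2 \<partial>M) \<longlonglongrightarrow> 0"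
    by (rule tendsto_zero_squeeze) simp
  then show ?thesis using L by (auto simp: L2lim_def intro!: L2_add)
qed

text \<open>Meant for b the square root of the potential: it makes the zero order term of the
  quadratic form continuous in L2.\<close>

lemma L2lim_bounded_mult:
  assumes "L2lim M F f" and b [measurable]: "b \<in> borel_measurable M" and C: "AE x in M. \<bar>b x\<bar> \<le> (C::real)"
  shows "L2lim M (\<lambda>n x. b x *\<^sub>R F n x) (\<lambda>x. b x *\<^sub>R f x)"
proof -
  note L = L2limD[OF assms(1)]
  have C2: "AE x in M. (b x)\<^sup>2 \<le> C\<^sup>2" using C by eventually_elim (use power_mono[of "\<bar>b _\<bar>" C 2] in auto)
  have bd: "AE x in M. (norm (b x *\<^sub>R g x))\<^sup>2 \<le> C\<^sup>2 * (norm (g x))\<^sup>2" for g :: "'a \<Rightarrow> 'b"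
    using C2 by eventually_elim (auto simp: power_mult_distrib intro!: mult_right_mono)
  have L2b: "L2 M (\<lambda>x. b x *\<^sub>R g x)" if g: "L2 M g" for g :: "'a \<Rightarrow> 'b"
  proof -
    have [measurable]: "g \<in> borel_measurable M" using g by (simp add: L2_def)
    have "integrable M (\<lambda>x. C\<^sup>2 * (norm (g x))\<^sup>2)" using g by (simp add: L2_def)
    then have "integrable M (\<lambda>x. (norm (b x *\<^sub>R g x))\<^sup>2)"
      by (rule Bochner_Integration.integrable_bound) (use bd[of g] in auto)
    then show ?thesis by (simp add: L2_def)
  qed
  have le: "(\<integral>x. (norm (b x *\<^sub>R F n x - b x *\<^sub>R f x))\<^sup>2 \<partial>M) \<le> C\<^sup>2 * (\<integral>x. (norm (F n x - f x))\<^sup>2 \<partial>M)" for n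
  proof -
    have l: "L2 M (\<lambda>x. F n x - f x)" using L by (auto intro!: L2_diff)
    have "(\<integral>x. (norm (b x *\<^sub>R (F n x - f x)))\<^sup>2 \<partial>M) \<le> (\<integral>x. C\<^sup>2 * (norm (F n x - f x))\<^sup>2 \<partial>M)"
      using L2b[OF l] l bd by (intro integral_mono_AE) (auto simp: L2_def)
    then show ?thesis by (simp add: scaleR_diff_right)
  qed
  have "(\<lambda>n. C\<^sup>2 * (\<integral>x. (norm (F n x - f x))\<^sup>2 \<partial>M)) \<longlonglongrightarrow> 0"
    using assms by (intro tendsto_mult_right_zero) (auto simp: L2lim_def)
  then have "(\<lambda>n. \<integral>x. (norm (b x *\<^sub>R F n x - b x *\<^sub>R f x))\<^sup>2 \<partial>M) \<longlonglongrightarrow> 0"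
    using le by (rule tendsto_zero_squeeze) simp
  then show ?thesis using L2b[OF L(1)] L2b[OF L(2)] by (simp add: L2lim_def)
qed

lemma L2lim_coeff:
  assumes "L2 M f" "(c :: nat \<Rightarrow> real) \<longlonglongrightarrow> l"
  shows "L2lim M (\<lambda>n x. c n *\<^sub>R f x) (\<lambda>x. l *\<^sub>R f x)"
proof -
  have "(\<lambda>n. (c n - l)\<^sup>2 * (\<integral>x. (norm (f x))\<^sup>2 \<partial>M)) \<longlonglongrightarrow> (l - l)\<^sup>2 * (\<integral>x. (norm (f x))\<^sup>2 \<partial>M)"
    by (intro tendsto_intros assms)
  moreover have "(norm (c n *\<^sub>R f x - l *\<^sub>R f x))\<^sup>2 = (c n - l)\<^sup>2 * (norm (f x))\<^sup>2" for n x
    by (simp flip: scaleR_diff_left add: power_mult_distrib)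
  ultimately show ?thesis using assms by (simp add: L2lim_def L2_scaleR)
qed

lemma L2lim_bounded_coeff:
  assumes F: "L2lim M F f" and c: "(c :: nat \<Rightarrow> real) \<longlonglongrightarrow> l"
  shows "L2lim M (\<lambda>n x. c n *\<^sub>R F n x) (\<lambda>x. l *\<^sub>R f x)"
proof -
  note L = L2limD[OF F]
  have "(\<lambda>n. (c n)\<^sup>2 * (\<integral>x. (norm (F n x - f x))\<^sup>2 \<partial>M)) \<longlonglongrightarrow> l\<^sup>2 * 0"
    using F by (intro tendsto_intros c) (auto simp: L2lim_def)
  moreover have "(norm (c n *\<^sub>R (F n x - f x)))\<^sup>2 = (c n)\<^sup>2 * (norm (F n x - f x))\<^sup>2" for n x
    by (simp add: power_mult_distrib)
  ultimately have "L2lim M (\<lambda>n x. c n *\<^sub>R (F n x - f x)) (\<lambda>x. 0)"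
    using L by (auto simp: L2lim_def intro!: L2_zero L2_diff L2_scaleR)
  from L2lim_add[OF this L2lim_coeff[OF L(1) c]] show ?thesis
    by (simp add: scaleR_diff_right)
qed

lemma L2lim_sum:
  assumes "\<And>i. i \<in> I \<Longrightarrow> L2lim M (F i) (f i)"
  shows "L2lim M (\<lambda>n x. \<Sum>i\<in>I. F i n x) (\<lambda>x. \<Sum>i\<in>I. f i x)"
  using assms by (induction I rule: infinite_finite_induct) (auto intro: L2lim_add L2lim_const L2_zero)

lemma L2lim_diff:
  assumes "L2lim M F f" "L2lim M G g"
  shows "L2lim M (\<lambda>n x. F n x - G n x) (\<lambda>x. f x - g x)"
  using L2lim_add[OF assms(1) L2lim_bounded_coeff[OF assms(2) tendsto_const[of "-1"]]] by simp

text \<open>The product is expanded around the limits into three error terms, each of which tends to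
  0 by Cauchy-Schwarz.\<close>

lemma L2lim_inner:
  assumes "L2lim M F f" "L2lim M G g"
  shows "(\<lambda>n. \<integral>x. F n x \<bullet> G n x \<partial>M) \<longlonglongrightarrow> (\<integral>x. f x \<bullet> g x \<partial>M)"
proof -
  have inner0: "(\<lambda>n. \<integral>x. H n x \<bullet> k x \<partial>M) \<longlonglongrightarrow> 0"
    if H: "L2lim M H (\<lambda>x. 0)" and k: "L2 M k" for H :: "nat \<Rightarrow> 'a \<Rightarrow> 'b" and k :: "'a \<Rightarrow> 'b"
  proof -
    have "(\<lambda>n. (\<integral>x. (norm (H n x))\<^sup>2 \<partial>M) * (\<integral>x. (norm (k x))\<^sup>2 \<partial>M)) \<longlonglongrightarrow> 0"
      using H by (intro tendsto_mult_left_zero) (simp add: L2lim_def)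
    then have "(\<lambda>n. (\<integral>x. H n x \<bullet> k x \<partial>M)\<^sup>2) \<longlonglongrightarrow> 0"
      by (rule tendsto_zero_squeeze) (use L2_cauchy_schwarz[OF L2limD(2)[OF H] k] in simp_all)
    from tendsto_real_sqrt[OF this] show ?thesis by (simp add: tendsto_rabs_zero_iff)
  qed
  note L = L2limD[OF assms(1)] L2limD[OF assms(2)]
  have FG: "L2lim M (\<lambda>n x. F n x - f x) (\<lambda>x. 0)" "L2lim M (\<lambda>n x. G n x - g x) (\<lambda>x. 0)"
    using L2lim_diff[OF assms(1) L2lim_const[OF L(1)]] L2lim_diff[OF assms(2) L2lim_const[OF L(3)]] by auto
  have 3: "(\<lambda>n. \<integral>x. (F n x - f x) \<bullet> (G n x - g x) \<partial>M) \<longlonglongrightarrow> 0"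
  proof -
    have "(\<lambda>n. (\<integral>x. (norm (F n x - f x))\<^sup>2 \<partial>M) * (\<integral>x. (norm (G n x - g x))\<^sup>2 \<partial>M)) \<longlonglongrightarrow> 0"
      using FG by (intro tendsto_mult_zero) (simp_all add: L2lim_def)
    then have "(\<lambda>n. (\<integral>x. (F n x - f x) \<bullet> (G n x - g x) \<partial>M)\<^sup>2) \<longlonglongrightarrow> 0"
      by (rule tendsto_zero_squeeze) (use L2_cauchy_schwarz[OF L2limD(2)[OF FG(1)] L2limD(2)[OF FG(2)]] in simp_all)
    from tendsto_real_sqrt[OF this] show ?thesis by (simp add: tendsto_rabs_zero_iff)
  qed
  have "(\<lambda>n. (\<integral>x. (F n x - f x) \<bullet> (G n x - g x) \<partial>M) + (\<integral>x. (F n x - f x) \<bullet> g x \<partial>M)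
      + (\<integral>x. (G n x - g x) \<bullet> f x \<partial>M) + (\<integral>x. f x \<bullet> g x \<partial>M)) \<longlonglongrightarrow> 0 + 0 + 0 + (\<integral>x. f x \<bullet> g x \<partial>M)"
    by (intro tendsto_intros 3 inner0 FG L)
  moreover have "(\<integral>x. (F n x - f x) \<bullet> (G n x - g x) \<partial>M) + (\<integral>x. (F n x - f x) \<bullet> g x \<partial>M)
      + (\<integral>x. (G n x - g x) \<bullet> f x \<partial>M) + (\<integral>x. f x \<bullet> g x \<partial>M) = (\<integral>x. F n x \<bullet> G n x \<partial>M)" for n
  proof -
    have i: "integrable M (\<lambda>x. (F n x - f x) \<bullet> (G n x - g x))" "integrable M (\<lambda>x. (F n x - f x) \<bullet> g x)"
      "integrable M (\<lambda>x. (G n x - g x) \<bullet> f x)" "integrable M (\<lambda>x. f x \<bullet> g x)"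
      using L by (auto intro!: L2_inner L2_diff)
    have "(\<integral>x. F n x \<bullet> G n x \<partial>M) = (\<integral>x. (F n x - f x) \<bullet> (G n x - g x) + (F n x - f x) \<bullet> g x
       + (G n x - g x) \<bullet> f x + f x \<bullet> g x \<partial>M)"
      by (intro Bochner_Integration.integral_cong) (auto simp: inner_diff inner_commute)
    then show ?thesis using i by simp
  qed
  ultimately show ?thesis by simp
qed

section \<open>Test functions and uniqueness of weak gradients\<close>

text \<open>Restricting the measure turns the set integrals of the definitions into plain integrals,
  to which the L2 calculus applies.\<close>

abbreviation MB :: "(real^2) measure" where "MB \<equiv> restrict_space lborel B"

lemma sets_B [measurable]: "B \<in> sets borel" "B \<in> sets lborel"
  by (auto simp: B_def)

lemma space_MB [simp]: "space MB = B"
  by (simp add: space_restrict_space)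

lemma set_integrable_MB: 
  fixes f :: "real^2 \<Rightarrow> 'b::euclidean_space"
  shows "set_integrable lborel B f \<longleftrightarrow> integrable MB f"
  unfolding set_integrable_def by (rule integrable_restrict_space[symmetric]) (simp add: sets_B)

lemma set_integral_MB: 
  fixes f :: "real^2 \<Rightarrow> 'b::euclidean_space"
  shows "set_lebesgue_integral lborel B f = integral\<^sup>L MB f"
  unfolding set_lebesgue_integral_def by (rule integral_restrict_space[symmetric]) (simp add: sets_B)

lemma set_borel_measurable_MB: 
  fixes f :: "real^2 \<Rightarrow> 'b::euclidean_space"
  shows "set_borel_measurable lborel B f \<longleftrightarrow> f \<in> borel_measurable MB"
  unfolding set_borel_measurable_def by (rule borel_measurable_restrict_space_iff[symmetric]) (simp add: sets_B)

lemmas MB_simps = set_integrable_MB set_integral_MB set_borel_measurable_MB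

lemma AE_MB: "(AE x in MB. P x) \<longleftrightarrow> (AE x in lborel. x \<in> B \<longrightarrow> P x)"
  by (simp add: AE_restrict_space_iff sets_B)

lemma finite_measure_MB: "finite_measure MB"
proof
  have "emeasure lborel B < \<infinity>" unfolding B_def by (intro emeasure_bounded_finite bounded_ball)
  then show "emeasure MB (space MB) \<noteq> \<infinity>" by (auto simp: emeasure_restrict_space)
qed

section \<open>Calculus of continuously differentiable functions on the plane\<close>

definition C1 :: "(real^2 \<Rightarrow> real) \<Rightarrow> bool" where
  "C1 \<phi> \<longleftrightarrow> (\<forall>x. \<phi> differentiable (at x)) \<and> continuous_on UNIV (cgrad \<phi>)"

lemma has_derivative_cgrad:
  assumes "\<phi> differentiable (at x)"
  shows "(\<phi> has_derivative (\<lambda>h. cgrad \<phi> x \<bullet> h)) (at x)"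
proof -
  have d: "(\<phi> has_derivative frechet_derivative \<phi> (at x)) (at x)"
    using assms by (simp add: frechet_derivative_works)
  interpret bounded_linear "frechet_derivative \<phi> (at x)" using d by (rule has_derivative_bounded_linear)
  have "frechet_derivative \<phi> (at x) h = cgrad \<phi> x \<bullet> h" for h
  proof -
    have "frechet_derivative \<phi> (at x) h = frechet_derivative \<phi> (at x) (\<Sum>i\<in>UNIV. h $ i *\<^sub>R axis i 1)"
      by (simp flip: scalar_mult_eq_scaleR add: basis_expansion)
    also have "\<dots> = (\<Sum>i\<in>UNIV. h $ i * frechet_derivative \<phi> (at x) (axis i 1))"
      by (simp add: sum scaleR)
    finally show ?thesis by (simp add: cgrad_def inner_vec_def mult.commute)
  qed
  then show ?thesis using d by (metis (no_types, lifting) ext)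
qed

lemma cgrad_eqI:
  assumes "(\<phi> has_derivative (\<lambda>h. g \<bullet> h)) (at x)"
  shows "cgrad \<phi> x = g"
proof -
  have "frechet_derivative \<phi> (at x) = (\<lambda>h. g \<bullet> h)"
    using frechet_derivative_at[OF assms] by simp
  then show ?thesis by (simp add: cgrad_def vec_eq_iff inner_axis)
qed

lemma C1I:
  assumes "\<And>x. (\<phi> has_derivative (\<lambda>h. g x \<bullet> h)) (at x)" "continuous_on UNIV g"
  shows "C1 \<phi>"
proof -
  have "cgrad \<phi> = g" using cgrad_eqI[OF assms(1)] by auto
  then show ?thesis using assms by (auto simp: C1_def differentiable_def)
qed

lemma C1D: "C1 \<phi> \<Longrightarrow> (\<phi> has_derivative (\<lambda>h. cgrad \<phi> x \<bullet> h)) (at x)"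
  by (simp add: C1_def has_derivative_cgrad)

lemma C1_continuous: "C1 \<phi> \<Longrightarrow> continuous_on S \<phi>"
  by (meson C1_def continuous_at_imp_continuous_on differentiable_imp_continuous_within)

lemma C1_cgrad_continuous: "C1 \<phi> \<Longrightarrow> continuous_on S (cgrad \<phi>)"
  by (meson C1_def continuous_on_subset top_greatest)

lemma C1_const: "C1 (\<lambda>x. c)" and cgrad_const: "cgrad (\<lambda>x. c) = (\<lambda>x. 0)"
  by (rule C1I[where g="\<lambda>x. 0"]) (auto intro!: cgrad_eqI)

lemma has_derivative_add_cgrad:
  assumes "C1 f" "C1 g"
  shows "((\<lambda>x. f x + g x) has_derivative (\<lambda>h. (cgrad f x + cgrad g x) \<bullet> h)) (at x)"
  using has_derivative_add[OF C1D[OF assms(1)] C1D[OF assms(2)]] by (simp add: inner_add_left)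

lemma has_derivative_mult_cgrad:
  assumes "C1 f" "C1 g"
  shows "((\<lambda>x. f x * g x) has_derivative (\<lambda>h. (f x *\<^sub>R cgrad g x + g x *\<^sub>R cgrad f x) \<bullet> h)) (at x)"
  using has_derivative_mult[OF C1D[OF assms(1)] C1D[OF assms(2)]] by (simp add: inner_add_left mult.commute)

lemma C1_add: "C1 f \<Longrightarrow> C1 g \<Longrightarrow> C1 (\<lambda>x. f x + g x)"
  and cgrad_add: "C1 f \<Longrightarrow> C1 g \<Longrightarrow> cgrad (\<lambda>x. f x + g x) x = cgrad f x + cgrad g x"
  by (auto intro!: C1I[OF has_derivative_add_cgrad] cgrad_eqI has_derivative_add_cgrad
      continuous_intros C1_cgrad_continuous)

lemma C1_mult: "C1 f \<Longrightarrow> C1 g \<Longrightarrow> C1 (\<lambda>x. f x * g x)"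
  and cgrad_mult: "C1 f \<Longrightarrow> C1 g \<Longrightarrow> cgrad (\<lambda>x. f x * g x) x = f x *\<^sub>R cgrad g x + g x *\<^sub>R cgrad f x"
  by (auto intro!: C1I[OF has_derivative_mult_cgrad] cgrad_eqI has_derivative_mult_cgrad
      continuous_intros C1_cgrad_continuous C1_continuous)

lemma C1_linear:
  assumes "bounded_linear f"
  shows "C1 f"
proof -
  interpret bounded_linear f by fact
  have "f h = (\<chi> i. f (axis i 1)) \<bullet> h" for h
  proof -
    have "f h = f (\<Sum>i\<in>UNIV. h $ i *\<^sub>R axis i 1)"
      by (simp flip: scalar_mult_eq_scaleR add: basis_expansion)
    also have "\<dots> = (\<Sum>i\<in>UNIV. h $ i * f (axis i 1))"
      by (simp add: sum scaleR)
    finally show ?thesis by (simp add: inner_vec_def mult.commute)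
  qed
  then have "f = (\<lambda>h. (\<chi> i. f (axis i 1)) \<bullet> h)" by blast
  from has_derivative_eq_rhs[OF bounded_linear_imp_has_derivative[OF assms] this]
  have "(f has_derivative (\<lambda>h. (\<chi> i. f (axis i 1)) \<bullet> h)) (at x)" for x .
  then show ?thesis by (rule C1I) simp
qed

lemma C1_polynomial: "real_polynomial_function p \<Longrightarrow> C1 p"
  by (induction rule: real_polynomial_function.induct) (auto intro: C1_linear C1_const C1_add C1_mult)

text \<open>A compact subset of the open disc stays inside a smaller disc: the norm attains its
  maximum on the support, and the midpoint between this maximum and 1 serves as r. In logarithmic
  coordinates this means vanishing for all small t.\<close>

lemma test_fun_iff:
  "test_fun \<phi> \<longleftrightarrow> C1 \<phi> \<and> (\<exists>r\<in>{0<..<1}. \<forall>x. norm x \<ge> r \<longrightarrow> \<phi> x = 0)"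
proof
  assume t: "test_fun \<phi>"
  let ?K = "closure {x. \<phi> x \<noteq> 0}"
  have K: "compact ?K" "?K \<subseteq> ball 0 1" using t by (auto simp: test_fun_def B_def)
  have "\<exists>r\<in>{0<..<1}. \<forall>x. norm x \<ge> r \<longrightarrow> \<phi> x = 0"
  proof (cases "?K = {}")
    case True
    then have "\<phi> x = 0" for x by auto
    then show ?thesis by (intro bexI[of _ "1/2"]) auto
  next
    case False
    then obtain y where y: "y \<in> ?K" "\<And>x. x \<in> ?K \<Longrightarrow> norm x \<le> norm y"
      using continuous_attains_sup[OF K(1) False continuous_on_norm_id] by blast
    have "norm y < 1" using y K by (auto simp: subset_iff)
    moreover have "\<phi> x = 0" if "norm x \<ge> (norm y + 1)/2" for x
    proof (rule ccontr)
      assume "\<phi> x \<noteq> 0"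
      then have "x \<in> ?K" using closure_subset by fastforce
      then show False using y(2)[of x] that \<open>norm y < 1\<close> by (simp add: field_simps)
    qed
    ultimately show ?thesis by (intro bexI[of _ "(norm y + 1)/2"]) (auto intro!: add_nonneg_pos)
  qed
  then show "C1 \<phi> \<and> (\<exists>r\<in>{0<..<1}. \<forall>x. norm x \<ge> r \<longrightarrow> \<phi> x = 0)"
    using t by (auto simp: test_fun_def C1_def)
next
  assume "C1 \<phi> \<and> (\<exists>r\<in>{0<..<1}. \<forall>x. norm x \<ge> r \<longrightarrow> \<phi> x = 0)"
  then obtain r where r: "C1 \<phi>" "r < 1" "0 < r" "\<And>x. norm x \<ge> r \<Longrightarrow> \<phi> x = 0" by auto
  have s: "{x. \<phi> x \<noteq> 0} \<subseteq> cball 0 r" using r by (auto simp: dist_norm) (meson linorder_le_cases)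
  then have c: "closure {x. \<phi> x \<noteq> 0} \<subseteq> cball 0 r" by (simp add: closure_minimal)
  then have "compact (closure {x. \<phi> x \<noteq> 0})"
    by (meson bounded_cball bounded_subset closed_closure compact_eq_bounded_closed)
  moreover have "cball 0 r \<subseteq> B" using r by (auto simp: B_def)
  ultimately show "test_fun \<phi>" using r c by (auto simp: test_fun_def C1_def)
qed

lemma test_fun_C1: "test_fun \<phi> \<Longrightarrow> C1 \<phi>"
  by (simp add: test_fun_iff)

lemma test_fun_vanish:
  assumes "test_fun \<phi>"
  obtains r where "0 < r" "r < 1" "\<And>x. norm x \<ge> r \<Longrightarrow> \<phi> x = 0" "\<And>x. norm x \<ge> r \<Longrightarrow> cgrad \<phi> x = 0"
proof -
  obtain r where r: "C1 \<phi>" "r < 1" "0 < r" "\<And>x. norm x \<ge> r \<Longrightarrow> \<phi> x = 0"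
    using assms by (auto simp: test_fun_iff)
  have "cgrad \<phi> x = 0" if "norm x > r" for x
  proof (rule cgrad_eqI)
    have o: "open {x::real^2. r < norm x}" by (intro open_Collect_less continuous_intros)
    have z: "((\<lambda>x. 0::real) has_derivative (\<lambda>h. 0 \<bullet> h)) (at x)" by simp
    show "(\<phi> has_derivative (\<lambda>h. 0 \<bullet> h)) (at x)"
      by (rule has_derivative_transform_within_open[OF z o]) (use that r in auto)
  qed
  \<comment> \<open>The gradient is known to vanish only where the norm exceeds r strictly, since a
    neighbourhood is needed; a larger radius restores the weak inequality for both the function and
    its gradient.\<close>
  then show ?thesis using r by (intro that[of "(r+1)/2"]) auto
qed

lemma test_fun_mult:
  assumes "C1 f" "test_fun \<phi>"
  shows "test_fun (\<lambda>x. f x * \<phi> x)"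
  using assms by (auto simp: test_fun_iff intro: C1_mult)

lemma test_fun_scale: "test_fun \<phi> \<Longrightarrow> test_fun (\<lambda>x. c * \<phi> x)"
  by (rule test_fun_mult[OF C1_const])

lemma cgrad_scale: "C1 \<phi> \<Longrightarrow> cgrad (\<lambda>x. c * \<phi> x) x = c *\<^sub>R cgrad \<phi> x"
  by (subst cgrad_mult) (auto simp: C1_const cgrad_const)

lemma test_fun_add:
  assumes "test_fun f" "test_fun g"
  shows "test_fun (\<lambda>x. f x + g x)"
proof -
  obtain r where r: "r < 1" "0 < r" "\<And>x. norm x \<ge> r \<Longrightarrow> f x = 0"
    using assms by (auto simp: test_fun_iff)
  obtain s where s: "s < 1" "0 < s" "\<And>x. norm x \<ge> s \<Longrightarrow> g x = 0"
    using assms by (auto simp: test_fun_iff)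
  show ?thesis unfolding test_fun_iff using r s assms
    by (intro conjI C1_add bexI[of _ "max r s"]) (auto simp: test_fun_iff)
qed

lemma test_fun_zero: "test_fun (\<lambda>x. 0)"
  unfolding test_fun_iff by (intro conjI C1_const bexI[of _ "1/2"]) auto

lemma test_fun_lincomb:
  assumes "\<And>i. i < (k::nat) \<Longrightarrow> test_fun (f i)"
  shows "test_fun (\<lambda>x. \<Sum>i<k. c i * f i x)"
    and "cgrad (\<lambda>x. \<Sum>i<k. c i * f i x) x = (\<Sum>i<k. c i *\<^sub>R cgrad (f i) x)"
proof -
  have "test_fun (\<lambda>x. \<Sum>i<k. c i * f i x) \<and> cgrad (\<lambda>x. \<Sum>i<k. c i * f i x) x = (\<Sum>i<k. c i *\<^sub>R cgrad (f i) x)"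
    using assms
  proof (induction k)
    case 0
    then show ?case by (simp add: test_fun_zero cgrad_const)
  next
    case (Suc k)
    then have t: "test_fun (\<lambda>x. \<Sum>i<k. c i * f i x)" "test_fun (\<lambda>x. c k * f k x)" "C1 (f k)"
      by (auto simp: test_fun_scale test_fun_C1)
    then show ?case using Suc
      by (simp add: test_fun_add cgrad_add test_fun_C1 cgrad_scale)
  qed
  then show "test_fun (\<lambda>x. \<Sum>i<k. c i * f i x)"
    "cgrad (\<lambda>x. \<Sum>i<k. c i * f i x) x = (\<Sum>i<k. c i *\<^sub>R cgrad (f i) x)" by auto
qed

lemma integrable_MB_continuous:
  fixes f :: "real^2 \<Rightarrow> 'b::euclidean_space"
  assumes "continuous_on UNIV f"
  shows "integrable MB f"
proof -
  have [measurable]: "f \<in> borel_measurable borel" using assms by (rule borel_measurable_continuous_onI)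
  have "bounded (f ` cball 0 1)"
    by (intro compact_imp_bounded compact_continuous_image continuous_on_subset[OF assms]) auto
  then obtain C where C: "\<And>x. x \<in> cball 0 1 \<Longrightarrow> norm (f x) \<le> C" unfolding bounded_iff by blast
  interpret finite_measure MB by (rule finite_measure_MB)
  show ?thesis
    by (rule integrable_const_bound[of _ C])
       (auto simp: B_def intro!: C AE_I2 measurable_restrict_space1)
qed

lemma L2_MB_continuous:
  fixes f :: "real^2 \<Rightarrow> 'b::euclidean_space"
  assumes "continuous_on UNIV f"
  shows "L2 MB f"
  unfolding L2_def
  using assms by (auto intro!: integrable_MB_continuous continuous_intros borel_measurable_integrable)

lemma test_fun_L2: "test_fun \<phi> \<Longrightarrow> L2 MB \<phi>" "test_fun \<phi> \<Longrightarrow> L2 MB (cgrad \<phi>)"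
  by (auto intro!: L2_MB_continuous C1_continuous C1_cgrad_continuous test_fun_C1)

text \<open>Everything later about H^1_0 goes through this form. Square integrability of the
  approximants comes for free, because continuous functions are bounded on the disc.\<close>

lemma H10_grad_iff:
  "H10_grad \<psi> G \<longleftrightarrow> (\<exists>\<phi>. (\<forall>n. test_fun (\<phi> n)) \<and> L2lim MB \<phi> \<psi> \<and> L2lim MB (\<lambda>n. cgrad (\<phi> n)) G)"
  unfolding H10_grad_def MB_simps L2lim_def
  by (auto simp: L2_def test_fun_L2[unfolded L2_def, simplified])

text \<open>Translation invariance of Lebesgue measure makes the difference quotients integrate to zero.\<close>
lemma integral_cgrad_eq_0:
  assumes "test_fun \<phi>"
  shows "(\<integral>x. cgrad \<phi> x \<bullet> b \<partial>MB) = 0"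
proof -
  obtain r where r: "0 < r" "r < 1" "\<And>x. norm x \<ge> r \<Longrightarrow> \<phi> x = 0" "\<And>x. norm x \<ge> r \<Longrightarrow> cgrad \<phi> x = 0"
    using test_fun_vanish[OF assms] by blast
  have C1: "C1 \<phi>" using assms by (rule test_fun_C1)
  have [measurable]: "\<phi> \<in> borel_measurable borel" "cgrad \<phi> \<in> borel_measurable borel"
    using C1 by (auto intro!: borel_measurable_continuous_onI C1_continuous C1_cgrad_continuous)
  have intB: "integrable lborel f" if "continuous_on UNIV f" "\<And>x. norm x \<ge> R \<Longrightarrow> f x = 0" 
    for f :: "real^2 \<Rightarrow> real" and R
  proof -
    have "integrable lborel (\<lambda>x. indicator (cball 0 R) x *\<^sub>R f x)"
      by (intro borel_integrable_compact continuous_on_subset[OF that(1)]) auto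
    moreover have "(\<lambda>x. indicator (cball 0 R) x *\<^sub>R f x) = f"
      using that(2) by (auto simp: fun_eq_iff indicator_def)
    ultimately show ?thesis by simp
  qed
  have i\<phi>: "integrable lborel \<phi>" by (rule intB[of _ r]) (use C1 r C1_continuous in auto)
  \<comment> \<open>Difference quotients in direction b with step 1/(n+1).\<close>
  define D where "D = (\<lambda>(n::nat) x. (\<phi> (x + (1 / Suc n) *\<^sub>R b) - \<phi> x) * Suc n)"
  have D0: "(\<integral>x. D n x \<partial>lborel) = 0" for n
  proof -
    have "integrable (distr lborel borel ((+) ((1 / Suc n) *\<^sub>R b))) \<phi>"
      using i\<phi> by (simp add: lborel_distr_plus)
    then have "integrable lborel (\<lambda>x. \<phi> (x + (1 / Suc n) *\<^sub>R b))"
      by (subst (asm) integrable_distr_eq) (auto simp: add.commute)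
    moreover have "(\<integral>x. \<phi> (x + (1 / Suc n) *\<^sub>R b) \<partial>lborel) = (\<integral>x. \<phi> x \<partial>lborel)"
      by (subst (2) lborel_distr_plus[of "(1 / Suc n) *\<^sub>R b", symmetric], subst integral_distr)
         (auto simp: add.commute)
    ultimately show ?thesis using i\<phi> unfolding D_def by simp
  qed
  have "bounded (cgrad \<phi> ` cball 0 1)"
    by (intro compact_imp_bounded compact_continuous_image C1_cgrad_continuous C1) auto
  then obtain C where C: "\<And>x. x \<in> cball 0 1 \<Longrightarrow> norm (cgrad \<phi> x) \<le> C" "C \<ge> 0"
    by (auto simp: bounded_iff) (metis dual_order.trans mem_cball_0 norm_ge_zero norm_zero zero_le_one)
  have C': "norm (cgrad \<phi> x) \<le> C" for x
    using C r by (cases "norm x \<le> 1") auto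
  have lip: "\<bar>\<phi> x - \<phi> y\<bar> \<le> C * norm (x - y)" for x y
  proof -
    have "norm (\<phi> x - \<phi> y) \<le> C * norm (x - y)"
    proof (rule differentiable_bound[of UNIV])
      show "(\<phi> has_derivative (\<lambda>h. cgrad \<phi> x \<bullet> h)) (at x within UNIV)" for x using C1D[OF C1] by simp
      show "onorm (\<lambda>h. cgrad \<phi> x \<bullet> h) \<le> C" for x
      proof (rule onorm_bound)
        fix h show "norm (cgrad \<phi> x \<bullet> h) \<le> C * norm h"
          using Cauchy_Schwarz_ineq2[of "cgrad \<phi> x" h] C'[of x]
          by (smt (verit) mult_right_mono norm_ge_zero real_norm_def)
      qed (use C in auto)
    qed auto
    then show ?thesis by simp
  qed
  \<comment> \<open>The Lipschitz bound \<open>lip\<close> dominates the quotients, and beyond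
    radius 1 + |b| they vanish, because both points involved then lie outside the unit disc.\<close>
  have "(\<lambda>n. \<integral>x. D n x \<partial>lborel) \<longlonglongrightarrow> (\<integral>x. cgrad \<phi> x \<bullet> b \<partial>lborel)"
  proof (rule integral_dominated_convergence[where w="\<lambda>x. indicator (cball 0 (1 + norm b)) x * (C * norm b)"])
    show "integrable lborel (\<lambda>x::real^2. indicator (cball 0 (1 + norm b)) x * (C * norm b))"
      using borel_integrable_compact[of "cball (0::real^2) (1 + norm b)" "\<lambda>_. C * norm b"] by simp
    show "AE x in lborel. (\<lambda>n. D n x) \<longlonglongrightarrow> cgrad \<phi> x \<bullet> b"
    proof (rule AE_I2)
      fix x
      have "((\<lambda>t. x + t *\<^sub>R b) has_derivative (\<lambda>t. t *\<^sub>R b)) (at 0)"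
        by (auto intro!: derivative_eq_intros)
      moreover have "(\<phi> has_derivative (\<lambda>h. cgrad \<phi> x \<bullet> h)) (at (x + 0 *\<^sub>R b))"
        using C1D[OF C1] by simp
      ultimately have "((\<lambda>t. \<phi> (x + t *\<^sub>R b)) has_derivative (\<lambda>t. cgrad \<phi> x \<bullet> (t *\<^sub>R b))) (at 0)"
        by (rule has_derivative_compose)
      then have "((\<lambda>t. \<phi> (x + t *\<^sub>R b)) has_real_derivative (cgrad \<phi> x \<bullet> b)) (at 0)"
        unfolding has_field_derivative_def
        by (rule has_derivative_eq_rhs) (simp add: fun_eq_iff mult.commute)
      then have "((\<lambda>h. (\<phi> (x + h *\<^sub>R b) - \<phi> x) / h) \<longlongrightarrow> cgrad \<phi> x \<bullet> b) (at 0)"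
        by (simp add: has_field_derivative_iff)
      moreover have "filterlim (\<lambda>n. 1 / real (Suc n)) (at 0) sequentially"
        by (rule filterlim_atI[OF LIMSEQ_inverse_real_of_nat[unfolded inverse_eq_divide]]) simp
      ultimately have "(\<lambda>n. (\<phi> (x + (1 / real (Suc n)) *\<^sub>R b) - \<phi> x) / (1 / real (Suc n))) \<longlonglongrightarrow> cgrad \<phi> x \<bullet> b"
        by (rule filterlim_compose[where g="\<lambda>h. (\<phi> (x + h *\<^sub>R b) - \<phi> x) / h" and f="\<lambda>n. 1 / real (Suc n)"])
      then show "(\<lambda>n. D n x) \<longlonglongrightarrow> cgrad \<phi> x \<bullet> b" by (simp add: D_def)
    qed
    show "AE x in lborel. norm (D n x) \<le> indicator (cball 0 (1 + norm b)) x * (C * norm b)" for n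
    proof (rule AE_I2)
      fix x
      have "\<bar>D n x\<bar> = \<bar>\<phi> (x + (1 / Suc n) *\<^sub>R b) - \<phi> x\<bar> * Suc n"
        unfolding D_def abs_mult by simp
      also have "\<dots> \<le> (C * norm ((x + (1 / Suc n) *\<^sub>R b) - x)) * Suc n"
        by (intro mult_right_mono lip) simp
      also have "\<dots> = C * norm b" by simp
      finally have "\<bar>D n x\<bar> \<le> C * norm b" .
      moreover have "D n x = 0" if "norm x > 1 + norm b"
      proof -
        have "norm ((1 / Suc n) *\<^sub>R b) \<le> norm b" by (simp add: field_simps)
        then have "norm (x + (1 / Suc n) *\<^sub>R b) \<ge> 1"
          using that norm_triangle_ineq4[of "x + (1 / Suc n) *\<^sub>R b" "(1 / Suc n) *\<^sub>R b"] by simp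
        moreover have "norm x \<ge> 1" using that by (smt (verit) norm_ge_zero)
        ultimately show ?thesis using r by (simp add: D_def)
      qed
      ultimately show "norm (D n x) \<le> indicator (cball 0 (1 + norm b)) x * (C * norm b)"
        by (auto simp: indicator_def)
    qed
  qed (auto simp: D_def)
  then have "(\<integral>x. cgrad \<phi> x \<bullet> b \<partial>lborel) = 0"
    unfolding D0 using LIMSEQ_unique tendsto_const by blast
  moreover have "(\<integral>x. cgrad \<phi> x \<bullet> b \<partial>lborel) = (\<integral>x. cgrad \<phi> x \<bullet> b \<partial>MB)"
    unfolding integral_restrict_space[of B lborel, simplified]
    using r by (intro Bochner_Integration.integral_cong) (auto simp: indicator_def B_def)
  ultimately show ?thesis by simp
qed

text \<open>D is orthogonal to polynomial fields by integration by parts, hence to continuous fields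
  by uniform approximation, hence to every \<open>cgrad (\<phi> n)\<close>. These converge to D
  itself, so the norm of D is 0.\<close>

lemma weak_gradient_zero:
  assumes t: "\<And>n. test_fun (\<phi> n)" and L: "L2lim MB \<phi> (\<lambda>x. 0)" "L2lim MB (\<lambda>n. cgrad (\<phi> n)) D"
  shows "(\<integral>x. (norm (D x))\<^sup>2 \<partial>MB) = 0"
proof -
  have LD: "L2 MB D" using L2limD(1)[OF L(2)] .
  have poly: "(\<integral>x. D x \<bullet> (p x *\<^sub>R b) \<partial>MB) = 0" if p: "real_polynomial_function p" for p b
  proof -
    have C1: "C1 p" by (rule C1_polynomial[OF p])
    have cont: "continuous_on UNIV (\<lambda>x. p x *\<^sub>R b)" "continuous_on UNIV (\<lambda>x. cgrad p x \<bullet> b)"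
      by (intro continuous_intros C1_continuous C1_cgrad_continuous C1)+
    have "(\<lambda>n. (\<integral>x. cgrad (\<phi> n) x \<bullet> (p x *\<^sub>R b) \<partial>MB) + (\<integral>x. \<phi> n x \<bullet> (cgrad p x \<bullet> b) \<partial>MB)) \<longlonglongrightarrow>
       (\<integral>x. D x \<bullet> (p x *\<^sub>R b) \<partial>MB) + (\<integral>x. 0 \<bullet> (cgrad p x \<bullet> b) \<partial>MB)"
      by (intro tendsto_add L2lim_inner L L2lim_const L2_MB_continuous cont)
    moreover have "(\<integral>x. cgrad (\<phi> n) x \<bullet> (p x *\<^sub>R b) \<partial>MB) + (\<integral>x. \<phi> n x \<bullet> (cgrad p x \<bullet> b) \<partial>MB) = 0" for n
    proof -
      have i: "integrable MB (\<lambda>x. cgrad (\<phi> n) x \<bullet> (p x *\<^sub>R b))" "integrable MB (\<lambda>x. \<phi> n x \<bullet> (cgrad p x \<bullet> b))"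
        by (intro L2_inner L2_MB_continuous test_fun_L2 t cont)+
      \<comment> \<open>Integration by parts: a polynomial times a test function is again a test
        function, so its gradient has integral zero.\<close>
      have "(\<integral>x. cgrad (\<lambda>x. p x * \<phi> n x) x \<bullet> b \<partial>MB) = 0"
        by (intro integral_cgrad_eq_0 test_fun_mult C1 t)
      then show ?thesis unfolding Bochner_Integration.integral_add[OF i, symmetric]
        using cgrad_mult[OF C1 test_fun_C1[OF t]] by (simp add: inner_add_left)
    qed
    ultimately have "(\<lambda>n::nat. 0) \<longlonglongrightarrow> (\<integral>x. D x \<bullet> (p x *\<^sub>R b) \<partial>MB)" by simp
    then show ?thesis by (simp add: LIMSEQ_const_iff)
  qed
  interpret finite_measure MB by (rule finite_measure_MB)
  have D1: "integrable MB (\<lambda>x. norm (D x))"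
  proof (rule Bochner_Integration.integrable_bound[where f="\<lambda>x. 1 + (norm (D x))\<^sup>2"])
    show "integrable MB (\<lambda>x. 1 + (norm (D x))\<^sup>2)" using LD by (auto simp: L2_def)
    show "AE x in MB. norm (norm (D x)) \<le> norm (1 + (norm (D x))\<^sup>2)"
    proof (rule AE_I2)
      fix x
      have "0 \<le> (norm (D x) - 1)\<^sup>2" "norm (D x) \<ge> 0" by simp_all
      then have "norm (D x) \<le> 1 + (norm (D x))\<^sup>2"
        unfolding power2_diff one_power2 mult_1_right using norm_ge_zero[of "D x"] by linarith
      then show "norm (norm (D x)) \<le> norm (1 + (norm (D x))\<^sup>2)" by simp
    qed
  qed (use LD in \<open>auto simp: L2_def\<close>)
  \<comment> \<open>Stone-Weierstrass on the closed disc; the error of the uniform approximation is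
    absorbed by the integrability \<open>D1\<close> of |D|.\<close>
  have cont: "(\<integral>x. D x \<bullet> (h x *\<^sub>R b) \<partial>MB) = 0" if h: "continuous_on UNIV h" for h b
  proof -
    have iD: "integrable MB (\<lambda>x. D x \<bullet> (k x *\<^sub>R b))" if "continuous_on UNIV k" for k
      by (intro L2_inner LD L2_MB_continuous continuous_intros that)
    have "\<bar>\<integral>x. D x \<bullet> (h x *\<^sub>R b) \<partial>MB\<bar> \<le> e * norm b * (\<integral>x. norm (D x) \<partial>MB)" if "e > 0" for e
    proof -
      obtain p where p: "real_polynomial_function p" "\<And>x. x \<in> cball 0 1 \<Longrightarrow> \<bar>h x - p x\<bar> < e"
        using Stone_Weierstrass_real_polynomial_function[of "cball 0 1" h e] \<open>e > 0\<close> 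
          continuous_on_subset[OF h] by auto
      have "(\<integral>x. D x \<bullet> (h x *\<^sub>R b) \<partial>MB) = (\<integral>x. D x \<bullet> (h x *\<^sub>R b) - D x \<bullet> (p x *\<^sub>R b) \<partial>MB)"
        using poly[OF p(1)] iD[OF h] iD[OF C1_continuous[OF C1_polynomial[OF p(1)]]] by simp
      also have "\<bar>\<dots>\<bar> \<le> (\<integral>x. e * norm b * norm (D x) \<partial>MB)"
      proof (rule integral_abs_bound[THEN order_trans], rule integral_mono)
        show "integrable MB (\<lambda>x. \<bar>D x \<bullet> (h x *\<^sub>R b) - D x \<bullet> (p x *\<^sub>R b)\<bar>)"
          using iD[OF h] iD[OF C1_continuous[OF C1_polynomial[OF p(1)]]] by auto
        show "integrable MB (\<lambda>x. e * norm b * norm (D x))" using D1 by auto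
        fix x assume "x \<in> space MB"
        then have "\<bar>h x - p x\<bar> \<le> e" using p(2)[of x] by (auto simp: B_def)
        have "\<bar>D x \<bullet> (h x *\<^sub>R b) - D x \<bullet> (p x *\<^sub>R b)\<bar> = \<bar>h x - p x\<bar> * \<bar>D x \<bullet> b\<bar>"
          by (simp add: abs_mult flip: left_diff_distrib)
        also have "\<dots> \<le> e * (norm (D x) * norm b)"
          using \<open>\<bar>h x - p x\<bar> \<le> e\<close> \<open>e > 0\<close> by (intro mult_mono Cauchy_Schwarz_ineq2) auto
        finally show "\<bar>D x \<bullet> (h x *\<^sub>R b) - D x \<bullet> (p x *\<^sub>R b)\<bar> \<le> e * norm b * norm (D x)"
          by (simp add: mult_ac)
      qed
      finally show ?thesis by simp
    qed
    then have le: "\<bar>\<integral>x. D x \<bullet> (h x *\<^sub>R b) \<partial>MB\<bar> \<le> e * (norm b * (\<integral>x. norm (D x) \<partial>MB))" if "e > 0" for e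
      using that by (simp add: mult.assoc)
    have lim: "((\<lambda>e. e * (norm b * (\<integral>x. norm (D x) \<partial>MB))) \<longlongrightarrow> 0) (at_right 0)"
      by (intro tendsto_eq_intros) auto
    have "\<bar>\<integral>x. D x \<bullet> (h x *\<^sub>R b) \<partial>MB\<bar> \<le> 0"
      by (rule tendsto_lowerbound[OF lim]) (use le in \<open>auto simp: eventually_at_right_field intro!: exI[of _ 1]\<close>)
    then show ?thesis by simp
  qed
  have "(\<lambda>n. \<integral>x. cgrad (\<phi> n) x \<bullet> D x \<partial>MB) \<longlonglongrightarrow> (\<integral>x. D x \<bullet> D x \<partial>MB)"
    by (intro L2lim_inner L L2lim_const LD)
  moreover have "(\<integral>x. cgrad (\<phi> n) x \<bullet> D x \<partial>MB) = 0" for n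
  proof -
    have c: "continuous_on UNIV (\<lambda>x. cgrad (\<phi> n) x $ i)" for i
      by (intro continuous_intros C1_cgrad_continuous test_fun_C1 t)
    have e: "cgrad (\<phi> n) x \<bullet> D x = (\<Sum>i\<in>UNIV. D x \<bullet> ((cgrad (\<phi> n) x $ i) *\<^sub>R axis i 1))" for x
      by (simp add: inner_vec_def[of "cgrad (\<phi> n) x"] inner_axis)
    show ?thesis unfolding e
      by (subst Bochner_Integration.integral_sum)
         (intro L2_inner LD L2_MB_continuous continuous_intros c cont sum.neutral ballI)+
  qed
  ultimately have "(\<lambda>n::nat. 0) \<longlonglongrightarrow> (\<integral>x. D x \<bullet> D x \<partial>MB)" by simp
  then show ?thesis by (simp add: LIMSEQ_const_iff power2_norm_eq_inner)
qed

text \<open>The difference of the two approximating sequences tends to 0 in L2, so its limiting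
  gradient vanishes almost everywhere.\<close>

lemma H10_grad_norm_unique:
  assumes "H10_grad \<psi> G" "H10_grad \<psi> G'"
  shows "(\<integral>x. (norm (G x))\<^sup>2 \<partial>MB) = (\<integral>x. (norm (G' x))\<^sup>2 \<partial>MB)"
proof -
  obtain \<phi> \<phi>' where \<phi>: "\<And>n. test_fun (\<phi> n)" "L2lim MB \<phi> \<psi>" "L2lim MB (\<lambda>n. cgrad (\<phi> n)) G"
     and \<phi>': "\<And>n. test_fun (\<phi>' n)" "L2lim MB \<phi>' \<psi>" "L2lim MB (\<lambda>n. cgrad (\<phi>' n)) G'"
    using assms by (auto simp: H10_grad_iff)
  have t: "test_fun (\<lambda>x. \<phi> n x - \<phi>' n x)" "cgrad (\<lambda>x. \<phi> n x - \<phi>' n x) = (\<lambda>x. cgrad (\<phi> n) x - cgrad (\<phi>' n) x)" for n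
    using test_fun_add[OF \<phi>(1)[of n] test_fun_scale[OF \<phi>'(1)[of n], of "-1"]]
      cgrad_add[OF test_fun_C1[OF \<phi>(1)[of n]] test_fun_C1[OF test_fun_scale[OF \<phi>'(1)[of n], of "-1"]]]
      cgrad_scale[OF test_fun_C1[OF \<phi>'(1)[of n]], of "-1"]
    by (simp_all add: fun_eq_iff)
  have "(\<integral>x. (norm (G x - G' x))\<^sup>2 \<partial>MB) = 0"
    using weak_gradient_zero[of "\<lambda>n x. \<phi> n x - \<phi>' n x" "\<lambda>x. G x - G' x"] t(1)
      L2lim_diff[OF \<phi>(2) \<phi>'(2)] L2lim_diff[OF \<phi>(3) \<phi>'(3)] by (simp add: t(2))
  moreover have "L2 MB (\<lambda>x. G x - G' x)"
    using \<phi>(3) \<phi>'(3) by (intro L2_diff) (auto simp: L2lim_def)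
  ultimately have "AE x in MB. G x = G' x"
    by (subst (asm) integral_nonneg_eq_0_iff_AE) (auto simp: L2_def)
  then show ?thesis
    using \<phi>(3) \<phi>'(3) by (intro integral_cong_AE) (auto simp: L2lim_def L2_def)
qed

lemma H10_wgrad: "H10 \<psi> \<Longrightarrow> H10_grad \<psi> (wgrad \<psi>)"
  unfolding H10_def wgrad_def by (erule someI_ex)

text \<open>\<open>wgrad\<close> comes from a choice operator. The quadratic form sees it only
  through this integral, so any convenient gradient may take its place.\<close>

lemma integral_wgrad:
  "H10_grad \<psi> G \<Longrightarrow> (\<integral>x. (norm (wgrad \<psi> x))\<^sup>2 \<partial>MB) = (\<integral>x. (norm (G x))\<^sup>2 \<partial>MB)"
  by (rule H10_grad_norm_unique[OF H10_wgrad]) (auto simp: H10_def)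

lemma test_fun_H10_grad: "test_fun \<phi> \<Longrightarrow> H10_grad \<phi> (cgrad \<phi>)"
  unfolding H10_grad_iff by (intro exI[of _ "\<lambda>_. \<phi>"]) (auto intro: L2lim_const test_fun_L2)

section \<open>Logarithmic polar coordinates\<close>

definition pol :: "real \<Rightarrow> real \<Rightarrow> real^2" where
  "pol t \<theta> = (exp (-t) * cos \<theta>) *\<^sub>R axis 1 1 + (exp (-t) * sin \<theta>) *\<^sub>R axis 2 1"

lemma pol_nth [simp]: "pol t \<theta> $ 1 = exp (-t) * cos \<theta>" "pol t \<theta> $ 2 = exp (-t) * sin \<theta>"
  by (simp_all add: pol_def axis_def)

lemma norm_vec2: "norm (x::real^2) = sqrt ((x$1)\<^sup>2 + (x$2)\<^sup>2)"
  by (simp add: norm_vec_def L2_set_def sum_2)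

lemma norm_pol [simp]: "norm (pol t \<theta>) = exp (-t)"
proof -
  have "(norm (pol t \<theta>))\<^sup>2 = (exp (-t))\<^sup>2 * ((cos \<theta>)\<^sup>2 + (sin \<theta>)\<^sup>2)"
    unfolding norm_vec2 by (simp add: power_mult_distrib flip: distrib_left)
  then show ?thesis by (simp add: power2_eq_iff_nonneg)
qed

text \<open>Open at both ends of the angular interval: this makes \<open>pol\<close> injective, and
  the ray that is lost is a null set.\<close>

definition strip :: "(real \<times> real) set" where "strip = {0<..} \<times> {0<..<2*pi}"

lemma pol_in_B: "0 < t \<Longrightarrow> pol t \<theta> \<in> B"
  by (simp add: B_def)

lemma pol_inj:
  assumes "pol s \<eta> = pol t \<theta>" "0 < \<eta>" "\<eta> < 2*pi" "0 < \<theta>" "\<theta> < 2*pi"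
  shows "s = t \<and> \<eta> = \<theta>"
proof -
  have st: "s = t" using arg_cong[OF assms(1), of norm] by simp
  then have "sin \<eta> = sin \<theta> \<and> cos \<eta> = cos \<theta>"
    using arg_cong[OF assms(1), of "\<lambda>x. x$1"] arg_cong[OF assms(1), of "\<lambda>x. x$2"] by simp
  then obtain n :: int where n: "\<eta> = \<theta> + 2 * pi * n" using sin_cos_eq_iff[of \<eta> \<theta>] by auto
  have "n = 0"
  proof (rule ccontr)
    assume "n \<noteq> 0"
    then consider "real_of_int n \<ge> 1" | "real_of_int n \<le> -1" by linarith
    then show False
    proof cases
      case 1
      then have "2 * pi * real_of_int n \<ge> 2 * pi * 1" by (intro mult_left_mono) auto
      then show ?thesis using n assms by linarith
    next
      case 2
      then have "2 * pi * real_of_int n \<le> 2 * pi * (-1)" by (intro mult_left_mono) auto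
      then show ?thesis using n assms by linarith
    qed
  qed
  then show ?thesis using n st by simp
qed

lemma pol_surj:
  assumes "x \<in> B" "x$2 \<noteq> 0"
  obtains t \<theta> where "0 < t" "0 < \<theta>" "\<theta> < 2*pi" "x = pol t \<theta>"
proof -
  let ?r = "norm x"
  have r: "0 < ?r" "?r < 1" using assms by (auto simp: B_def)
  have sq: "(x$1)\<^sup>2 + (x$2)\<^sup>2 = ?r\<^sup>2" by (simp add: norm_vec2)
  have "(x$1 / ?r)\<^sup>2 + (x$2 / ?r)\<^sup>2 = ((x$1)\<^sup>2 + (x$2)\<^sup>2) / ?r\<^sup>2"
    by (simp add: power_divide add_divide_distrib)
  also have "\<dots> = 1" unfolding sq using r(1) by simp
  finally obtain \<theta> where \<theta>: "0 \<le> \<theta>" "\<theta> < 2*pi" "x$1 / ?r = cos \<theta>" "x$2 / ?r = sin \<theta>"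
    by (rule sincos_total_2pi)
  have "x$1 = ?r * cos \<theta>" "x$2 = ?r * sin \<theta>" using r(1) by (simp_all flip: \<theta>(3,4))
  moreover have "exp (- (- ln ?r)) = ?r" using r(1) by simp
  ultimately have "x = pol (- ln ?r) \<theta>" by (simp only: vec_eq_iff forall_2 pol_nth)
  moreover have "\<theta> \<noteq> 0"
  proof
    assume "\<theta> = 0"
    then have "x$2 / ?r = 0" using \<theta>(4) by simp
    then show False using r(1) assms(2) by simp
  qed
  moreover have "- ln ?r > 0" using r by simp
  ultimately show thesis using that[of "- ln ?r" \<theta>] \<theta>(1,2) by linarith
qed

lemma pol_has_derivative:
  fixes x :: "real^2"
  shows "((\<lambda>x. pol (x$1) (x$2)) has_derivative
     (\<lambda>h. (- exp (-(x$1)) * cos (x$2) * h$1 - exp (-(x$1)) * sin (x$2) * h$2) *\<^sub>R axis 1 1 +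
          (- exp (-(x$1)) * sin (x$2) * h$1 + exp (-(x$1)) * cos (x$2) * h$2) *\<^sub>R axis 2 1)) (at x within S)"
proof -
  note [derivative_intros] = bounded_linear_imp_has_derivative[OF bounded_linear_vec_nth]
  show ?thesis unfolding pol_def
    by (auto intro!: derivative_eq_intros simp: algebra_simps)
qed

lemma measurable_real2:
  "(\<lambda>z::real\<times>real. fst z *\<^sub>R axis 1 1 + snd z *\<^sub>R axis 2 1 :: real^2) \<in> measurable lborel lborel"
  unfolding measurable_lborel1 measurable_lborel2
  by (intro borel_measurable_continuous_onI continuous_intros)

text \<open>The change of variables formula concerns \<open>real^2\<close>, Fubini concerns pairs;
  this identification connects the two. Lebesgue measure is determined by its values on
  boxes.\<close>

lemma lborel_real2:
  "distr lborel lborel (\<lambda>z. fst z *\<^sub>R axis 1 1 + snd z *\<^sub>R axis 2 1 :: real^2) = lborel"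
proof (rule lborel_eqI[symmetric])
  fix l u :: "real^2"
  assume lu: "\<And>b. b \<in> Basis \<Longrightarrow> l \<bullet> b \<le> u \<bullet> b"
  have ax: "axis 1 1 \<in> (Basis::(real^2) set)" "axis 2 1 \<in> (Basis::(real^2) set)"
    by (auto simp: axis_in_Basis_iff)
  have l: "l$1 \<le> u$1" "l$2 \<le> u$2" using lu[OF ax(1)] lu[OF ax(2)] by (auto simp: inner_axis)
  have B2: "(Basis::(real^2) set) = {axis 1 1, axis 2 1}"
    by (auto simp: Basis_vec_def UNIV_2)
  have ne: "(axis 1 1::real^2) \<noteq> axis 2 1" by (simp add: axis_eq_axis)
  have comp: "(c *\<^sub>R axis 1 1 + d *\<^sub>R axis 2 1 :: real^2) $ 1 = c"
    "(c *\<^sub>R axis 1 1 + d *\<^sub>R axis 2 1 :: real^2) $ 2 = d" for c d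
    by (simp_all add: axis_def)
  have vimage: "(\<lambda>z. fst z *\<^sub>R axis 1 1 + snd z *\<^sub>R axis 2 1 :: real^2) -` box l u = box (l$1) (u$1) \<times> box (l$2) (u$2)"
  proof (rule set_eqI)
    fix z :: "real \<times> real"
    show "z \<in> (\<lambda>z. fst z *\<^sub>R axis 1 1 + snd z *\<^sub>R axis 2 1 :: real^2) -` box l u \<longleftrightarrow>
        z \<in> box (l$1) (u$1) \<times> box (l$2) (u$2)"
      unfolding vimage_eq mem_box B2 ball_simps inner_axis comp mem_Times_iff
      by (simp add: inner_axis)
  qed
  have "emeasure (distr lborel lborel (\<lambda>z. fst z *\<^sub>R axis 1 1 + snd z *\<^sub>R axis 2 1 :: real^2)) (box l u)
     = emeasure (lborel \<Otimes>\<^sub>M lborel) (box (l$1) (u$1) \<times> box (l$2) (u$2))"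
    by (subst emeasure_distr[OF measurable_real2]) (simp_all only: vimage space_lborel space_borel Int_UNIV_right lborel_prod sets_lborel box_borel)
  also have "\<dots> = emeasure lborel (box (l$1) (u$1)) * emeasure lborel (box (l$2) (u$2))"
    by (rule lborel.emeasure_pair_measure_Times) auto
  also have "\<dots> = ennreal ((u$1 - l$1) * (u$2 - l$2))"
    using l by (simp add: ennreal_mult)
  also have "(u$1 - l$1) * (u$2 - l$2) = (\<Prod>b\<in>Basis. (u - l) \<bullet> b)"
    unfolding B2 using ne by (simp only: prod.insert finite.intros insert_iff empty_iff prod.empty
        inner_axis vector_minus_component inner_real_def mult_1_right simp_thms)
  finally show "emeasure (distr lborel lborel (\<lambda>z. fst z *\<^sub>R axis 1 1 + snd z *\<^sub>R axis 2 1 :: real^2)) (box l u) = 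
      ennreal (\<Prod>b\<in>Basis. (u - l) \<bullet> b)" .
next
  show "sets (distr lborel lborel (\<lambda>z. fst z *\<^sub>R axis 1 1 + snd z *\<^sub>R axis 2 1 :: real^2)) = sets borel"
    by (simp only: sets_distr sets_lborel)
qed

lemma polar_integral:
  fixes f :: "real^2 \<Rightarrow> real"
  assumes "set_integrable lborel B f"
  shows "set_integrable lborel strip (\<lambda>(t, \<theta>). exp (-2*t) * f (pol t \<theta>))"
    and "(\<integral>x\<in>B. f x \<partial>lborel) = (\<integral>z\<in>strip. (case z of (t, \<theta>) \<Rightarrow> exp (-2*t) * f (pol t \<theta>)) \<partial>lborel)"
proof -
  define S :: "(real^2) set" where "S = {x. 0 < x$1 \<and> 0 < x$2 \<and> x$2 < 2*pi}"
  define g :: "real^2 \<Rightarrow> real^2" where "g = (\<lambda>x. pol (x$1) (x$2))"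
  define F where "F = (\<lambda>x. indicator B x * f x)"
  \<comment> \<open>The change of variables theorem is about integrands with values in a space of
    vectors, so scalar functions are carried along the unit vector c and recovered by an inner
    product with it.\<close>
  define c :: "real^1" where "c = axis 1 1"
  have cc: "c \<bullet> c = 1" by (simp add: c_def inner_axis_axis)
  have F: "integrable lborel F" using assms by (simp add: set_integrable_def F_def)
  have Fm [measurable]: "F \<in> borel_measurable borel" using F by auto
  have "open S" unfolding S_def by (intro open_Collect_conj open_Collect_less continuous_intros)
  then have S: "S \<in> sets lebesgue" "S \<in> sets borel" by auto
  have "x \<in> g ` S" if x: "x \<in> B" "x$2 \<noteq> 0" for x
  proof -
    obtain t \<theta> where "0 < t" "0 < \<theta>" "\<theta> < 2*pi" "x = pol t \<theta>" by (rule pol_surj[OF x])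
    then show ?thesis by (intro image_eqI[of _ _ "vector [t, \<theta>]"]) (auto simp: g_def S_def)
  qed
  then have g: "g ` S \<subseteq> B" "B - g ` S \<subseteq> {x. x$2 = 0}"
    by (auto simp: S_def g_def pol_in_B)
  have inj: "inj_on g S"
  proof (rule inj_onI)
    fix x y assume "x \<in> S" "y \<in> S" "g x = g y"
    then have "x$1 = y$1 \<and> x$2 = y$2" unfolding S_def g_def by (intro pol_inj) auto
    then show "x = y" by (simp add: vec_eq_iff forall_2)
  qed
  have "negligible {x::real^2. x \<bullet> axis 2 1 = 0}"
    by (rule negligible_standard_hyperplane) (simp add: axis_in_Basis_iff)
  then have neg: "negligible (B - g ` S)" by (rule negligible_subset) (use g in \<open>auto simp: inner_axis\<close>)
  have gS: "g ` S \<in> sets lebesgue"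
  proof -
    have "g ` S = B - (B - g ` S)" using g by auto
    moreover have "B \<in> sets lebesgue" using sets_B(2) by (rule sets_completionI_sets)
    moreover have "B - g ` S \<in> sets lebesgue" using neg by (rule negligible_imp_sets)
    ultimately show ?thesis by (metis sets.Diff)
  qed
  let ?g' = "\<lambda>x h. (- exp (-(x$1)) * cos (x$2) * h$1 - exp (-(x$1)) * sin (x$2) * h$2) *\<^sub>R axis 1 1 +
          (- exp (-(x$1)) * sin (x$2) * h$1 + exp (-(x$1)) * cos (x$2) * h$2) *\<^sub>R axis 2 1 :: real^2"
  \<comment> \<open>The Jacobian is -exp (-2 t); its absolute value is the weight in all later polar
    integrals.\<close>
  have det: "\<bar>det (matrix (?g' x))\<bar> = exp (-2 * x$1)" for x :: "real^2"
  proof -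
    have 1: "det (matrix (?g' x)) = - (exp (-(x$1)) * exp (-(x$1))) * (cos (x$2) * cos (x$2) + sin (x$2) * sin (x$2))"
    proof -
      define E c s where "E = exp (-(x$1))" and "c = cos (x$2)" and "s = sin (x$2)"
      show ?thesis unfolding det_2 matrix_def E_def[symmetric] c_def[symmetric] s_def[symmetric]
        by (simp add: axis_def algebra_simps)
    qed
    have "det (matrix (?g' x)) = - exp (-2 * x$1)" unfolding 1 sin_cos_squared_add3 by (simp flip: exp_add)
    then show ?thesis by simp
  qed
  have FgS: "(\<lambda>x. F x *\<^sub>R c) absolutely_integrable_on (g ` S)"
  proof -
    have "(\<lambda>x. F x *\<^sub>R c) absolutely_integrable_on UNIV"
      unfolding set_integrable_def using F by (simp add: integrable_completion)
    then show ?thesis by (rule set_integrable_subset) (use gS in auto)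
  qed
  have "(\<lambda>x. \<bar>det (matrix (?g' x))\<bar> *\<^sub>R (F (g x) *\<^sub>R c)) absolutely_integrable_on S \<and>
           integral S (\<lambda>x. \<bar>det (matrix (?g' x))\<bar> *\<^sub>R (F (g x) *\<^sub>R c)) = integral (g ` S) (\<lambda>x. F x *\<^sub>R c)"
    by (subst has_absolute_integral_change_of_variables[where f="\<lambda>x. F x *\<^sub>R c"])
       (use S inj FgS pol_has_derivative in \<open>auto simp: g_def\<close>)
  then have cov: "(\<lambda>x. (exp (-2 * x$1) * F (g x)) *\<^sub>R c) absolutely_integrable_on S"
     "integral S (\<lambda>x. (exp (-2 * x$1) * F (g x)) *\<^sub>R c) = integral (g ` S) (\<lambda>x. F x *\<^sub>R c)"
    unfolding det by simp_all
  have gm [measurable]: "g \<in> borel_measurable borel" 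
    unfolding g_def pol_def by (intro borel_measurable_continuous_onI continuous_intros)
  define H where "H = (\<lambda>x. indicator S x * (exp (-2 * x$1) * F (g x)))"
  have Hm [measurable]: "H \<in> borel_measurable borel"
    unfolding H_def using S by measurable
  have Hc: "(\<lambda>x. indicator S x *\<^sub>R (exp (-2 * x$1) * F (g x)) *\<^sub>R c) = (\<lambda>x. H x *\<^sub>R c)"
    by (auto simp: H_def)
  have Hi: "integrable lborel H"
  proof -
    have "integrable lebesgue (\<lambda>x. H x *\<^sub>R c)"
      using cov(1) unfolding set_integrable_def Hc .
    then have "integrable lebesgue (\<lambda>x. (H x *\<^sub>R c) \<bullet> c)" by (rule integrable_inner_left)
    then have "integrable lebesgue H" by (simp add: cc)
    then show ?thesis by (simp add: integrable_completion)
  qed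
  have "integral\<^sup>L lborel H = integral\<^sup>L lborel F"
  proof -
    have "integral\<^sup>L lborel H *\<^sub>R c = integral\<^sup>L lebesgue (\<lambda>x. H x *\<^sub>R c)"
      using Hi by (simp add: integral_completion)
    also have "\<dots> = integral S (\<lambda>x. (exp (-2 * x$1) * F (g x)) *\<^sub>R c)"
      using set_lebesgue_integral_eq_integral(2)[OF cov(1)] unfolding set_lebesgue_integral_def Hc by simp
    also have "\<dots> = integral (g ` S) (\<lambda>x. F x *\<^sub>R c)" by (rule cov)
    also have "\<dots> = (\<integral>x. indicator (g ` S) x *\<^sub>R (F x *\<^sub>R c) \<partial>lebesgue)"
      using set_lebesgue_integral_eq_integral(2)[OF FgS] unfolding set_lebesgue_integral_def by simp
    also have "\<dots> = (\<integral>x. F x *\<^sub>R c \<partial>lebesgue)"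
    proof (rule integral_cong_AE)
      have "AE x in lebesgue. x \<notin> B - g ` S" by (rule AE_not_in[OF neg[unfolded negligible_iff_null_sets]])
      then show "AE x in lebesgue. indicator (g ` S) x *\<^sub>R (F x *\<^sub>R c) = F x *\<^sub>R c"
        by eventually_elim (auto simp: indicator_def F_def)
    qed (use FgS in \<open>auto simp: set_integrable_def intro: borel_measurable_integrable measurable_completion\<close>)
    also have "\<dots> = integral\<^sup>L lborel F *\<^sub>R c" using F by (simp add: integral_completion)
    finally show ?thesis by (metis cc inner_zero_left scaleR_right_imp_eq zero_neq_one)
  qed
  let ?p = "\<lambda>z. fst z *\<^sub>R axis 1 1 + snd z *\<^sub>R axis 2 1 :: real^2"
  have Hm': "H \<in> borel_measurable lborel" by simp
  have HP: "(\<lambda>z. H (?p z)) = (\<lambda>z. indicator strip z *\<^sub>R (case z of (t, \<theta>) \<Rightarrow> exp (-2*t) * f (pol t \<theta>)))"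
    by (auto simp: H_def F_def S_def g_def strip_def axis_def indicator_def pol_in_B)
  have "integrable (distr lborel lborel ?p) H" using Hi by (simp add: lborel_real2)
  then have "integrable lborel (\<lambda>z. H (?p z))" by (subst (asm) integrable_distr_eq[OF measurable_real2 Hm'])
  then show "set_integrable lborel strip (\<lambda>(t, \<theta>). exp (-2*t) * f (pol t \<theta>))"
    unfolding set_integrable_def HP .
  have "(\<integral>x\<in>B. f x \<partial>lborel) = integral\<^sup>L lborel F"
    unfolding set_lebesgue_integral_def F_def by simp
  also have "\<dots> = integral\<^sup>L (distr lborel lborel ?p) H"
    unfolding lborel_real2 using \<open>integral\<^sup>L lborel H = integral\<^sup>L lborel F\<close> ..
  also have "\<dots> = (\<integral>z. H (?p z) \<partial>lborel)"
    by (rule integral_distr[OF measurable_real2 Hm'])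
  also have "\<dots> = (\<integral>z\<in>strip. (case z of (t, \<theta>) \<Rightarrow> exp (-2*t) * f (pol t \<theta>)) \<partial>lborel)"
    unfolding set_lebesgue_integral_def HP ..
  finally show "(\<integral>x\<in>B. f x \<partial>lborel) = (\<integral>z\<in>strip. (case z of (t, \<theta>) \<Rightarrow> exp (-2*t) * f (pol t \<theta>)) \<partial>lborel)" .
qed

section \<open>Trigonometric basis and a Wirtinger inequality\<close>

text \<open>Index 0 is the constant; 2k+1 and 2k+2 carry the cosine and the sine of frequency k+1.
  Hence the indices below 2n+1 are exactly the modes of frequency at most n.\<close>

definition freq :: "nat \<Rightarrow> nat" where "freq j = (j + 1) div 2"

definition tb :: "nat \<Rightarrow> real \<Rightarrow> real" where
  "tb j \<theta> = (if j = 0 then 1 / sqrt (2*pi)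
     else if odd j then cos (real (freq j) * \<theta>) / sqrt pi else sin (real (freq j) * \<theta>) / sqrt pi)"

definition dtb :: "nat \<Rightarrow> real \<Rightarrow> real" where
  "dtb j \<theta> = (if j = 0 then 0
     else if odd j then - real (freq j) * tb (j + 1) \<theta> else real (freq j) * tb (j - 1) \<theta>)"

abbreviation IT :: "(real \<Rightarrow> real) \<Rightarrow> real" where "IT f \<equiv> integral {0..2*pi} f"

definition cf :: "(real \<Rightarrow> real) \<Rightarrow> nat \<Rightarrow> real" where
  "cf g j = IT (\<lambda>\<theta>. g \<theta> * tb j \<theta>)"

lemma freq_simps: "freq (2*k + 1) = k + 1" "freq (2*k + 2) = k + 1" "freq 0 = 0"
  by (simp_all add: freq_def)

lemma tb_odd: "tb (2*k + 1) \<theta> = cos (real (k+1) * \<theta>) / sqrt pi"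
  by (simp add: tb_def freq_def)

lemma tb_even: "tb (2*k + 2) \<theta> = sin (real (k+1) * \<theta>) / sqrt pi"
  by (simp add: tb_def freq_def)

lemma tb_0: "tb 0 \<theta> = 1 / sqrt (2*pi)"
  by (simp add: tb_def)

lemma index_cases:
  obtains "j = 0" | k where "j = 2*k + 1" | k where "j = 2*k + (2::nat)"
proof (cases "even j")
  case True
  then obtain i where i: "j = 2*i" by auto
  then show ?thesis using that(1) that(3)[of "i - 1"] by (cases i) auto
next
  case False
  then show ?thesis using that(2) by (auto elim!: oddE)
qed

lemma dtb_odd: "dtb (2*k + 1) \<theta> = - real (k+1) * tb (2*k + 2) \<theta>"
  by (simp add: dtb_def freq_def)

lemma dtb_even: "dtb (2*k + 2) \<theta> = real (k+1) * tb (2*k + 1) \<theta>"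
  by (simp add: dtb_def freq_def)

lemma tb_deriv: "(tb j has_real_derivative dtb j \<theta>) (at \<theta>)"
proof (cases j rule: index_cases)
  case 1
  have "tb 0 = (\<lambda>\<theta>. 1 / sqrt (2*pi))" by (simp add: fun_eq_iff tb_0)
  then show ?thesis using 1 by (simp add: dtb_def)
next
  case (2 k)
  define c where "c = 1 / sqrt pi"
  have "tb (2*k+1) = (\<lambda>\<theta>. c * cos (real (k+1) * \<theta>))" "tb (2*k+2) = (\<lambda>\<theta>. c * sin (real (k+1) * \<theta>))"
    using tb_odd tb_even unfolding c_def by (auto simp: fun_eq_iff)
  then show ?thesis unfolding 2 dtb_odd by (auto intro!: derivative_eq_intros simp: algebra_simps)
next
  case (3 k)
  define c where "c = 1 / sqrt pi"
  have "tb (2*k+1) = (\<lambda>\<theta>. c * cos (real (k+1) * \<theta>))" "tb (2*k+2) = (\<lambda>\<theta>. c * sin (real (k+1) * \<theta>))"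
    using tb_odd tb_even unfolding c_def by (auto simp: fun_eq_iff)
  then show ?thesis unfolding 3 dtb_even by (auto intro!: derivative_eq_intros simp: algebra_simps)
qed

lemma tb_continuous [continuous_intros]: "continuous_on S (tb j)"
  using tb_deriv by (meson DERIV_isCont continuous_at_imp_continuous_on)

lemma dtb_continuous [continuous_intros]: "continuous_on S (dtb j)"
  unfolding dtb_def[abs_def] by (cases "j = 0"; cases "odd j"; simp) (intro continuous_intros)+

lemma tb_periodic: "tb j (2*pi) = tb j 0"
proof (cases j rule: index_cases)
  case (2 k)
  have "cos (real (k+1) * (2*pi)) = 1" using cos_int_2pin[of "int (k+1)"] by (simp add: mult_ac)
  then show ?thesis unfolding 2 tb_odd by simp
next
  case (3 k)
  have "sin (real (k+1) * (2*pi)) = 0" using sin_int_2pin[of "int (k+1)"] by (simp add: mult_ac)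
  then show ?thesis unfolding 3 tb_even by simp
qed (simp add: tb_0)

lemma integral_cos_int: "IT (\<lambda>\<theta>. cos (of_int k * \<theta>)) = (if k = 0 then 2*pi else 0)"
proof (cases "k = 0")
  case False
  have "((\<lambda>\<theta>. cos (of_int k * \<theta>)) has_integral (sin (of_int k * (2*pi)) / of_int k - sin (of_int k * 0) / of_int k)) {0..2*pi}"
    using False by (intro fundamental_theorem_of_calculus)
      (auto intro!: derivative_eq_intros simp flip: has_real_derivative_iff_has_vector_derivative)
  moreover have "sin (of_int k * (2*pi)) = 0" using sin_int_2pin[of k] by (simp add: mult_ac)
  ultimately show ?thesis using False by (simp add: integral_unique)
qed simp

lemma integral_sin_int: "IT (\<lambda>\<theta>. sin (of_int k * \<theta>)) = 0"
proof (cases "k = 0")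
  case False
  have "((\<lambda>\<theta>. sin (of_int k * \<theta>)) has_integral (- cos (of_int k * (2*pi)) / of_int k - - cos (of_int k * 0) / of_int k)) {0..2*pi}"
    using False by (intro fundamental_theorem_of_calculus)
      (auto intro!: derivative_eq_intros simp flip: has_real_derivative_iff_has_vector_derivative)
  moreover have "cos (of_int k * (2*pi)) = 1" using cos_int_2pin[of k] by (simp add: mult_ac)
  ultimately show ?thesis using False by (simp add: integral_unique)
qed simp

lemma integral_trig_products:
  fixes a b :: nat
  shows "IT (\<lambda>\<theta>. cos (real a * \<theta>) * cos (real b * \<theta>)) =
      ((if a = b then 2*pi else 0) + (if a + b = 0 then 2*pi else 0)) / 2"
    and "IT (\<lambda>\<theta>. sin (real a * \<theta>) * sin (real b * \<theta>)) =
      ((if a = b then 2*pi else 0) - (if a + b = 0 then 2*pi else 0)) / 2"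
    and "IT (\<lambda>\<theta>. sin (real a * \<theta>) * cos (real b * \<theta>)) = 0"
    and "IT (\<lambda>\<theta>. cos (real a * \<theta>) * sin (real b * \<theta>)) = 0"
proof -
  define d s where "d = int a - int b" and "s = int a + int b"
  have ds: "real a * \<theta> - real b * \<theta> = of_int d * \<theta>" "real a * \<theta> + real b * \<theta> = of_int s * \<theta>" for \<theta>
    by (simp_all add: d_def s_def algebra_simps)
  have d0: "d = 0 \<longleftrightarrow> a = b" "s = 0 \<longleftrightarrow> a + b = 0" by (auto simp: d_def s_def)
  have i: "(\<lambda>\<theta>. cos (of_int k * \<theta>)) integrable_on {0..2*pi}" "(\<lambda>\<theta>. sin (of_int k * \<theta>)) integrable_on {0..2*pi}" for k
    by (intro integrable_continuous_interval continuous_intros)+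
  show "IT (\<lambda>\<theta>. cos (real a * \<theta>) * cos (real b * \<theta>)) =
      ((if a = b then 2*pi else 0) + (if a + b = 0 then 2*pi else 0)) / 2"
    unfolding cos_times_cos ds integral_divide integral_add[OF i(1) i(1)] integral_cos_int d0 ..
  show "IT (\<lambda>\<theta>. sin (real a * \<theta>) * sin (real b * \<theta>)) =
      ((if a = b then 2*pi else 0) - (if a + b = 0 then 2*pi else 0)) / 2"
    unfolding sin_times_sin ds integral_divide integral_diff[OF i(1) i(1)] integral_cos_int d0 ..
  show "IT (\<lambda>\<theta>. sin (real a * \<theta>) * cos (real b * \<theta>)) = 0"
    unfolding sin_times_cos ds integral_divide integral_add[OF i(2) i(2)] integral_sin_int by simp
  show "IT (\<lambda>\<theta>. cos (real a * \<theta>) * sin (real b * \<theta>)) = 0"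
    unfolding cos_times_sin ds integral_divide integral_diff[OF i(2) i(2)] integral_sin_int by simp
qed

text \<open>The constant is treated as a cosine of frequency 0, only with a different normalisation.
  Orthonormality then reduces to the four products of cosines and sines.\<close>

lemma tb_form:
  obtains c k where "tb j = (\<lambda>\<theta>. c * cos (real k * \<theta>))" "even (j + 1) \<or> j = 0" "k = freq j"
      "c * c * pi = (if j = 0 then 1/2 else 1)"
  | c k where "tb j = (\<lambda>\<theta>. c * sin (real k * \<theta>))" "even j" "j > 0" "k = freq j" "c * c * pi = 1"
proof (cases j rule: index_cases)
  case 1
  have "tb 0 = (\<lambda>\<theta>. (1 / sqrt (2*pi)) * cos (real 0 * \<theta>))" by (simp add: fun_eq_iff tb_0)
  then show ?thesis by (rule that(1)[unfolded 1]) (simp_all add: freq_simps)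
next
  case (2 k)
  have "tb (2*k+1) = (\<lambda>\<theta>. (1 / sqrt pi) * cos (real (k+1) * \<theta>))" using tb_odd by (auto simp: fun_eq_iff)
  then show ?thesis by (rule that(1)[unfolded 2]) (simp_all add: freq_def)
next
  case (3 k)
  have "tb (2*k+2) = (\<lambda>\<theta>. (1 / sqrt pi) * sin (real (k+1) * \<theta>))" using tb_even by (auto simp: fun_eq_iff)
  then show ?thesis by (rule that(2)[unfolded 3]) (simp_all add: freq_def)
qed

lemma freq_inj: "freq i = freq j \<Longrightarrow> even i = even j \<Longrightarrow> i = j"
  unfolding freq_def by presburger

lemma tb_orthonormal: "IT (\<lambda>\<theta>. tb i \<theta> * tb j \<theta>) = (if i = j then 1 else 0)"
proof (cases i rule: tb_form)
  case (1 c k)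
  note i = 1
  show ?thesis
  proof (cases j rule: tb_form)
    case (1 d l)
    have "IT (\<lambda>\<theta>. tb i \<theta> * tb j \<theta>) = IT (\<lambda>\<theta>. (c * d) * (cos (real k * \<theta>) * cos (real l * \<theta>)))"
      unfolding i(1) 1(1) by (simp add: mult_ac)
    also have "\<dots> = c * d * (((if k = l then 2*pi else 0) + (if k + l = 0 then 2*pi else 0)) / 2)"
      unfolding integral_mult_right integral_trig_products ..
    also have "\<dots> = (if i = j then 1 else 0)"
    proof (cases "i = j")
      case True
      have "c = d"
        using fun_cong[OF i(1), of 0] fun_cong[OF 1(1), of 0] True by simp
      moreover have "k + k = 0 \<longleftrightarrow> j = 0" using i(3) True by (auto simp: freq_def)
      ultimately show ?thesis using True i 1 by (auto simp: mult_ac)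
    next
      case False
      have "k \<noteq> l"
      proof
        assume kl: "k = l"
        then have f: "freq i = freq j" using i 1 by simp
        show False
        proof (cases "i = 0 \<or> j = 0")
          case True then show ?thesis using f False by (auto simp: freq_def)
        next
          case F: False then show ?thesis using f i(2) 1(2) freq_inj[of i j] False by simp
        qed
      qed
      then show ?thesis using False by auto
    qed
    finally show ?thesis .
  next
    case (2 d l)
    have "IT (\<lambda>\<theta>. tb i \<theta> * tb j \<theta>) = IT (\<lambda>\<theta>. (c * d) * (cos (real k * \<theta>) * sin (real l * \<theta>)))"
      unfolding i(1) 2(1) by (simp add: mult_ac)
    moreover have "i \<noteq> j" using i 2 by auto
    ultimately show ?thesis unfolding integral_mult_right integral_trig_products by simp
  qed
next
  case (2 c k)
  note i = 2
  show ?thesis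
  proof (cases j rule: tb_form)
    case (1 d l)
    have "IT (\<lambda>\<theta>. tb i \<theta> * tb j \<theta>) = IT (\<lambda>\<theta>. (c * d) * (sin (real k * \<theta>) * cos (real l * \<theta>)))"
      unfolding i(1) 1(1) by (simp add: mult_ac)
    moreover have "i \<noteq> j" using i 1 by auto
    ultimately show ?thesis unfolding integral_mult_right integral_trig_products by simp
  next
    case (2 d l)
    have "IT (\<lambda>\<theta>. tb i \<theta> * tb j \<theta>) = IT (\<lambda>\<theta>. (c * d) * (sin (real k * \<theta>) * sin (real l * \<theta>)))"
      unfolding i(1) 2(1) by (simp add: mult_ac)
    also have "\<dots> = c * d * (((if k = l then 2*pi else 0) - (if k + l = 0 then 2*pi else 0)) / 2)"
      unfolding integral_mult_right integral_trig_products ..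
    also have "\<dots> = (if i = j then 1 else 0)"
    proof (cases "i = j")
      case True
      have k: "k = l" "k > 0" using i 2 True by (auto simp: freq_def)
      \<comment> \<open>Both representations are evaluated at a quarter period to identify the
        amplitudes; at 0 a sine gives no information.\<close>
      have "sin (real k * (pi / (2 * real k))) = 1" using k by simp
      then have "c = d"
        using fun_cong[OF i(1), of "pi / (2 * real k)"] fun_cong[OF 2(1), of "pi / (2 * real k)"] True k by simp
      then show ?thesis using True i 2 k by (auto simp: mult_ac)
    next
      case False
      then have "k \<noteq> l" using i 2 freq_inj[of i j] by auto
      then show ?thesis using False by auto
    qed
    finally show ?thesis .
  qed
qed

text \<open>Leaving the coefficients d free lets one identity serve three purposes: d =
  \<open>cf g\<close> gives Bessel, arbitrary d gives best approximation, and g = 0 gives the norm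
  of a trigonometric polynomial.\<close>

lemma bessel_identity:
  assumes g: "continuous_on {0..2*pi} g"
  shows "IT (\<lambda>\<theta>. (g \<theta> - (\<Sum>j<N. d j * tb j \<theta>))\<^sup>2) =
     IT (\<lambda>\<theta>. (g \<theta>)\<^sup>2) - (\<Sum>j<N. (cf g j)\<^sup>2) + (\<Sum>j<N. (cf g j - d j)\<^sup>2)"
proof -
  have i1: "(\<lambda>\<theta>. (g \<theta>)\<^sup>2) integrable_on {0..2*pi}"
    and i2: "\<And>j. (\<lambda>\<theta>. 2 * d j * (g \<theta> * tb j \<theta>)) integrable_on {0..2*pi}"
    and i3: "\<And>i j. (\<lambda>\<theta>. d i * d j * (tb i \<theta> * tb j \<theta>)) integrable_on {0..2*pi}"
    by (intro integrable_continuous_interval continuous_intros g)+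
  have "(g \<theta> - (\<Sum>j<N. d j * tb j \<theta>))\<^sup>2 = (g \<theta>)\<^sup>2 - (\<Sum>j<N. 2 * d j * (g \<theta> * tb j \<theta>))
      + (\<Sum>i<N. \<Sum>j<N. d i * d j * (tb i \<theta> * tb j \<theta>))" for \<theta>
  proof -
    have "(\<Sum>j<N. d j * tb j \<theta>)\<^sup>2 = (\<Sum>i<N. \<Sum>j<N. d i * d j * (tb i \<theta> * tb j \<theta>))"
      unfolding power2_eq_square sum_product by (intro sum.cong) auto
    moreover have "2 * g \<theta> * (\<Sum>j<N. d j * tb j \<theta>) = (\<Sum>j<N. 2 * d j * (g \<theta> * tb j \<theta>))"
      unfolding sum_distrib_left by (intro sum.cong) auto
    ultimately show ?thesis unfolding power2_diff by simp
  qed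
  then have "IT (\<lambda>\<theta>. (g \<theta> - (\<Sum>j<N. d j * tb j \<theta>))\<^sup>2) =
     IT (\<lambda>\<theta>. (g \<theta>)\<^sup>2 - (\<Sum>j<N. 2 * d j * (g \<theta> * tb j \<theta>)) + (\<Sum>i<N. \<Sum>j<N. d i * d j * (tb i \<theta> * tb j \<theta>)))"
    by simp
  also have "\<dots> = IT (\<lambda>\<theta>. (g \<theta>)\<^sup>2) - (\<Sum>j<N. 2 * d j * cf g j) + (\<Sum>i<N. \<Sum>j<N. d i * d j * (if i = j then 1 else 0))"
    by (subst integral_add, (intro integrable_diff integrable_sum i1 i2 i3 finite_lessThan)+,
        subst integral_diff, (intro integrable_diff integrable_sum i1 i2 i3 finite_lessThan)+,
        simp add: integral_sum i2 i3 integrable_sum integral_mult_right tb_orthonormal cf_def del: mult_if_delta)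
  also have "(\<Sum>i<N. \<Sum>j<N. d i * d j * (if i = j then 1 else 0)) = (\<Sum>j<N. (d j)\<^sup>2)"
    by (intro sum.cong) (auto simp: if_distrib power2_eq_square cong: if_cong)
  finally show ?thesis
    by (simp add: power2_diff sum.distrib sum_subtractf algebra_simps)
qed

lemma bessel:
  assumes "continuous_on {0..2*pi} g"
  shows "(\<Sum>j<N. (cf g j)\<^sup>2) \<le> IT (\<lambda>\<theta>. (g \<theta>)\<^sup>2)"
proof -
  have "0 \<le> IT (\<lambda>\<theta>. (g \<theta> - (\<Sum>j<N. cf g j * tb j \<theta>))\<^sup>2)"
    by (intro integral_nonneg integrable_continuous_interval continuous_intros assms) auto
  then show ?thesis unfolding bessel_identity[OF assms] by simp
qed

section \<open>Density of trigonometric polynomials on circles\<close>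

definition trig :: "(real \<Rightarrow> real) \<Rightarrow> bool" where
  "trig T \<longleftrightarrow> (\<exists>N d. T = (\<lambda>\<theta>. \<Sum>j<N. d j * tb j \<theta>))"

lemma trig_extend:
  assumes "M \<ge> (N::nat)"
  shows "(\<Sum>j<N. d j * tb j \<theta>) = (\<Sum>j<M. (if j < N then d j else 0) * tb j \<theta>)"
  using assms by (intro sum.mono_neutral_cong_left) auto

lemma trig_add:
  assumes "trig f" "trig g"
  shows "trig (\<lambda>x. f x + g x)"
proof -
  obtain N d where f: "f = (\<lambda>\<theta>. \<Sum>j<N. d j * tb j \<theta>)" using assms by (auto simp: trig_def)
  obtain M e where g: "g = (\<lambda>\<theta>. \<Sum>j<M. e j * tb j \<theta>)" using assms by (auto simp: trig_def)
  have "f x + g x = (\<Sum>j<max M N. ((if j < N then d j else 0) + (if j < M then e j else 0)) * tb j x)" for x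
  proof -
    have "f x = (\<Sum>j<max M N. (if j < N then d j else 0) * tb j x)"
      "g x = (\<Sum>j<max M N. (if j < M then e j else 0) * tb j x)"
      unfolding f g by (rule trig_extend, simp)+
    then show ?thesis by (simp only: sum.distrib distrib_right)
  qed
  then have *: "(\<lambda>x. f x + g x) = (\<lambda>x. \<Sum>j<max M N. (\<lambda>j. (if j < N then d j else 0) + (if j < M then e j else 0)) j * tb j x)"
    by (intro ext)
  show ?thesis unfolding trig_def
    by (rule exI[of _ "max M N"], rule exI[of _ "\<lambda>j. (if j < N then d j else 0) + (if j < M then e j else 0)"]) (rule *)
qed

lemma trig_scale: "trig f \<Longrightarrow> trig (\<lambda>x. c * f x)"
  unfolding trig_def
proof (elim exE)
  fix N d assume "f = (\<lambda>\<theta>. \<Sum>j<N. d j * tb j \<theta>)"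
  then show "\<exists>N d. (\<lambda>x. c * f x) = (\<lambda>\<theta>. \<Sum>j<N. d j * tb j \<theta>)"
    by (intro exI[of _ N] exI[of _ "\<lambda>j. c * d j"]) (simp add: sum_distrib_left mult.assoc)
qed

lemma trig_tb: "trig (tb j)"
  unfolding trig_def
  by (intro exI[of _ "Suc j"] exI[of _ "\<lambda>i. if i = j then 1 else 0"]) (simp add: fun_eq_iff)

lemma trig_const: "trig (\<lambda>x. c)"
  using trig_scale[OF trig_tb[of 0], of "c * sqrt (2*pi)"] by (simp add: tb_0)

lemma trig_cos_nat: "trig (\<lambda>\<theta>. cos (real k * \<theta>))"
proof (cases k)
  case (Suc l)
  have "(\<lambda>\<theta>. cos (real k * \<theta>)) = (\<lambda>\<theta>. sqrt pi * tb (2*l+1) \<theta>)"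
    unfolding tb_odd Suc by simp
  then show ?thesis using trig_scale[OF trig_tb] by presburger
qed (simp add: trig_const)

lemma trig_sin_nat: "trig (\<lambda>\<theta>. sin (real k * \<theta>))"
proof (cases k)
  case (Suc l)
  have "(\<lambda>\<theta>. sin (real k * \<theta>)) = (\<lambda>\<theta>. sqrt pi * tb (2*l+2) \<theta>)"
    unfolding tb_even Suc by simp
  then show ?thesis using trig_scale[OF trig_tb] by presburger
qed (simp add: trig_const)

lemma trig_cos_int: "trig (\<lambda>\<theta>. cos (of_int k * \<theta>))"
proof (cases "k \<ge> 0")
  case True then show ?thesis using trig_cos_nat[of "nat k"] by simp
next
  case False
  then have "of_int k * \<theta> = - (real (nat (-k)) * \<theta>)" for \<theta> :: real by simp
  then have "(\<lambda>\<theta>. cos (of_int k * \<theta>)) = (\<lambda>\<theta>. cos (real (nat (-k)) * \<theta>))" by (simp only: cos_minus)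
  then show ?thesis using trig_cos_nat[of "nat (-k)"] by (simp only:)
qed

lemma trig_sin_int: "trig (\<lambda>\<theta>. sin (of_int k * \<theta>))"
proof (cases "k \<ge> 0")
  case True then show ?thesis using trig_sin_nat[of "nat k"] by simp
next
  case False
  then have "of_int k * \<theta> = - (real (nat (-k)) * \<theta>)" for \<theta> :: real by simp
  then have "(\<lambda>\<theta>. sin (of_int k * \<theta>)) = (\<lambda>\<theta>. -1 * sin (real (nat (-k)) * \<theta>))"
    by (simp only: sin_minus mult_minus1)
  then show ?thesis using trig_scale[OF trig_sin_nat, of "-1" "nat (-k)"] by (simp only:)
qed

lemma trig_products:
  fixes a b :: nat
  shows "trig (\<lambda>\<theta>. cos (real a * \<theta>) * cos (real b * \<theta>))"
    and "trig (\<lambda>\<theta>. sin (real a * \<theta>) * sin (real b * \<theta>))"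
    and "trig (\<lambda>\<theta>. sin (real a * \<theta>) * cos (real b * \<theta>))"
    and "trig (\<lambda>\<theta>. cos (real a * \<theta>) * sin (real b * \<theta>))"
proof -
  define d s where "d = int a - int b" and "s = int a + int b"
  have ds: "real a * \<theta> - real b * \<theta> = of_int d * \<theta>" "real a * \<theta> + real b * \<theta> = of_int s * \<theta>" for \<theta>
    by (simp_all add: d_def s_def algebra_simps)
  note C = trig_scale[OF trig_cos_int, of "1/2"] trig_scale[OF trig_cos_int, of "-1/2"]
  note S = trig_scale[OF trig_sin_int, of "1/2"] trig_scale[OF trig_sin_int, of "-1/2"]
  show "trig (\<lambda>\<theta>. cos (real a * \<theta>) * cos (real b * \<theta>))"
    unfolding cos_times_cos ds using trig_add[OF C(1)[of d] C(1)[of s]] by (simp add: add_divide_distrib)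
  show "trig (\<lambda>\<theta>. sin (real a * \<theta>) * sin (real b * \<theta>))"
    unfolding sin_times_sin ds using trig_add[OF C(1)[of d] C(2)[of s]] by (simp add: diff_divide_distrib)
  show "trig (\<lambda>\<theta>. sin (real a * \<theta>) * cos (real b * \<theta>))"
    unfolding sin_times_cos ds using trig_add[OF S(1)[of s] S(1)[of d]] by (simp add: add_divide_distrib)
  show "trig (\<lambda>\<theta>. cos (real a * \<theta>) * sin (real b * \<theta>))"
    unfolding cos_times_sin ds using trig_add[OF S(1)[of s] S(2)[of d]] by (simp add: diff_divide_distrib)
qed

lemma trig_tb_mult: "trig (\<lambda>\<theta>. tb i \<theta> * tb j \<theta>)"
proof -
  have *: "trig (\<lambda>\<theta>. (c * f \<theta>) * (d * g \<theta>))" if "trig (\<lambda>\<theta>. f \<theta> * g \<theta>)" for c d f g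
    using trig_scale[OF that, of "c * d"] by (simp add: mult_ac)
  show ?thesis
    by (cases i rule: tb_form; cases j rule: tb_form) (auto intro!: * trig_products)
qed

lemma trig_sum: "finite I \<Longrightarrow> (\<And>i. i \<in> I \<Longrightarrow> trig (f i)) \<Longrightarrow> trig (\<lambda>x. \<Sum>i\<in>I. f i x)"
  by (induction I rule: finite_induct) (auto intro: trig_const trig_add)

lemma trig_mult:
  assumes "trig f" "trig g"
  shows "trig (\<lambda>x. f x * g x)"
proof -
  obtain N d where f: "f = (\<lambda>\<theta>. \<Sum>j<N. d j * tb j \<theta>)" using assms by (auto simp: trig_def)
  obtain M e where g: "g = (\<lambda>\<theta>. \<Sum>j<M. e j * tb j \<theta>)" using assms by (auto simp: trig_def)
  have "(\<lambda>x. f x * g x) = (\<lambda>x. \<Sum>i<N. \<Sum>j<M. (d i * e j) * (tb i x * tb j x))"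
    unfolding f g sum_product by (intro ext sum.cong) auto
  then show ?thesis by (simp only:) (intro trig_sum trig_scale trig_tb_mult finite_lessThan)
qed

lemma trig_polynomial: "real_polynomial_function p \<Longrightarrow> trig (\<lambda>\<theta>. p (pol t \<theta>))"
proof (induction rule: real_polynomial_function.induct)
  case (linear f)
  interpret bounded_linear f by fact
  have "f (pol t \<theta>) = exp (-t) * f (axis 1 1) * cos (real 1 * \<theta>) + exp (-t) * f (axis 2 1) * sin (real 1 * \<theta>)" for \<theta>
    unfolding pol_def by (simp add: add scaleR)
  then show ?case by (simp only:) (intro trig_add trig_scale trig_cos_nat trig_sin_nat)
qed (rule trig_const trig_add trig_mult; assumption)+

text \<open>A polynomial in the plane restricts to a trigonometric polynomial on each circle around
  the origin. Weierstrass approximation on a disc therefore replaces a Fejer argument.\<close>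

lemma trig_dense:
  assumes "continuous_on UNIV \<phi>" "e > 0"
  obtains T where "trig T" "\<And>\<theta>. \<bar>\<phi> (pol t \<theta>) - T \<theta>\<bar> < e"
proof -
  have c: "continuous_on (cball 0 (exp (-t))) \<phi>" by (rule continuous_on_subset[OF assms(1)]) simp
  obtain q where q: "real_polynomial_function q" "\<And>x. x \<in> cball 0 (exp (-t)) \<Longrightarrow> \<bar>\<phi> x - q x\<bar> < e"
    using Stone_Weierstrass_real_polynomial_function[OF compact_cball c assms(2)] by blast
  have "\<bar>\<phi> (pol t \<theta>) - q (pol t \<theta>)\<bar> < e" for \<theta> by (rule q(2)) simp
  with trig_polynomial[OF q(1)] show thesis by (rule that)
qed

section \<open>Fourier coefficients of derivatives and a Wirtinger inequality\<close>

lemma cf_deriv: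
  assumes der: "\<And>\<theta>. (g has_real_derivative g' \<theta>) (at \<theta>)" and g': "continuous_on UNIV g'"
    and per: "g (2*pi) = g 0"
  shows "cf g' j = - IT (\<lambda>\<theta>. g \<theta> * dtb j \<theta>)"
proof -
  have g: "continuous_on UNIV g" using der by (meson DERIV_isCont continuous_at_imp_continuous_on)
  have "((\<lambda>\<theta>. g \<theta> * tb j \<theta>) has_real_derivative (g' \<theta> * tb j \<theta> + g \<theta> * dtb j \<theta>)) (at \<theta> within {0..2*pi})" for \<theta>
    by (rule has_field_derivative_at_within, rule DERIV_cong[OF DERIV_mult[OF der tb_deriv]])
       (simp only: mult.commute)
  then have "((\<lambda>\<theta>. g' \<theta> * tb j \<theta> + g \<theta> * dtb j \<theta>) has_integral (g (2*pi) * tb j (2*pi) - g 0 * tb j 0)) {0..2*pi}"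
    unfolding has_real_derivative_iff_has_vector_derivative
    by (intro fundamental_theorem_of_calculus) simp_all
  then have "IT (\<lambda>\<theta>. g' \<theta> * tb j \<theta> + g \<theta> * dtb j \<theta>) = 0"
    unfolding per tb_periodic by (simp only: integral_unique diff_self)
  moreover have "IT (\<lambda>\<theta>. g' \<theta> * tb j \<theta> + g \<theta> * dtb j \<theta>) = cf g' j + IT (\<lambda>\<theta>. g \<theta> * dtb j \<theta>)"
    unfolding cf_def
    by (intro integral_add integrable_continuous_interval continuous_intros continuous_on_subset[OF g] continuous_on_subset[OF g']) auto
  ultimately show ?thesis by simp
qed

lemma sum_lessThan_add_two:
  fixes F :: "nat \<Rightarrow> real"
  shows "sum F {..<2 * Suc k + 1} = sum F {..<2*k+1} + (F (2*k+1) + F (2*k+2))"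
proof -
  have "sum F {..<Suc (Suc i)} = sum F {..<i} + (F i + F (Suc i))" for i
    by (simp add: add.assoc)
  from this[of "2*k+1"] show ?thesis by simp
qed

text \<open>Differentiation exchanges the cosine and sine coefficients of equal frequency up to
  factor and sign. The sums agree because the cut at 2K+1 never separates such a pair.\<close>

lemma parseval_deriv:
  assumes der: "\<And>\<theta>. (g has_real_derivative g' \<theta>) (at \<theta>)" and g': "continuous_on UNIV g'"
    and per: "g (2*pi) = g 0"
  shows "(\<Sum>j<2*K+1. (cf g' j)\<^sup>2) = (\<Sum>j<2*K+1. (real (freq j) * cf g j)\<^sup>2)"
proof (induction K)
  case 0
  have "cf g' 0 = 0" using cf_deriv[OF assms, of 0] by (simp add: dtb_def)
  then show ?case by (simp add: freq_def)
next
  case (Suc K)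
  have "cf g' (2*K+1) = real (K+1) * cf g (2*K+2)" "cf g' (2*K+2) = - (real (K+1) * cf g (2*K+1))"
    using cf_deriv[OF assms, of "2*K+1"] cf_deriv[OF assms, of "2*K+2"]
    unfolding dtb_odd dtb_even cf_def
    by (simp_all only: mult.left_commute[of "g _"] integral_mult_right)
  then have pair: "(cf g' (2*K+1))\<^sup>2 + (cf g' (2*K+2))\<^sup>2 = (real (freq (2*K+1)) * cf g (2*K+1))\<^sup>2 + (real (freq (2*K+2)) * cf g (2*K+2))\<^sup>2"
    unfolding freq_simps by (simp only: power_mult_distrib power2_minus add.commute)
  show ?case
    by (rule trans[OF sum_lessThan_add_two[where F="\<lambda>j. (cf g' j)\<^sup>2"]],
        rule trans[OF arg_cong2[where f="(+)", OF Suc.IH pair]],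
        rule sum_lessThan_add_two[where F="\<lambda>j. (real (freq j) * cf g j)\<^sup>2", symmetric])
qed

lemma le_lim_at_right_0:
  fixes f :: "real \<Rightarrow> real"
  assumes lim: "(f \<longlongrightarrow> l) (at_right 0)" and le: "\<And>e. e > 0 \<Longrightarrow> a \<le> f e"
  shows "a \<le> l"
proof (rule tendsto_lowerbound[OF lim])
  show "\<forall>\<^sub>F e in at_right 0. a \<le> f e"
    by (rule eventually_mono[OF eventually_at_right_less[of 0]]) (rule le)
qed simp

text \<open>High modes have frequency at least n+1, which gives the inequality for finitely many of
  them through \<open>parseval_deriv\<close> and Bessel for g'. Uniform approximation by T shows
  that the modes left out carry at most 2 pi e^2 of the norm, so no infinite series is
  needed.\<close>

lemma wirtinger:
  assumes der: "\<And>\<theta>. (g has_real_derivative g' \<theta>) (at \<theta>)" and g': "continuous_on UNIV g'"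
    and per: "g (2*pi) = g 0"
    and dense: "\<And>e. e > 0 \<Longrightarrow> \<exists>T. trig T \<and> (\<forall>\<theta>. \<bar>g \<theta> - T \<theta>\<bar> < e)"
  shows "(real n + 1)\<^sup>2 * (IT (\<lambda>\<theta>. (g \<theta>)\<^sup>2) - (\<Sum>j<2*n+1. (cf g j)\<^sup>2)) \<le> IT (\<lambda>\<theta>. (g' \<theta>)\<^sup>2)"
proof -
  have g: "continuous_on UNIV g" using der by (meson DERIV_isCont continuous_at_imp_continuous_on)
  have gc: "continuous_on {0..2*pi} g" "continuous_on {0..2*pi} g'"
    using g g' continuous_on_subset by blast+
  have main: "(real n + 1)\<^sup>2 * (IT (\<lambda>\<theta>. (g \<theta>)\<^sup>2) - (\<Sum>j<2*n+1. (cf g j)\<^sup>2)) \<le> IT (\<lambda>\<theta>. (g' \<theta>)\<^sup>2) + (real n + 1)\<^sup>2 * (2*pi*e\<^sup>2)"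
    if "e > 0" for e
  proof -
    obtain T where T: "trig T" "\<And>\<theta>. \<bar>g \<theta> - T \<theta>\<bar> < e" using dense[OF \<open>e > 0\<close>] by blast
    obtain N d where Td: "T = (\<lambda>\<theta>. \<Sum>j<N. d j * tb j \<theta>)" using T(1) by (auto simp: trig_def)
    \<comment> \<open>Large enough to contain all modes of T as well as the low modes.\<close>
    define K where "K = N + n"
    define A where "A = (\<Sum>j<2*K+1. (cf g j)\<^sup>2)"
    have T2: "T \<theta> = (\<Sum>j<2*K+1. (if j < N then d j else 0) * tb j \<theta>)" for \<theta>
      unfolding Td by (rule trig_extend) (simp add: K_def)
    have "IT (\<lambda>\<theta>. (g \<theta>)\<^sup>2) - A \<le> IT (\<lambda>\<theta>. (g \<theta> - T \<theta>)\<^sup>2)"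
      unfolding T2 bessel_identity[OF gc(1)] A_def by (simp add: sum_nonneg)
    also have "\<dots> \<le> IT (\<lambda>\<theta>. e\<^sup>2)"
    proof (intro integral_le integrable_continuous_interval)
      show "continuous_on {0..2*pi} (\<lambda>\<theta>. (g \<theta> - T \<theta>)\<^sup>2)" unfolding Td by (intro continuous_intros gc)
      fix \<theta> show "(g \<theta> - T \<theta>)\<^sup>2 \<le> e\<^sup>2" using T(2)[of \<theta>] by (intro power2_le_iff_abs_le[THEN iffD2]) auto
    qed auto
    finally have 1: "IT (\<lambda>\<theta>. (g \<theta>)\<^sup>2) - A \<le> 2*pi*e\<^sup>2" by simp
    have split: "{..<2*K+1} = {..<2*n+1} \<union> {2*n+1..<2*K+1}" by (auto simp: K_def)
    have A2: "A = (\<Sum>j<2*n+1. (cf g j)\<^sup>2) + (\<Sum>j=2*n+1..<2*K+1. (cf g j)\<^sup>2)"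
      unfolding A_def split by (rule sum.union_disjoint) auto
    have "(real n + 1)\<^sup>2 * (\<Sum>j=2*n+1..<2*K+1. (cf g j)\<^sup>2) \<le> (\<Sum>j=2*n+1..<2*K+1. (real (freq j) * cf g j)\<^sup>2)"
      unfolding sum_distrib_left power_mult_distrib
    proof (intro sum_mono mult_right_mono power_mono)
      fix j assume "j \<in> {2*n+1..<2*K+1}"
      then have "n + 1 \<le> freq j" by (auto simp: freq_def)
      then show "real n + 1 \<le> real (freq j)" by linarith
    qed auto
    also have "\<dots> \<le> (\<Sum>j<2*K+1. (real (freq j) * cf g j)\<^sup>2)"
      by (intro sum_mono2) auto
    also have "\<dots> = (\<Sum>j<2*K+1. (cf g' j)\<^sup>2)" using parseval_deriv[OF der g' per] ..
    also have "\<dots> \<le> IT (\<lambda>\<theta>. (g' \<theta>)\<^sup>2)" by (rule bessel[OF gc(2)])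
    finally have 2: "(real n + 1)\<^sup>2 * (\<Sum>j=2*n+1..<2*K+1. (cf g j)\<^sup>2) \<le> IT (\<lambda>\<theta>. (g' \<theta>)\<^sup>2)" .
    have "(real n + 1)\<^sup>2 * (IT (\<lambda>\<theta>. (g \<theta>)\<^sup>2) - (\<Sum>j<2*n+1. (cf g j)\<^sup>2)) =
        (real n + 1)\<^sup>2 * (\<Sum>j=2*n+1..<2*K+1. (cf g j)\<^sup>2) + (real n + 1)\<^sup>2 * (IT (\<lambda>\<theta>. (g \<theta>)\<^sup>2) - A)"
      unfolding A2 by (simp add: algebra_simps)
    moreover have "(real n + 1)\<^sup>2 * (IT (\<lambda>\<theta>. (g \<theta>)\<^sup>2) - A) \<le> (real n + 1)\<^sup>2 * (2*pi*e\<^sup>2)"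
      by (intro mult_left_mono 1) simp
    ultimately show ?thesis using 2 by linarith
  qed
  have lim: "((\<lambda>e. IT (\<lambda>\<theta>. (g' \<theta>)\<^sup>2) + (real n + 1)\<^sup>2 * (2*pi*e\<^sup>2)) \<longlongrightarrow> IT (\<lambda>\<theta>. (g' \<theta>)\<^sup>2)) (at_right 0)"
    by (intro tendsto_eq_intros) auto
  show ?thesis by (rule le_lim_at_right_0[OF lim main])
qed

section \<open>The radial equation in logarithmic coordinates\<close>

lemma tendsto_le_at_top:
  fixes f :: "real \<Rightarrow> real"
  assumes "(f \<longlongrightarrow> l) at_top"
  shows "(\<And>b. t \<le> b \<Longrightarrow> f b \<le> a) \<Longrightarrow> l \<le> a" "(\<And>b. t \<le> b \<Longrightarrow> a \<le> f b) \<Longrightarrow> a \<le> l"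
  by (rule tendsto_upperbound[OF assms], rule eventually_mono[OF eventually_ge_at_top[of t]], simp, simp)
     (rule tendsto_lowerbound[OF assms], rule eventually_mono[OF eventually_ge_at_top[of t]], simp, simp)

text \<open>K stands for w'. Boundedness of w and K \<rightarrow> 0 at infinity express regularity
  of the solution at the origin of the disc, w 0 = 0 is the boundary condition, and m is 1 +
  \<alpha>/2.\<close>

locale emden =
  fixes m p :: real and w K :: "real \<Rightarrow> real"
  assumes m1: "m \<ge> 1" and p1: "p > 1"
    and w_deriv: "\<And>t. t > 0 \<Longrightarrow> (w has_real_derivative K t) (at t)"
    and K_deriv: "\<And>t. t > 0 \<Longrightarrow> (K has_real_derivative - (exp (-2*m*t) * w t powr p)) (at t)"
    and w_0: "w 0 = 0" and w_cont: "continuous_on {0..} w" and K_cont: "continuous_on {0..} K"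
    and w_pos: "\<And>t. t > 0 \<Longrightarrow> w t > 0"
    and w_bdd: "\<exists>M. \<forall>t\<ge>0. w t \<le> M"
    and K_lim: "(K \<longlongrightarrow> 0) at_top"
begin

definition V :: "real \<Rightarrow> real" where "V t = p * (exp (-2*m*t) * w t powr (p - 1))"

lemma w_nonneg: "t \<ge> 0 \<Longrightarrow> w t \<ge> 0"
  using w_pos w_0 by (cases "t = 0") (auto simp: less_imp_le)

lemma cont_sub: "0 \<le> a \<Longrightarrow> continuous_on {a..b} w" "0 \<le> a \<Longrightarrow> continuous_on {a..b} K"
  using w_cont K_cont by (auto elim: continuous_on_subset)

lemma V_cont: "continuous_on {0..} V"
proof -
  have "continuous_on {0..} (\<lambda>t. w t powr (p - 1))"
    by (rule continuous_on_powr'[OF w_cont continuous_on_const]) (use p1 w_nonneg in auto)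
  then show ?thesis unfolding V_def[abs_def] by (intro continuous_on_mult continuous_on_const continuous_on_exp continuous_on_id)
qed

lemma K_antimono:
  assumes "0 \<le> a" "a \<le> b" shows "K b \<le> K a"
proof (rule DERIV_nonpos_imp_decreasing_open[OF assms(2)])
  show "\<exists>y. (K has_real_derivative y) (at x) \<and> y \<le> 0" if "a < x" "x < b" for x
    using K_deriv[of x] assms that by (intro exI[of _ "- (exp (-2*m*x) * w x powr p)"]) auto
qed (use assms cont_sub in auto)

lemma K_pos: 
  assumes "t > 0" shows "K t > 0"
proof -
  have "0 < K t"
  proof (rule DERIV_neg_imp_decreasing_at_top[OF _ K_lim])
    fix x assume "t \<le> x"
    then show "\<exists>y. (K has_real_derivative y) (at x) \<and> y < 0"
      using K_deriv[of x] assms w_pos[of x] by (intro exI[of _ "- (exp (-2*m*x) * w x powr p)"]) auto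
  qed
  then show ?thesis .
qed

lemma K0_pos: "K 0 > 0"
  using K_pos[of 1] K_antimono[of 0 1] by simp

lemma w_mono:
  assumes "0 \<le> a" "a \<le> b" shows "w a \<le> w b"
proof (rule DERIV_nonneg_imp_increasing_open[OF assms(2)])
  show "\<exists>y. (w has_real_derivative y) (at x) \<and> y \<ge> 0" if "a < x" "x < b" for x
    using w_deriv[of x] K_pos[of x] assms that by (intro exI[of _ "K x"]) auto
qed (use assms cont_sub in auto)

lemma w_le_K0:
  assumes "0 \<le> t" shows "w t \<le> K 0 * t"
proof -
  have "K 0 * 0 - w 0 \<le> K 0 * t - w t"
  proof (rule DERIV_nonneg_imp_increasing_open[OF assms, of "\<lambda>t. K 0 * t - w t"])
    show "\<exists>y. ((\<lambda>t. K 0 * t - w t) has_real_derivative y) (at x) \<and> y \<ge> 0" if "0 < x" "x < t" for x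
      using K_antimono[of 0 x] that
      by (intro exI[of _ "K 0 - K x"]) (auto intro!: derivative_eq_intros w_deriv)
  qed (intro continuous_intros cont_sub, simp)
  then show ?thesis using w_0 by simp
qed

lemma w_powr_deriv:
  assumes "t > 0"
  shows "((\<lambda>t. w t powr r) has_real_derivative r * w t powr (r - 1) * K t) (at t)"
  using DERIV_chain2[OF has_real_derivative_powr[OF w_pos[OF assms], of r] w_deriv[OF assms]] .

lemma w_powr_split:
  assumes "t > 0" shows "w t powr p = w t powr (p - 1) * w t"
  using w_pos[OF assms] powr_add[of "w t" "p-1" 1] by simp

lemma ew_deriv:
  assumes "t > 0"
  shows "((\<lambda>t. exp (-2*m*t) * w t powr p) has_real_derivative
     (V t * K t - 2 * m * (exp (-2*m*t) * w t powr p))) (at t)"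
  by (rule derivative_eq_intros w_powr_deriv assms refl | simp add: V_def algebra_simps)+

lemma exp_lim: "((\<lambda>t. exp (-2*m*t)) \<longlongrightarrow> 0) at_top"
proof -
  have "filterlim (\<lambda>t. (2*m) * t) at_top at_top"
    using m1 by (intro filterlim_tendsto_pos_mult_at_top[OF tendsto_const]) (auto intro: filterlim_ident)
  then have "filterlim (\<lambda>t. - ((2*m) * t)) at_bot at_top"
    by (simp add: filterlim_uminus_at_bot)
  then show ?thesis using filterlim_compose[OF exp_at_bot] by simp
qed

lemma w_bound:
  obtains M where "M > 0" "\<And>t. t \<ge> 0 \<Longrightarrow> w t \<le> M"
proof -
  obtain M where M: "\<forall>t\<ge>0. w t \<le> M" using w_bdd by blast
  then have "M \<ge> w 1" by simp
  then have "M > 0" using w_pos[of 1] by simp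
  then show thesis using that[of M] M by blast
qed

text \<open>The difference \<open>?D\<close> has derivative -V K \<le> 0 and tends to 0 at infinity,
  hence is nonnegative. It yields the lower bound -m for q and drives \<open>decay\<close>.\<close>

lemma K_lower:
  assumes t: "t > 0" shows "exp (-2*m*t) * w t powr p \<le> 2*m * K t"
proof -
  obtain M where M: "M > 0" "\<And>t. t \<ge> 0 \<Longrightarrow> w t \<le> M" using w_bound by blast
  let ?D = "\<lambda>t. 2*m * K t - exp (-2*m*t) * w t powr p"
  have dec: "?D b \<le> ?D t" if "t \<le> b" for b
  proof (rule DERIV_nonpos_imp_nonincreasing[OF that])
    fix x assume x: "t \<le> x" "x \<le> b"
    then have "x > 0" using t by simp
    then have "(?D has_real_derivative 2*m * (- (exp (-2*m*x) * w x powr p)) - (V x * K x - 2*m*(exp (-2*m*x) * w x powr p))) (at x)"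
      by (intro DERIV_diff DERIV_cmult K_deriv ew_deriv)
    moreover have "V x * K x \<ge> 0" using K_pos[OF \<open>x > 0\<close>] p1 by (simp add: V_def)
    ultimately show "\<exists>y. (?D has_real_derivative y) (at x) \<and> y \<le> 0"
      by (intro exI conjI) (assumption, simp)
  qed
  have "((\<lambda>t. exp (-2*m*t) * w t powr p) \<longlongrightarrow> 0) at_top"
  proof (rule tendsto_sandwich[where f="\<lambda>_. 0" and h="\<lambda>t. exp (-2*m*t) * M powr p"])
    show "((\<lambda>t. exp (-2*m*t) * M powr p) \<longlongrightarrow> 0) at_top" by (rule tendsto_mult_left_zero[OF exp_lim])
    show "\<forall>\<^sub>F t in at_top. exp (-2*m*t) * w t powr p \<le> exp (-2*m*t) * M powr p"
      using eventually_ge_at_top[of 0]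
    proof eventually_elim
      case (elim t)
      then have "w t powr p \<le> M powr p" using M(2)[of t] w_nonneg[of t] p1 by (intro powr_mono2) simp_all
      then show ?case by (intro mult_left_mono) simp_all
    qed
  qed auto
  then have "(?D \<longlongrightarrow> 2*m*0 - 0) at_top" by (intro tendsto_intros K_lim)
  then have "?D t \<ge> 2*m*0-0"
    by (rule tendsto_le_at_top(1)) (rule dec)
  then show ?thesis by simp
qed

text \<open>Here the difference increases to 0 because w stays below M. Consequently z = exp (m t) K
  decays like exp (-m t), which makes cutting z off far out almost free.\<close>

lemma K_upper:
  obtains C where "C > 0" "\<And>t. t > 0 \<Longrightarrow> K t \<le> C * exp (-2*m*t)"
proof -
  obtain M where M: "M > 0" "\<And>t. t \<ge> 0 \<Longrightarrow> w t \<le> M" using w_bound by blast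
  let ?D = "\<lambda>t. K t - M powr p / (2*m) * exp (-2*m*t)"
  have "?D t \<le> 0" if t: "t > 0" for t
  proof -
    have inc: "?D t \<le> ?D b" if "t \<le> b" for b
    proof (rule DERIV_nonneg_imp_nondecreasing[OF that])
      fix x assume x: "t \<le> x" "x \<le> b"
      then have "x > 0" using t by simp
      then have "(?D has_real_derivative - (exp (-2*m*x) * w x powr p) - M powr p / (2*m) * (exp (-2*m*x) * (-2*m))) (at x)"
        by (intro DERIV_diff DERIV_cmult K_deriv) (auto intro!: derivative_eq_intros)
      moreover have "- (exp (-2*m*x) * w x powr p) - M powr p / (2*m) * (exp (-2*m*x) * (-2*m)) = exp (-2*m*x) * (M powr p - w x powr p)"
        using m1 by (simp add: field_simps)
      moreover have "w x powr p \<le> M powr p" using M(2)[of x] \<open>x > 0\<close> w_nonneg p1 by (intro powr_mono2) auto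
      ultimately show "\<exists>y. (?D has_real_derivative y) (at x) \<and> y \<ge> 0"
        by (intro exI conjI) (assumption, simp)
    qed
    have "(?D \<longlongrightarrow> 0 - 0) at_top" by (intro tendsto_diff K_lim tendsto_mult_right_zero exp_lim)
    then have "?D t \<le> 0 - 0"
      by (rule tendsto_le_at_top(2)) (rule inc)
    then show ?thesis by simp
  qed
  then show thesis using that[of "M powr p / (2*m)"] M m1 by simp
qed

text \<open>The logarithmic derivative of z = exp(mt) w', a positive solution of z'' = (m^2 - V) z.\<close>
definition q :: "real \<Rightarrow> real" where "q t = m - exp (-2*m*t) * w t powr p / K t"

lemma q_deriv:
  assumes "t > 0"
  shows "(q has_real_derivative m\<^sup>2 - V t - (q t)\<^sup>2) (at t)"
proof -
  have K: "K t \<noteq> 0" using K_pos[OF assms] by simp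
  define E where "E = exp (-2*m*t) * w t powr p"
  have "(q has_real_derivative 0 - ((V t * K t - 2*m*E) * K t - E * (- E)) / (K t * K t)) (at t)"
    unfolding q_def[abs_def] E_def by (intro DERIV_diff DERIV_const DERIV_divide ew_deriv K_deriv assms K)
  moreover have "0 - ((V t * K t - 2*m*E) * K t - E * (- E)) / (K t * K t) = m\<^sup>2 - V t - (q t)\<^sup>2"
    unfolding q_def E_def[symmetric] using K by (simp add: field_simps power2_eq_square)
  ultimately show ?thesis by simp
qed

text \<open>The lower bound keeps the boundary term q S of the Riccati comparison under control at
  infinity.\<close>

lemma q_bound:
  assumes "t > 0" shows "\<bar>q t\<bar> \<le> m"
proof -
  have "0 \<le> exp (-2*m*t) * w t powr p / K t" "exp (-2*m*t) * w t powr p / K t \<le> 2*m"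
    using K_pos[OF assms] K_lower[OF assms] by (auto simp: divide_simps)
  then show ?thesis unfolding q_def by linarith
qed

text \<open>The generator of the scaling symmetry; it solves the linearised equation -y'' = V y.\<close>
definition y :: "real \<Rightarrow> real" where "y t = 2*m/(p-1) * w t - K t"

definition dy :: "real \<Rightarrow> real" where "dy t = 2*m/(p-1) * K t + exp (-2*m*t) * w t powr p"

lemma y_deriv: "t > 0 \<Longrightarrow> (y has_real_derivative dy t) (at t)"
  unfolding y_def[abs_def] dy_def
  using DERIV_diff[OF DERIV_cmult[OF w_deriv, of t "2*m/(p-1)"] K_deriv[of t]] by simp

lemma dy_deriv:
  assumes "t > 0"
  shows "(dy has_real_derivative - V t * y t) (at t)"
proof -
  define E where "E = exp (-2*m*t) * w t powr p"
  have "(dy has_real_derivative 2*m/(p-1) * (- E) + (V t * K t - 2*m*E)) (at t)"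
    unfolding dy_def[abs_def] E_def by (intro DERIV_add DERIV_cmult K_deriv ew_deriv assms)
  moreover have "E * p = V t * w t"
    unfolding E_def V_def w_powr_split[OF assms] by (simp add: mult_ac)
  then have "2*m/(p-1) * (- E) + (V t * K t - 2*m*E) = - V t * y t"
    using p1 unfolding y_def by (simp add: field_simps)
  ultimately show ?thesis by simp
qed

lemma dy_pos: "t > 0 \<Longrightarrow> dy t > 0"
  unfolding dy_def using K_pos[of t] m1 p1 by (intro add_pos_nonneg) auto

lemma y_strict_mono:
  assumes "0 < a" "a < b" shows "y a < y b"
proof (rule DERIV_pos_imp_increasing[OF assms(2)])
  fix x assume "a \<le> x" "x \<le> b"
  then have "x > 0" using assms by simp
  then show "\<exists>z. (y has_real_derivative z) (at x) \<and> z > 0" using y_deriv dy_pos by blast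
qed

text \<open>y is negative at 0, where w vanishes and K is positive; it is positive far out, where K
  is small while w is at least w 1.\<close>

lemma y_zero: obtains t0 where "t0 > 0" "y t0 = 0"
proof -
  have c: "2*m/(p-1) * w 1 > 0" using m1 p1 w_pos[of 1] by simp
  have "\<forall>\<^sub>F t in at_top. K t < 2*m/(p-1) * w 1" by (rule order_tendstoD(2)[OF K_lim c])
  then have "\<forall>\<^sub>F t in at_top. t \<ge> 1 \<and> K t < 2*m/(p-1) * w 1" 
    using eventually_ge_at_top[of 1] by eventually_elim auto
  then obtain b where b: "b \<ge> 1" "K b < 2*m/(p-1) * w 1" 
    by (metis (no_types, lifting) eventually_happens trivial_limit_at_top_linorder)
  have "2*m/(p-1) * w 1 \<le> 2*m/(p-1) * w b"
    using w_mono[of 1 b] b m1 p1 by (intro mult_left_mono) auto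
  then have yb: "y b > 0" using b unfolding y_def by linarith
  have y0: "y 0 < 0" using K0_pos w_0 by (simp add: y_def)
  have "continuous_on {0..b} y" unfolding y_def[abs_def] by (intro continuous_intros cont_sub) auto
  then obtain t where t: "0 \<le> t" "t \<le> b" "y t = 0"
    using IVT'[of y 0 0 b] y0 yb b by force
  moreover have "t \<noteq> 0" using t y0 by auto
  ultimately show thesis using that[of t] by simp
qed

text \<open>By (w^(1-p))' = -(p-1) w^(-p) w' \<le> -(p-1) exp(-2mt) / (2m), which is the previous lower bound on w'.\<close>
lemma decay:
  assumes t: "t > 0"
  shows "exp (-2*m*t) * w t powr (p-1) \<le> 4 * m\<^sup>2 / (p-1)"
proof -
  \<comment> \<open>The factor that appears when (p-1) exp (-2 m t) / (2 m) is integrated from t to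
    infinity. For the limit at infinity it is enough that w^(1-p) is nonnegative.\<close>
  define c where "c = (p-1) / (4 * m\<^sup>2)"
  have c: "c > 0" using p1 m1 by (simp add: c_def)
  let ?D = "\<lambda>t. w t powr (1-p) - c * exp (-2*m*t)"
  have dec: "?D b \<le> ?D t" if "t \<le> b" for b
  proof (rule DERIV_nonpos_imp_nonincreasing[OF that])
    fix x assume x: "t \<le> x" "x \<le> b"
    then have x0: "x > 0" using t by simp
    have "(?D has_real_derivative (1-p) * w x powr (1 - p - 1) * K x - c * (exp (-2*m*x) * (-2*m))) (at x)"
      by (intro DERIV_diff DERIV_cmult w_powr_deriv x0) (auto intro!: derivative_eq_intros)
    moreover have "(1-p) * w x powr (1 - p - 1) * K x - c * (exp (-2*m*x) * (-2*m)) \<le> 0"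
    proof -
      have "w x powr (-p) * w x powr p = 1" using w_pos[OF x0] by (simp flip: powr_add)
      then have "exp (-2*m*x) = w x powr (-p) * (exp (-2*m*x) * w x powr p)"
        by (metis mult.left_commute mult.right_neutral)
      also have "\<dots> \<le> w x powr (-p) * (2*m * K x)"
        by (intro mult_left_mono K_lower x0) simp
      finally have "w x powr (-p) * K x * (2*m) \<ge> exp (-2*m*x)"
        by (simp only: mult_ac)
      then have "(p-1) * (w x powr (-p) * K x * (2*m)) \<ge> (p-1) * exp (-2*m*x)"
        using p1 by (intro mult_left_mono) auto
      moreover have "c * (exp (-2*m*x) * (2*m)) * (2*m) = (p-1) * exp (-2*m*x)"
        using m1 by (simp add: c_def power2_eq_square)
      moreover have "(p-1) * (w x powr (-p) * K x * (2*m)) = ((p-1) * (w x powr (-p) * K x)) * (2*m)"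
        by (simp only: mult.assoc)
      ultimately have "(c * (exp (-2*m*x) * (2*m))) * (2*m) \<le> ((p-1) * (w x powr (-p) * K x)) * (2*m)"
        by linarith
      then have "c * (exp (-2*m*x) * (2*m)) \<le> (p-1) * (w x powr (-p) * K x)"
        using m1 by (simp only: mult_le_cancel_right)
      then show ?thesis by (simp add: algebra_simps)
    qed
    ultimately show "\<exists>y. (?D has_real_derivative y) (at x) \<and> y \<le> 0" by blast
  qed
  have "((\<lambda>b. - c * exp (-2*m*b)) \<longlongrightarrow> 0) at_top" by (rule tendsto_mult_right_zero[OF exp_lim])
  then have "0 \<le> ?D t"
  proof (rule tendsto_le_at_top(1))
    fix b assume "t \<le> b"
    show "- c * exp (-2*m*b) \<le> ?D t"
      using dec[OF \<open>t \<le> b\<close>] powr_ge_zero[of "w b" "1-p"] by linarith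
  qed
  then have "c * exp (-2*m*t) * w t powr (p-1) \<le> w t powr (1-p) * w t powr (p-1)"
    by (intro mult_right_mono) auto
  also have "\<dots> = 1" using w_pos[OF t] by (simp flip: powr_add)
  finally have "c * (exp (-2*m*t) * w t powr (p-1)) \<le> 1" by (simp add: mult.assoc)
  then have "exp (-2*m*t) * w t powr (p-1) \<le> 1 / c" using c by (simp add: field_simps)
  then show ?thesis by (simp add: c_def)
qed

text \<open>Here p must be large. By \<open>decay\<close> and w \<le> K 0 t, the slope of K is at
  least -4 m^2 K 0 t / (p-1), so up to time T it loses at most 2 m^2 T^2 K 0 / (p-1), that is, at
  most K 0 / 2.\<close>

lemma K_half:
  assumes T: "T > 0" "p - 1 \<ge> 4 * m\<^sup>2 * T\<^sup>2"
  shows "K T \<ge> K 0 / 2"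
proof -
  define c where "c = 4 * m\<^sup>2 / (p-1) * K 0"
  have c0: "c \<ge> 0" using p1 K0_pos by (simp add: c_def)
  let ?D = "\<lambda>t. K t + c * t\<^sup>2 / 2"
  have "?D 0 \<le> ?D T"
  proof (rule DERIV_nonneg_imp_increasing_open[of 0 T ?D])
    fix x assume x: "0 < x" "x < T"
    have "(?D has_real_derivative - (exp (-2*m*x) * w x powr p) + c * x) (at x)"
      using K_deriv[OF x(1)] by (auto intro!: derivative_eq_intros)
    moreover have "exp (-2*m*x) * w x powr p \<le> c * x"
    proof -
      have "exp (-2*m*x) * w x powr p = (exp (-2*m*x) * w x powr (p-1)) * w x"
        unfolding w_powr_split[OF x(1)] by (simp add: mult.assoc)
      also have "\<dots> \<le> (4 * m\<^sup>2 / (p-1)) * (K 0 * x)"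
        using decay[OF x(1)] w_le_K0[of x] w_nonneg[of x] x p1 by (intro mult_mono) auto
      finally show ?thesis by (simp add: c_def mult.assoc)
    qed
    ultimately show "\<exists>y. (?D has_real_derivative y) (at x) \<and> y \<ge> 0" by (intro exI conjI) (assumption, simp)
  qed (use T in \<open>auto intro!: continuous_intros cont_sub\<close>)
  then have "K T \<ge> K 0 - c * T\<^sup>2 / 2" by simp
  moreover have "c * T\<^sup>2 \<le> K 0"
  proof -
    have "c * T\<^sup>2 = (4 * m\<^sup>2 * T\<^sup>2) * (K 0 / (p-1))" by (simp add: c_def)
    also have "\<dots> \<le> (p - 1) * (K 0 / (p-1))" using T p1 K0_pos by (intro mult_right_mono) auto
    finally show ?thesis using p1 by simp
  qed
  ultimately show ?thesis by linarith
qed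

end

section \<open>Nonnegativity of the quadratic form in finite codimension\<close>

lemma polar_iterated:
  fixes f :: "real^2 \<Rightarrow> real"
  assumes "integrable MB f"
  shows "set_integrable lborel {0<..} (\<lambda>t. LBINT \<theta>:{0<..<2*pi}. exp (-2*t) * f (pol t \<theta>))"
    and "integral\<^sup>L MB f = (LBINT t:{0<..}. LBINT \<theta>:{0<..<2*pi}. exp (-2*t) * f (pol t \<theta>))"
proof -
  have f: "set_integrable lborel B f" using assms by (simp only: set_integrable_MB)
  let ?g = "\<lambda>z. indicator strip z *\<^sub>R (case z of (t, \<theta>) \<Rightarrow> exp (-2*t) * f (pol t \<theta>))"
  have i: "integrable (lborel \<Otimes>\<^sub>M lborel) ?g"
    using polar_integral(1)[OF f] unfolding set_integrable_def lborel_prod .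
  have e: "(\<integral>\<theta>. ?g (t, \<theta>) \<partial>lborel) = indicator {0<..} t *\<^sub>R (LBINT \<theta>:{0<..<2*pi}. exp (-2*t) * f (pol t \<theta>))" for t
  proof -
    have "?g (t, \<theta>) = indicator {0<..} t *\<^sub>R (indicator {0<..<2*pi} \<theta> *\<^sub>R (exp (-2*t) * f (pol t \<theta>)))" for \<theta>
      by (simp add: strip_def indicator_def)
    then show ?thesis unfolding set_lebesgue_integral_def by (simp only: integral_scaleR_right)
  qed
  show "set_integrable lborel {0<..} (\<lambda>t. LBINT \<theta>:{0<..<2*pi}. exp (-2*t) * f (pol t \<theta>))"
    using lborel_pair.integrable_fst'[OF i] unfolding set_integrable_def e .
  have "integral\<^sup>L MB f = integral\<^sup>L lborel ?g"
    using polar_integral(2)[OF f, unfolded set_integral_MB, unfolded set_lebesgue_integral_def] .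
  also have "\<dots> = integral\<^sup>L (lborel \<Otimes>\<^sub>M lborel) ?g" unfolding lborel_prod ..
  also have "\<dots> = (\<integral>t. (\<integral>\<theta>. ?g (t, \<theta>) \<partial>lborel) \<partial>lborel)"
    by (rule lborel_pair.integral_fst'[OF i, symmetric])
  finally show "integral\<^sup>L MB f = (LBINT t:{0<..}. LBINT \<theta>:{0<..<2*pi}. exp (-2*t) * f (pol t \<theta>))"
    unfolding e set_lebesgue_integral_def[of lborel "{0<..}"] .
qed

lemma set_integral_open_interval:
  fixes g :: "real \<Rightarrow> real"
  assumes "continuous_on {a..b} g"
  shows "(LBINT x:{a<..<b}. g x) = integral {a..b} g"
proof -
  have "(LBINT x:{a..b}. g x) = (LBINT x:{a<..<b}. g x)"
    unfolding set_lebesgue_integral_def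
  proof (rule integral_cong_AE)
    have "AE x in lborel. x \<noteq> a" "AE x in lborel. x \<noteq> b" by (rule AE_lborel_singleton)+
    then show "AE x in lborel. indicator {a..b} x *\<^sub>R g x = indicator {a<..<b} x *\<^sub>R g x"
      by eventually_elim (auto simp: indicator_def)
    have i: "set_integrable lborel {a..b} g" by (rule borel_integrable_atLeastAtMost'[OF assms])
    have j: "set_integrable lborel {a<..<b} g" by (rule set_integrable_subset[OF i]) auto
    show "(\<lambda>x. indicator {a..b} x *\<^sub>R g x) \<in> borel_measurable lborel"
      by (rule borel_measurable_integrable[OF i[unfolded set_integrable_def]])
    show "(\<lambda>x. indicator {a<..<b} x *\<^sub>R g x) \<in> borel_measurable lborel"
      by (rule borel_measurable_integrable[OF j[unfolded set_integrable_def]])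
  qed
  then show ?thesis using set_borel_integral_eq_integral(2)[OF borel_integrable_atLeastAtMost'[OF assms]] by simp
qed

section \<open>Derivatives in logarithmic polar coordinates\<close>

definition perp :: "real \<Rightarrow> real \<Rightarrow> real^2" where
  "perp t \<theta> = (- exp (-t) * sin \<theta>) *\<^sub>R axis 1 1 + (exp (-t) * cos \<theta>) *\<^sub>R axis 2 1"

definition Ph :: "(real^2 \<Rightarrow> real) \<Rightarrow> real \<Rightarrow> real \<Rightarrow> real" where "Ph \<phi> t \<theta> = \<phi> (pol t \<theta>)"
definition Pt :: "(real^2 \<Rightarrow> real) \<Rightarrow> real \<Rightarrow> real \<Rightarrow> real" where
  "Pt \<phi> t \<theta> = - (cgrad \<phi> (pol t \<theta>) \<bullet> pol t \<theta>)"
definition Pa :: "(real^2 \<Rightarrow> real) \<Rightarrow> real \<Rightarrow> real \<Rightarrow> real" where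
  "Pa \<phi> t \<theta> = cgrad \<phi> (pol t \<theta>) \<bullet> perp t \<theta>"

lemma inner_vec2: "(x::real^2) \<bullet> y = x$1 * y$1 + x$2 * y$2"
  by (simp add: inner_vec_def sum_2)

lemma perp_nth [simp]: "perp t \<theta> $ 1 = - exp (-t) * sin \<theta>" "perp t \<theta> $ 2 = exp (-t) * cos \<theta>"
  by (simp_all add: perp_def axis_def)

text \<open>Conformal invariance of the Dirichlet integral: the factor exp (-2 t) is exactly the
  Jacobian, so no weight remains in front of the derivatives.\<close>

lemma Pt_Pa: "(Pt \<phi> t \<theta>)\<^sup>2 + (Pa \<phi> t \<theta>)\<^sup>2 = exp (-2*t) * (norm (cgrad \<phi> (pol t \<theta>)))\<^sup>2"
proof -
  define a b E c s where "a = cgrad \<phi> (pol t \<theta>) $ 1" and "b = cgrad \<phi> (pol t \<theta>) $ 2"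
    and "E = exp (-t)" and "c = cos \<theta>" and "s = sin \<theta>"
  have cs: "c * c + s * s = 1" unfolding c_def s_def by (rule sin_cos_squared_add3)
  have "exp (-2*t) = E * E" unfolding E_def by (simp flip: exp_add)
  moreover have "(Pt \<phi> t \<theta>)\<^sup>2 + (Pa \<phi> t \<theta>)\<^sup>2 = (a * (E * c) + b * (E * s))\<^sup>2 + (a * (- E * s) + b * (E * c))\<^sup>2"
    unfolding Pt_def Pa_def inner_vec2 pol_nth perp_nth a_def b_def E_def c_def s_def by (simp only: power2_minus)
  moreover have "(a * (E * c) + b * (E * s))\<^sup>2 + (a * (- E * s) + b * (E * c))\<^sup>2 = (E * E) * (a\<^sup>2 + b\<^sup>2) * (c * c + s * s)"
    by algebra
  moreover have "(norm (cgrad \<phi> (pol t \<theta>)))\<^sup>2 = a\<^sup>2 + b\<^sup>2"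
    unfolding norm_vec2 a_def b_def by simp
  ultimately show ?thesis using cs by simp
qed

lemma continuous_on_pol: "continuous_on UNIV (\<lambda>z. pol (fst z) (snd z))"
  "continuous_on UNIV (\<lambda>z. perp (fst z) (snd z))"
  unfolding pol_def perp_def by (intro continuous_intros)+

lemma polar_continuous:
  assumes "C1 \<phi>"
  shows "continuous_on UNIV (\<lambda>z. Ph \<phi> (fst z) (snd z))" "continuous_on UNIV (\<lambda>z. Pt \<phi> (fst z) (snd z))"
    "continuous_on UNIV (\<lambda>z. Pa \<phi> (fst z) (snd z))"
proof -
  have f: "continuous_on UNIV (\<lambda>z. \<phi> (pol (fst z) (snd z)))"
    by (rule continuous_on_compose2[OF C1_continuous[OF assms, of UNIV] continuous_on_pol(1)]) simp
  have g: "continuous_on UNIV (\<lambda>z. cgrad \<phi> (pol (fst z) (snd z)))"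
    by (rule continuous_on_compose2[OF C1_cgrad_continuous[OF assms, of UNIV] continuous_on_pol(1)]) simp
  show "continuous_on UNIV (\<lambda>z. Ph \<phi> (fst z) (snd z))" "continuous_on UNIV (\<lambda>z. Pt \<phi> (fst z) (snd z))"
    "continuous_on UNIV (\<lambda>z. Pa \<phi> (fst z) (snd z))"
    unfolding Ph_def Pt_def Pa_def by (intro f g continuous_on_inner continuous_on_minus continuous_on_pol)+
qed

lemma continuous_on_sections:
  assumes "continuous_on UNIV (\<lambda>z. F (fst z) (snd z) :: real)"
  shows "continuous_on S (\<lambda>\<theta>. F t \<theta>)" "continuous_on S (\<lambda>t. F t \<theta>)"
  using continuous_on_compose2[OF assms, of S "\<lambda>\<theta>. (t, \<theta>)"] continuous_on_compose2[OF assms, of S "\<lambda>t. (t, \<theta>)"]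
  by (simp_all add: continuous_on_Pair)

lemma continuous_IT:
  assumes "continuous_on UNIV (\<lambda>z. F (fst z) (snd z) :: real)"
  shows "continuous_on S (\<lambda>t. IT (F t))"
proof -
  have "continuous_on (S \<times> cbox 0 (2*pi)) (\<lambda>(t, \<theta>). F t \<theta>)"
    using continuous_on_subset[OF assms] by (simp add: case_prod_beta')
  from integral_continuous_on_param[OF this] show ?thesis by simp
qed

lemma IT_deriv:
  assumes F: "continuous_on UNIV (\<lambda>z. F (fst z) (snd z) :: real)"
    and F': "continuous_on UNIV (\<lambda>z. F' (fst z) (snd z))"
    and d: "\<And>t \<theta>. ((\<lambda>t. F t \<theta>) has_real_derivative F' t \<theta>) (at t)"
  shows "((\<lambda>t. IT (F t)) has_real_derivative IT (F' t)) (at t)"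
proof -
  have "((\<lambda>t. integral (cbox 0 (2*pi)) (F t)) has_field_derivative integral (cbox 0 (2*pi)) (F' t)) (at t within UNIV)"
  proof (rule leibniz_rule_field_derivative)
    show "continuous_on (UNIV \<times> cbox 0 (2*pi)) (\<lambda>(t, \<theta>). F' t \<theta>)"
      using continuous_on_subset[OF F'] by (simp add: case_prod_beta')
    show "F x integrable_on cbox 0 (2*pi)" for x
      by (rule integrable_continuous) (rule continuous_on_sections(1)[OF F])
  qed (use d in simp_all)
  then show ?thesis by simp
qed

lemma pol_deriv:
  "((\<lambda>t. pol t \<theta>) has_derivative (\<lambda>h. h *\<^sub>R (- pol t \<theta>))) (at t)"
  "((\<lambda>\<theta>. pol t \<theta>) has_derivative (\<lambda>h. h *\<^sub>R perp t \<theta>)) (at \<theta>)"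
  unfolding pol_def perp_def by (auto intro!: derivative_eq_intros simp: algebra_simps)

lemma Ph_deriv:
  assumes "C1 \<phi>"
  shows "((\<lambda>t. Ph \<phi> t \<theta>) has_real_derivative Pt \<phi> t \<theta>) (at t)"
    and "((\<lambda>\<theta>. Ph \<phi> t \<theta>) has_real_derivative Pa \<phi> t \<theta>) (at \<theta>)"
proof -
  show "((\<lambda>t. Ph \<phi> t \<theta>) has_real_derivative Pt \<phi> t \<theta>) (at t)"
    unfolding Ph_def Pt_def has_field_derivative_def
    by (rule has_derivative_eq_rhs[OF has_derivative_compose[OF pol_deriv(1) C1D[OF assms]]]) (simp add: fun_eq_iff mult.commute)
  show "((\<lambda>\<theta>. Ph \<phi> t \<theta>) has_real_derivative Pa \<phi> t \<theta>) (at \<theta>)"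
    unfolding Ph_def Pa_def has_field_derivative_def
    by (rule has_derivative_eq_rhs[OF has_derivative_compose[OF pol_deriv(2) C1D[OF assms]]]) (simp add: fun_eq_iff mult.commute)
qed

lemma Ph_periodic: "Ph \<phi> t (2*pi) = Ph \<phi> t 0"
  by (simp add: Ph_def pol_def)

lemma perp_norm [simp]: "norm (perp t \<theta>) = exp (-t)"
proof -
  have "(norm (perp t \<theta>))\<^sup>2 = (exp (-t))\<^sup>2 * ((sin \<theta>)\<^sup>2 + (cos \<theta>)\<^sup>2)"
    unfolding norm_vec2 by (simp add: power_mult_distrib flip: distrib_left)
  then show ?thesis by (simp add: power2_eq_iff_nonneg)
qed

lemma wirtinger_Ph:
  assumes "C1 \<phi>"
  shows "(real n + 1)\<^sup>2 * (IT (\<lambda>\<theta>. (Ph \<phi> t \<theta>)\<^sup>2) - (\<Sum>j<2*n+1. (cf (Ph \<phi> t) j)\<^sup>2)) \<le> IT (\<lambda>\<theta>. (Pa \<phi> t \<theta>)\<^sup>2)"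
proof (rule wirtinger)
  show "(Ph \<phi> t has_real_derivative Pa \<phi> t \<theta>) (at \<theta>)" for \<theta> using Ph_deriv(2)[OF assms] .
  show "continuous_on UNIV (Pa \<phi> t)" by (rule continuous_on_sections(1)[OF polar_continuous(3)[OF assms]])
  show "\<exists>T. trig T \<and> (\<forall>\<theta>. \<bar>Ph \<phi> t \<theta> - T \<theta>\<bar> < e)" if "e > 0" for e
    by (rule trig_dense[OF C1_continuous[OF assms] that, of t]) (auto simp: Ph_def)
qed (rule Ph_periodic)

text \<open>The algebra of \<open>J_lower\<close> in isolation. X and Y are the integrals of the
  squared t- and angular derivatives, a and s the low and high parts of the squared norm, A' and E
  the t-derivatives of a and s + a, C the low part of X. The hypotheses are Bessel for the
  t-derivative minus q times the function, a sum of squares with r, and Wirtinger.\<close>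

lemma J_lower_arith:
  fixes q :: real
  assumes "C - q * A' + q\<^sup>2 * a \<le> X - q * E + q\<^sup>2 * (s + a)" "r * A' - r\<^sup>2 * a \<le> C" "m2 * s \<le> Y"
  shows "(m2 - V - q\<^sup>2) * s + (E - A') * q + ((- V - r\<^sup>2) * a + A' * r) \<le> X + Y - V * (s + a)"
proof -
  have "(m2 - V - q\<^sup>2) * s + (E - A') * q + ((- V - r\<^sup>2) * a + A' * r) =
    m2 * s + (- (q\<^sup>2 * (s + a)) + q * E) + (- (q * A') + q\<^sup>2 * a) + (r * A' - r\<^sup>2 * a) - V * (s + a)"
    by algebra
  then show ?thesis using assms by linarith
qed

section \<open>Riccati comparison for the quadratic form\<close>

context emden
begin

text \<open>The density in t of the quadratic form, after integration over the angle; the Jacobian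
  is already absorbed.\<close>

definition J :: "(real^2 \<Rightarrow> real) \<Rightarrow> real \<Rightarrow> real" where
  "J \<phi> t = IT (\<lambda>\<theta>. (Pt \<phi> t \<theta>)\<^sup>2) + IT (\<lambda>\<theta>. (Pa \<phi> t \<theta>)\<^sup>2) - V t * IT (\<lambda>\<theta>. (Ph \<phi> t \<theta>)\<^sup>2)"

lemma J_continuous:
  assumes "C1 \<phi>" "a \<ge> 0"
  shows "continuous_on {a..b} (J \<phi>)"
proof -
  note c = polar_continuous[OF assms(1)]
  have V: "continuous_on {a..b} V" by (rule continuous_on_subset[OF V_cont]) (use assms in auto)
  show ?thesis unfolding J_def[abs_def]
    by (intro continuous_on_diff continuous_on_add continuous_on_mult V continuous_IT continuous_on_power c)
qed

text \<open>Riccati comparison: on the span of the low modes use y'/y, on its orthogonal complement z'/z.\<close>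
lemma J_lower:
  assumes \<phi>: "C1 \<phi>" and t: "t > 0" and y: "y t \<noteq> 0" and n: "m \<le> real n + 1"
  defines "A \<equiv> \<lambda>t. \<Sum>j<2*n+1. (cf (Ph \<phi> t) j)\<^sup>2"
  defines "S \<equiv> \<lambda>t. IT (\<lambda>\<theta>. (Ph \<phi> t \<theta>)\<^sup>2) - A t"
  shows "\<exists>d. ((\<lambda>t. q t * S t + dy t / y t * A t) has_real_derivative d) (at t) \<and> d \<le> J \<phi> t"
proof -
  note c = polar_continuous[OF \<phi>]
  note d = Ph_deriv[OF \<phi>]
  define c0 where "c0 = (\<lambda>j. cf (Ph \<phi> t) j)"
  define c1 where "c1 = (\<lambda>j. cf (Pt \<phi> t) j)"
  define E' where "E' = IT (\<lambda>\<theta>. 2 * (Ph \<phi> t \<theta> * Pt \<phi> t \<theta>))"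
  define A' where "A' = (\<Sum>j<2*n+1. 2 * (c0 j * c1 j))"
  define r where "r = dy t / y t"
  have ctb: "continuous_on UNIV (\<lambda>z. tb j (snd z))" for j
    by (rule continuous_on_compose2[OF tb_continuous[of UNIV] continuous_on_snd[OF continuous_on_id]]) simp
  have dcf: "((\<lambda>t. cf (Ph \<phi> t) j) has_real_derivative c1 j) (at t)" for j
    unfolding cf_def c1_def
    by (rule IT_deriv) (intro continuous_on_mult c ctb DERIV_cmult_right d)+
  have dE: "((\<lambda>t. IT (\<lambda>\<theta>. (Ph \<phi> t \<theta>)\<^sup>2)) has_real_derivative E') (at t)"
    unfolding E'_def
  proof (rule IT_deriv)
    show "((\<lambda>t. (Ph \<phi> t \<theta>)\<^sup>2) has_real_derivative 2 * (Ph \<phi> t \<theta> * Pt \<phi> t \<theta>)) (at t)" for t \<theta>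
      unfolding power2_eq_square by (rule DERIV_cong[OF DERIV_mult[OF d(1) d(1)]]) simp
  qed (intro continuous_on_mult continuous_on_power continuous_on_const c)+
  have dA: "(A has_real_derivative A') (at t)"
    unfolding A_def A'_def
  proof (rule DERIV_sum)
    fix j show "((\<lambda>t. (cf (Ph \<phi> t) j)\<^sup>2) has_real_derivative 2 * (c0 j * c1 j)) (at t)"
      unfolding power2_eq_square by (rule DERIV_cong[OF DERIV_mult[OF dcf dcf]]) (simp add: c0_def)
  qed
  have dS: "(S has_real_derivative (E' - A')) (at t)" unfolding S_def by (rule DERIV_diff[OF dE dA])
  have dr: "((\<lambda>t. dy t / y t) has_real_derivative (- V t - r\<^sup>2)) (at t)"
  proof -
    have "((\<lambda>t. dy t / y t) has_real_derivative ((- V t * y t) * y t - dy t * dy t) / (y t * y t)) (at t)"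
      by (rule DERIV_divide[OF dy_deriv[OF t] y_deriv[OF t] y])
    moreover have "((- V t * y t) * y t - dy t * dy t) / (y t * y t) = - V t - r\<^sup>2"
      unfolding diff_divide_distrib r_def power2_eq_square using y by simp
    ultimately show ?thesis by (simp only:)
  qed
  have h1: "((\<lambda>t. q t * S t) has_real_derivative ((m\<^sup>2 - V t - (q t)\<^sup>2) * S t + (E' - A') * q t)) (at t)"
    by (rule DERIV_mult[OF q_deriv[OF t] dS])
  have h2: "((\<lambda>t. dy t / y t * A t) has_real_derivative ((- V t - r\<^sup>2) * A t + A' * (dy t / y t))) (at t)"
    by (rule DERIV_mult[OF dr dA])
  have dH: "((\<lambda>t. q t * S t + dy t / y t * A t) has_real_derivative
      ((m\<^sup>2 - V t - (q t)\<^sup>2) * S t + (E' - A') * q t + ((- V t - r\<^sup>2) * A t + A' * r))) (at t)"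
    by (rule DERIV_add[OF h1 h2[folded r_def]])
  have gc: "continuous_on {0..2*pi} (\<lambda>\<theta>. Pt \<phi> t \<theta> - q t * Ph \<phi> t \<theta>)"
    "continuous_on {0..2*pi} (Ph \<phi> t)" "continuous_on {0..2*pi} (Pt \<phi> t)"
    by (intro continuous_on_diff continuous_on_mult continuous_on_const
        continuous_on_sections(1)[OF c(1)] continuous_on_sections(1)[OF c(2)])+
  have cfd: "cf (\<lambda>\<theta>. Pt \<phi> t \<theta> - q t * Ph \<phi> t \<theta>) j = c1 j - q t * c0 j" for j
  proof -
    have "cf (\<lambda>\<theta>. Pt \<phi> t \<theta> - q t * Ph \<phi> t \<theta>) j = IT (\<lambda>\<theta>. Pt \<phi> t \<theta> * tb j \<theta> - q t * (Ph \<phi> t \<theta> * tb j \<theta>))"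
      unfolding cf_def by (simp add: left_diff_distrib mult.assoc)
    also have "\<dots> = IT (\<lambda>\<theta>. Pt \<phi> t \<theta> * tb j \<theta>) - IT (\<lambda>\<theta>. q t * (Ph \<phi> t \<theta> * tb j \<theta>))"
      by (intro integral_diff integrable_continuous_interval continuous_on_mult continuous_on_const gc tb_continuous)
    finally show ?thesis unfolding c1_def c0_def cf_def integral_mult_right .
  qed
  have IT3: "IT (\<lambda>\<theta>. (Pt \<phi> t \<theta> - q t * Ph \<phi> t \<theta>)\<^sup>2) =
      IT (\<lambda>\<theta>. (Pt \<phi> t \<theta>)\<^sup>2) - q t * E' + (q t)\<^sup>2 * IT (\<lambda>\<theta>. (Ph \<phi> t \<theta>)\<^sup>2)"
  proof -
    have pw: "(Pt \<phi> t \<theta> - q t * Ph \<phi> t \<theta>)\<^sup>2 = (Pt \<phi> t \<theta>)\<^sup>2 - q t * (2 * (Ph \<phi> t \<theta> * Pt \<phi> t \<theta>)) + (q t)\<^sup>2 * (Ph \<phi> t \<theta>)\<^sup>2" for \<theta>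
      by algebra
    have "IT (\<lambda>\<theta>. (Pt \<phi> t \<theta> - q t * Ph \<phi> t \<theta>)\<^sup>2) =
      IT (\<lambda>\<theta>. (Pt \<phi> t \<theta>)\<^sup>2 - q t * (2 * (Ph \<phi> t \<theta> * Pt \<phi> t \<theta>)) + (q t)\<^sup>2 * (Ph \<phi> t \<theta>)\<^sup>2)"
      unfolding pw ..
    also have "\<dots> = IT (\<lambda>\<theta>. (Pt \<phi> t \<theta>)\<^sup>2 - q t * (2 * (Ph \<phi> t \<theta> * Pt \<phi> t \<theta>))) + IT (\<lambda>\<theta>. (q t)\<^sup>2 * (Ph \<phi> t \<theta>)\<^sup>2)"
      by (intro integral_add integrable_continuous_interval continuous_on_diff continuous_on_mult continuous_on_power continuous_on_const gc)
    also have "IT (\<lambda>\<theta>. (Pt \<phi> t \<theta>)\<^sup>2 - q t * (2 * (Ph \<phi> t \<theta> * Pt \<phi> t \<theta>))) = IT (\<lambda>\<theta>. (Pt \<phi> t \<theta>)\<^sup>2) - IT (\<lambda>\<theta>. q t * (2 * (Ph \<phi> t \<theta> * Pt \<phi> t \<theta>)))"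
      by (intro integral_diff integrable_continuous_interval continuous_on_diff continuous_on_mult continuous_on_power continuous_on_const gc)
    finally show ?thesis unfolding E'_def integral_mult_right .
  qed
  have sq: "(\<Sum>j<2*n+1. (c1 j - x * c0 j)\<^sup>2) = (\<Sum>j<2*n+1. (c1 j)\<^sup>2) - x * A' + x\<^sup>2 * A t" for x
    unfolding A'_def A_def sum_distrib_left sum.distrib[symmetric] sum_subtractf[symmetric]
  proof (intro sum.cong refl)
    fix j
    show "(c1 j - x * c0 j)\<^sup>2 = (c1 j)\<^sup>2 - x * (2 * (c0 j * c1 j)) + x\<^sup>2 * (cf (Ph \<phi> t) j)\<^sup>2"
      unfolding c0_def by algebra
  qed
  \<comment> \<open>The gap between the two sides is the high-mode part of the squared norm of
    \<open>Pt \<phi> t\<close> - q \<open>Ph \<phi> t\<close>: a completed square on the complement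
    of the low modes.\<close>
  have 1: "(\<Sum>j<2*n+1. (c1 j)\<^sup>2) - q t * A' + (q t)\<^sup>2 * A t \<le>
      IT (\<lambda>\<theta>. (Pt \<phi> t \<theta>)\<^sup>2) - q t * E' + (q t)\<^sup>2 * IT (\<lambda>\<theta>. (Ph \<phi> t \<theta>)\<^sup>2)"
    using bessel[OF gc(1), of "2*n+1"] unfolding cfd sq IT3 .
  \<comment> \<open>The completed square on the low modes, now with r = y'/y.\<close>
  have "0 \<le> (\<Sum>j<2*n+1. (c1 j - r * c0 j)\<^sup>2)" by (intro sum_nonneg) simp
  then have 2: "r * A' - r\<^sup>2 * A t \<le> (\<Sum>j<2*n+1. (c1 j)\<^sup>2)" unfolding sq by linarith
  have S0: "0 \<le> S t" unfolding S_def A_def using bessel[OF gc(2), of "2*n+1"] by linarith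
  \<comment> \<open>The whole angular energy is spent on the high modes, where it compensates the
    eigenvalue -m^2 of z; the low modes do without it because y solves the equation with eigenvalue
    0.\<close>
  have "m\<^sup>2 * S t \<le> (real n + 1)\<^sup>2 * S t" using n m1 S0 by (intro mult_right_mono power_mono) auto
  also have "\<dots> \<le> IT (\<lambda>\<theta>. (Pa \<phi> t \<theta>)\<^sup>2)" unfolding S_def A_def by (rule wirtinger_Ph[OF \<phi>])
  finally have 3: "m\<^sup>2 * S t \<le> IT (\<lambda>\<theta>. (Pa \<phi> t \<theta>)\<^sup>2)" .
  have ES: "IT (\<lambda>\<theta>. (Ph \<phi> t \<theta>)\<^sup>2) = S t + A t" by (simp add: S_def)
  show ?thesis
  proof (intro exI conjI)
    show "((\<lambda>t. q t * S t + dy t / y t * A t) has_real_derivative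
      ((m\<^sup>2 - V t - (q t)\<^sup>2) * S t + (E' - A') * q t + ((- V t - r\<^sup>2) * A t + A' * r))) (at t)" by (rule dH)
    show "(m\<^sup>2 - V t - (q t)\<^sup>2) * S t + (E' - A') * q t + ((- V t - r\<^sup>2) * A t + A' * r) \<le> J \<phi> t"
      using J_lower_arith[OF 1[unfolded ES] 2 3] unfolding J_def ES .
  qed
qed

text \<open>y'/y has a simple pole at t0, because y' is positive there, while the square of a
  coefficient vanishing at t0 has a double zero.\<close>

lemma mode_quotient_tendsto:
  assumes t0: "t0 > 0" "y t0 = 0" and c: "(c has_real_derivative c') (at t0)" "c t0 = 0"
  shows "((\<lambda>t. dy t / y t * (c t)\<^sup>2) \<longlongrightarrow> 0) (at t0)"
proof -
  have 1: "((\<lambda>t. c t / (t - t0)) \<longlongrightarrow> c') (at t0)"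
    using c by (simp add: has_field_derivative_iff LIM_offset_zero_iff[of _ _ t0])
  have 2: "((\<lambda>t. y t / (t - t0)) \<longlongrightarrow> dy t0) (at t0)"
    using y_deriv[OF t0(1)] t0(2) by (simp add: has_field_derivative_iff LIM_offset_zero_iff[of _ _ t0])
  have 3: "(dy \<longlongrightarrow> dy t0) (at t0)"
    using DERIV_isCont[OF dy_deriv[OF t0(1)]] by (simp add: isCont_def)
  have d0: "dy t0 \<noteq> 0" using dy_pos[OF t0(1)] by simp
  have 4: "((\<lambda>t. t - t0) \<longlongrightarrow> 0) (at t0)" by (rule tendsto_eq_intros refl | simp)+
  have "((\<lambda>t. dy t * ((c t / (t - t0))\<^sup>2 * (t - t0)) / (y t / (t - t0))) \<longlongrightarrow> dy t0 * (c'\<^sup>2 * 0) / dy t0) (at t0)"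
    by (intro tendsto_divide tendsto_mult tendsto_power 1 2 3 4 d0)
  then have l: "((\<lambda>t. dy t * ((c t / (t - t0))\<^sup>2 * (t - t0)) / (y t / (t - t0))) \<longlongrightarrow> 0) (at t0)"
    by (simp only: mult_zero_right div_0)
  have e: "\<forall>\<^sub>F t in at t0. dy t * ((c t / (t - t0))\<^sup>2 * (t - t0)) / (y t / (t - t0)) = dy t / y t * (c t)\<^sup>2"
    unfolding eventually_at_filter
  proof (rule always_eventually, safe)
    fix t :: real assume "t \<noteq> t0"
    then have "t - t0 \<noteq> 0" by simp
    then show "dy t * ((c t / (t - t0))\<^sup>2 * (t - t0)) / (y t / (t - t0)) = dy t / y t * (c t)\<^sup>2"
      by (simp add: power_divide power2_eq_square)
  qed
  show ?thesis by (rule Lim_transform_eventually[OF l e])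
qed

text \<open>The comparison function G satisfies G' \<le> J away from t0, is continuous across t0
  because the low modes vanish there, and is 0 near t = 0. Thus the integral of J up to T is at
  least G T, and G T is bounded below by a quantity tending to 0.\<close>

lemma upper_core:
  assumes \<phi>: "test_fun \<phi>" and n: "m \<le> real n + 1" and t0: "t0 > 0" "y t0 = 0"
    and c0: "\<And>j. j < 2*n+1 \<Longrightarrow> cf (Ph \<phi> t0) j = 0"
    and int: "set_integrable lborel {0<..} (J \<phi>)"
  shows "0 \<le> (LBINT t:{0<..}. J \<phi> t)"
proof -
  have C1: "C1 \<phi>" by (rule test_fun_C1[OF \<phi>])
  note cont = polar_continuous[OF C1]
  obtain r where r: "0 < r" "r < 1" "\<And>x. norm x \<ge> r \<Longrightarrow> \<phi> x = 0" "\<And>x. norm x \<ge> r \<Longrightarrow> cgrad \<phi> x = 0"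
    using test_fun_vanish[OF \<phi>] by blast
  \<comment> \<open>Up to a the function and its derivatives vanish; the second argument places a
    before t0.\<close>
  define a where "a = min (- ln r) (t0 / 2)"
  have "- ln r > 0" using r by simp
  then have a: "a > 0" "a < t0" using t0 by (auto simp: a_def)
  have van: "Ph \<phi> t \<theta> = 0" "Pt \<phi> t \<theta> = 0" "Pa \<phi> t \<theta> = 0" if "t \<le> a" for t \<theta>
  proof -
    have "ln r \<le> - t" using that by (auto simp: a_def)
    then have "exp (ln r) \<le> exp (-t)" by simp
    then have "r \<le> norm (pol t \<theta>)" using r by simp
    then show "Ph \<phi> t \<theta> = 0" "Pt \<phi> t \<theta> = 0" "Pa \<phi> t \<theta> = 0" using r by (auto simp: Ph_def Pt_def Pa_def)
  qed
  have J0: "J \<phi> t = 0" if "t \<le> a" for t unfolding J_def van[OF that] by simp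
  define A where "A = (\<lambda>t. \<Sum>j<2*n+1. (cf (Ph \<phi> t) j)\<^sup>2)"
  define S where "S = (\<lambda>t. IT (\<lambda>\<theta>. (Ph \<phi> t \<theta>)\<^sup>2) - A t)"
  \<comment> \<open>The value 0 assigned at t0 is the limit of the singular term, so that G is
    continuous.\<close>
  define G where "G = (\<lambda>t. q t * S t + (if t = t0 then 0 else dy t / y t * A t))"
  have y_nz: "y t \<noteq> 0" if "t > 0" "t \<noteq> t0" for t
    using y_strict_mono[of t t0] y_strict_mono[of t0 t] that t0 by (cases "t < t0") auto
  have ctb: "continuous_on UNIV (\<lambda>z. tb j (snd z))" for j
    by (rule continuous_on_compose2[OF tb_continuous[of UNIV] continuous_on_snd[OF continuous_on_id]]) simp
  have A_cont: "continuous_on UNIV A" unfolding A_def cf_def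
    by (intro continuous_on_sum continuous_on_power continuous_IT continuous_on_mult cont ctb)
  have S_cont: "continuous_on UNIV S" unfolding S_def
    by (intro continuous_on_diff continuous_IT continuous_on_power cont A_cont)
  have dcf: "((\<lambda>t. cf (Ph \<phi> t) j) has_real_derivative cf (Pt \<phi> t0) j) (at t0)" for j
    unfolding cf_def
    by (rule IT_deriv) (intro continuous_on_mult cont ctb DERIV_cmult_right Ph_deriv C1)+
  have quot: "((\<lambda>t. dy t / y t * A t) \<longlongrightarrow> 0) (at t0)"
  proof -
    have "((\<lambda>t. \<Sum>j<2*n+1. dy t / y t * (cf (Ph \<phi> t) j)\<^sup>2) \<longlongrightarrow> (\<Sum>j<2*n+1. 0)) (at t0)"
      by (rule tendsto_sum, rule mode_quotient_tendsto[OF t0 dcf c0]) simp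
    then show ?thesis unfolding A_def sum_distrib_left by simp
  qed
  have G_deriv: "\<exists>d. (G has_real_derivative d) (at t) \<and> d \<le> J \<phi> t" if t: "t > 0" "t \<noteq> t0" for t
  proof -
    obtain d where d: "((\<lambda>t. q t * S t + dy t / y t * A t) has_real_derivative d) (at t)" "d \<le> J \<phi> t"
      using J_lower[OF C1 t(1) y_nz[OF t] n] unfolding S_def A_def by blast
    have "(G has_real_derivative d) (at t)"
      by (rule has_field_derivative_transform_within_open[OF d(1), of "- {t0}"])
         (use t in \<open>auto simp: G_def\<close>)
    then show ?thesis using d(2) by blast
  qed
  have G_cont: "isCont G t" if "t > 0" for t
  proof (cases "t = t0")
    case False
    then show ?thesis using G_deriv[OF that] DERIV_isCont by blast
  next
    case True
    have "isCont q t0" using q_deriv[OF t0(1)] DERIV_isCont by blast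
    moreover have "isCont S t0" using S_cont by (simp add: continuous_on_eq_continuous_at)
    ultimately have 1: "((\<lambda>t. q t * S t) \<longlongrightarrow> q t0 * S t0) (at t0)" unfolding isCont_def by (rule tendsto_mult)
    have 2: "((\<lambda>t. if t = t0 then 0 else dy t / y t * A t) \<longlongrightarrow> 0) (at t0)"
      by (rule Lim_transform_eventually[OF quot]) (simp add: eventually_at_filter)
    have "(G \<longlongrightarrow> q t0 * S t0 + 0) (at t0)" unfolding G_def by (rule tendsto_add[OF 1 2])
    then show ?thesis unfolding True isCont_def by (simp add: G_def)
  qed
  define I where "I = (\<lambda>t. integral {a..t} (J \<phi>))"
  have Ga: "G a = 0" unfolding G_def S_def A_def cf_def van[OF order_refl] using a by simp
  have Jc: "continuous_on {a..b} (J \<phi>)" for b using a by (intro J_continuous C1) simp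
  \<comment> \<open>Only interior derivatives are required, so t0 may be an endpoint; the intervals
    [a, t0] and [t0, T] are then chained.\<close>
  have mono: "I b1 - G b1 \<le> I b2 - G b2" if "a \<le> b1" "b1 \<le> b2" "t0 \<notin> {b1<..<b2}" for b1 b2
  proof (rule DERIV_nonneg_imp_increasing_open[OF that(2), of "\<lambda>t. I t - G t"])
    fix x assume x: "b1 < x" "x < b2"
    then have x0: "x > 0" "x \<noteq> t0" using a that by auto
    obtain d where d: "(G has_real_derivative d) (at x)" "d \<le> J \<phi> x" using G_deriv[OF x0] by blast
    have "(I has_real_derivative J \<phi> x) (at x within {a..b2})"
      unfolding I_def by (rule integral_has_real_derivative[OF Jc]) (use x that in auto)
    moreover have "at x within {a..b2} = at x" using x that by (intro at_within_Icc_at) auto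
    ultimately have "(I has_real_derivative J \<phi> x) (at x)" by simp
    from DERIV_diff[OF this d(1)] d(2)
    show "\<exists>y. ((\<lambda>t. I t - G t) has_real_derivative y) (at x) \<and> 0 \<le> y" by (intro exI conjI) (assumption, simp)
  next
    have "continuous_on {a..b2} I" unfolding I_def
      by (rule indefinite_integral_continuous_1[OF integrable_continuous_interval[OF Jc]])
    then have 1: "continuous_on {b1..b2} I" by (rule continuous_on_subset) (use that in auto)
    have 2: "continuous_on {b1..b2} G"
      by (intro continuous_at_imp_continuous_on ballI G_cont) (use that a in auto)
    show "continuous_on {b1..b2} (\<lambda>t. I t - G t)" by (rule continuous_on_diff[OF 1 2])
  qed
  have "bounded (cgrad \<phi> ` cball 0 1)"
    by (intro compact_imp_bounded compact_continuous_image C1_cgrad_continuous C1) auto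
  then obtain C where C: "\<And>x. x \<in> cball 0 1 \<Longrightarrow> norm (cgrad \<phi> x) \<le> C" unfolding bounded_iff by blast
  have C0: "0 \<le> C" using order_trans[OF norm_ge_zero C[of 0]] by simp
  \<comment> \<open>Past t0 the quotient y'/y is positive, so only q S \<ge> -m S can be negative.
    Wirtinger bounds S by the angular energy, which is of order exp (-2 T) because the gradient of
    \<phi> is bounded.\<close>
  have lower: "- (2 * pi * C\<^sup>2) * exp (-2*T) \<le> I T" if "T > t0" for T
  proof -
    have T0: "T > 0" using that t0 by simp
    have "I a - G a \<le> I t0 - G t0" using a by (intro mono) auto
    also have "\<dots> \<le> I T - G T" using a that by (intro mono) auto
    finally have "G T \<le> I T" unfolding Ga by (simp add: I_def)
    have yT: "y T > 0" using y_strict_mono[OF t0(1) that] t0 by simp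
    have A0: "A T \<ge> 0" unfolding A_def by (intro sum_nonneg) simp
    have "dy T / y T * A T \<ge> 0" using yT dy_pos[OF T0] A0 by simp
    moreover have "continuous_on {0..2*pi} (Ph \<phi> T)" by (rule continuous_on_sections(1)[OF cont(1)])
    then have S0: "S T \<ge> 0" unfolding S_def A_def using bessel[of "Ph \<phi> T" "2*n+1"] by simp
    have "q T * S T \<ge> (- m) * S T" using q_bound[OF T0] S0 by (intro mult_right_mono) auto
    moreover have "m * S T \<le> (real n + 1)\<^sup>2 * S T"
    proof (intro mult_right_mono S0)
      have "m * 1 \<le> (real n + 1) * (real n + 1)" using n m1 by (intro mult_mono) auto
      then show "m \<le> (real n + 1)\<^sup>2" by (simp add: power2_eq_square)
    qed
    moreover have "(real n + 1)\<^sup>2 * S T \<le> IT (\<lambda>\<theta>. (Pa \<phi> T \<theta>)\<^sup>2)"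
      unfolding S_def A_def by (rule wirtinger_Ph[OF C1])
    moreover have "IT (\<lambda>\<theta>. (Pa \<phi> T \<theta>)\<^sup>2) \<le> IT (\<lambda>\<theta>. (C * exp (-T))\<^sup>2)"
    proof (intro integral_le integrable_continuous_interval continuous_on_power continuous_on_const
        continuous_on_sections(1)[OF cont(3)])
      fix \<theta>
      have "pol T \<theta> \<in> cball 0 1" using T0 by simp
      then have "norm (cgrad \<phi> (pol T \<theta>)) * norm (perp T \<theta>) \<le> C * exp (-T)"
        using C C0 by (intro mult_mono) auto
      then have "\<bar>Pa \<phi> T \<theta>\<bar> \<le> C * exp (-T)"
        unfolding Pa_def using Cauchy_Schwarz_ineq2[of "cgrad \<phi> (pol T \<theta>)" "perp T \<theta>"] by linarith
      then show "(Pa \<phi> T \<theta>)\<^sup>2 \<le> (C * exp (-T))\<^sup>2" by (metis abs_ge_zero power2_abs power_mono)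
    qed
    moreover have "IT (\<lambda>\<theta>. (C * exp (-T))\<^sup>2) = 2 * pi * C\<^sup>2 * exp (-2*T)"
      by (simp add: power_mult_distrib flip: exp_double)
    ultimately show ?thesis using \<open>G T \<le> I T\<close> that unfolding G_def by simp
  qed
  have e: "indicator {0<..} t *\<^sub>R J \<phi> t = indicator {a..} t *\<^sub>R J \<phi> t" for t
    using J0[of t] a by (auto simp: indicator_def)
  have int': "set_integrable lborel {a..} (J \<phi>)" using int unfolding set_integrable_def e .
  have "((\<lambda>T. LBINT t:{a..T}. J \<phi> t) \<longlongrightarrow> (LBINT t:{a..}. J \<phi> t)) at_top"
    by (rule tendsto_set_lebesgue_integral_at_top[OF _ int']) simp
  moreover have "(LBINT t:{a..T}. J \<phi> t) = I T" for T
    unfolding I_def by (rule set_borel_integral_eq_integral(2)[OF borel_integrable_atLeastAtMost'[OF Jc]])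
  ultimately have lim1: "(I \<longlongrightarrow> (LBINT t:{a..}. J \<phi> t)) at_top" by simp
  have lim2: "((\<lambda>T. - (2 * pi * C\<^sup>2) * exp (-2*T)) \<longlongrightarrow> 0) at_top"
  proof (rule tendsto_mult_right_zero)
    have "filterlim (\<lambda>t::real. 2 * t) at_top at_top"
      by (intro filterlim_tendsto_pos_mult_at_top[OF tendsto_const]) (auto intro: filterlim_ident)
    then have "filterlim (\<lambda>t::real. - (2 * t)) at_bot at_top" by (simp add: filterlim_uminus_at_bot)
    then show "((\<lambda>T::real. exp (-2*T)) \<longlongrightarrow> 0) at_top" using filterlim_compose[OF exp_at_bot] by simp
  qed
  have "0 \<le> (LBINT t:{a..}. J \<phi> t)"
    by (rule tendsto_le[OF _ lim1 lim2])
       (simp, rule eventually_mono[OF eventually_gt_at_top[of t0]], rule lower)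
  also have "(LBINT t:{a..}. J \<phi> t) = (LBINT t:{0<..}. J \<phi> t)"
    unfolding set_lebesgue_integral_def e ..
  finally show ?thesis .
qed

text \<open>The potential p |x|^\<alpha> u^(p-1) written through the continuous profile, with 2m - 2
  = \<alpha>. The maximum with 0 keeps the argument inside the half line on which w is continuous,
  so measurability holds on the whole plane.\<close>

definition pot :: "real^2 \<Rightarrow> real" where
  "pot x = p * (norm x powr (2*m - 2) * w (max 0 (- ln (norm x))) powr (p - 1))"

lemma w_max_continuous: "continuous_on UNIV (\<lambda>t. w (max 0 t))"
  by (rule continuous_on_compose2[OF w_cont]) (auto intro!: continuous_intros)

lemma pot_measurable [measurable]: "pot \<in> borel_measurable borel"
proof -
  have [measurable]: "(\<lambda>t. w (max 0 t)) \<in> borel_measurable borel"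
    by (rule borel_measurable_continuous_onI[OF w_max_continuous])
  have "(\<lambda>x::real^2. w (max 0 (- ln (norm x)))) \<in> borel_measurable borel" by measurable
  then show ?thesis unfolding pot_def[abs_def] by measurable
qed

lemma pot_nonneg: "pot x \<ge> 0"
  unfolding pot_def using p1 by simp

lemma pot_bounded: obtains C where "\<And>x. x \<in> B \<Longrightarrow> \<bar>pot x\<bar> \<le> C"
proof -
  obtain M where M: "M > 0" "\<And>t. t \<ge> 0 \<Longrightarrow> w t \<le> M" using w_bound by blast
  have "\<bar>pot x\<bar> \<le> p * (1 * M powr (p - 1))" if "x \<in> B" for x
  proof -
    have "norm x powr (2*m - 2) \<le> 1" using that m1 by (intro powr_le1) (auto simp: B_def)
    moreover have "w (max 0 (- ln (norm x))) powr (p - 1) \<le> M powr (p - 1)"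
      using p1 M w_nonneg by (intro powr_mono2) auto
    ultimately have "pot x \<le> p * (1 * M powr (p - 1))" unfolding pot_def
      using p1 by (intro mult_left_mono mult_mono) auto
    then show ?thesis using pot_nonneg[of x] by simp
  qed
  then show thesis by (rule that)
qed

lemma pot_pol: "t > 0 \<Longrightarrow> exp (-2*t) * pot (pol t \<theta>) = V t"
  unfolding pot_def V_def norm_pol by (simp add: powr_def algebra_simps flip: exp_add)

lemma Q_polar:
  assumes \<phi>: "test_fun \<phi>"
  shows "set_integrable lborel {0<..} (J \<phi>)"
    and "(\<integral>x. (norm (cgrad \<phi> x))\<^sup>2 \<partial>MB) - (\<integral>x. pot x * (\<phi> x)\<^sup>2 \<partial>MB) = (LBINT t:{0<..}. J \<phi> t)"
proof -
  have C1: "C1 \<phi>" by (rule test_fun_C1[OF \<phi>])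
  note cont = polar_continuous[OF C1]
  obtain C where C: "\<And>x. x \<in> B \<Longrightarrow> \<bar>pot x\<bar> \<le> C" using pot_bounded by blast
  have c\<phi>: "continuous_on UNIV (\<lambda>x. (\<phi> x)\<^sup>2)" by (intro continuous_on_power C1_continuous C1)
  have [measurable]: "(\<lambda>x. (\<phi> x)\<^sup>2) \<in> borel_measurable borel" by (rule borel_measurable_continuous_onI[OF c\<phi>])
  have i1: "integrable MB (\<lambda>x. (norm (cgrad \<phi> x))\<^sup>2)" using test_fun_L2(2)[OF \<phi>] by (simp add: L2_def)
  have i2: "integrable MB (\<lambda>x. pot x * (\<phi> x)\<^sup>2)"
  proof (rule Bochner_Integration.integrable_bound[where f="\<lambda>x. C * (\<phi> x)\<^sup>2"])
    show "integrable MB (\<lambda>x. C * (\<phi> x)\<^sup>2)" by (intro integrable_mult_right integrable_MB_continuous c\<phi>)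
    show "(\<lambda>x. pot x * (\<phi> x)\<^sup>2) \<in> borel_measurable MB" by (rule measurable_restrict_space1) simp
    show "AE x in MB. norm (pot x * (\<phi> x)\<^sup>2) \<le> norm (C * (\<phi> x)\<^sup>2)"
    proof (rule AE_I2)
      fix x assume "x \<in> space MB"
      then have "\<bar>pot x\<bar> \<le> \<bar>C\<bar>" using C[of x] by simp
      then show "norm (pot x * (\<phi> x)\<^sup>2) \<le> norm (C * (\<phi> x)\<^sup>2)"
        unfolding real_norm_def abs_mult by (intro mult_right_mono) auto
    qed
  qed
  let ?f = "\<lambda>x. (norm (cgrad \<phi> x))\<^sup>2 - pot x * (\<phi> x)\<^sup>2"
  have i: "integrable MB ?f" by (rule Bochner_Integration.integrable_diff[OF i1 i2])
  have inner: "(LBINT \<theta>:{0<..<2*pi}. exp (-2*t) * ?f (pol t \<theta>)) = J \<phi> t" if t: "t > 0" for t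
  proof -
    have eq: "exp (-2*t) * ?f (pol t \<theta>) = (Pt \<phi> t \<theta>)\<^sup>2 + (Pa \<phi> t \<theta>)\<^sup>2 - V t * (Ph \<phi> t \<theta>)\<^sup>2" for \<theta>
      unfolding right_diff_distrib mult.assoc[symmetric] pot_pol[OF t] Pt_Pa Ph_def ..
    have cc: "continuous_on {0..2*pi} (Pt \<phi> t)" "continuous_on {0..2*pi} (Pa \<phi> t)" "continuous_on {0..2*pi} (Ph \<phi> t)"
      by (intro cont[THEN continuous_on_sections(1)])+
    have "(LBINT \<theta>:{0<..<2*pi}. exp (-2*t) * ?f (pol t \<theta>)) = IT (\<lambda>\<theta>. (Pt \<phi> t \<theta>)\<^sup>2 + (Pa \<phi> t \<theta>)\<^sup>2 - V t * (Ph \<phi> t \<theta>)\<^sup>2)"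
      unfolding eq by (intro set_integral_open_interval continuous_on_diff continuous_on_add continuous_on_mult
          continuous_on_power continuous_on_const cc)
    also have "\<dots> = IT (\<lambda>\<theta>. (Pt \<phi> t \<theta>)\<^sup>2 + (Pa \<phi> t \<theta>)\<^sup>2) - IT (\<lambda>\<theta>. V t * (Ph \<phi> t \<theta>)\<^sup>2)"
      by (intro integral_diff integrable_continuous_interval continuous_on_add continuous_on_mult
          continuous_on_power continuous_on_const cc)
    also have "IT (\<lambda>\<theta>. (Pt \<phi> t \<theta>)\<^sup>2 + (Pa \<phi> t \<theta>)\<^sup>2) = IT (\<lambda>\<theta>. (Pt \<phi> t \<theta>)\<^sup>2) + IT (\<lambda>\<theta>. (Pa \<phi> t \<theta>)\<^sup>2)"
      by (intro integral_add integrable_continuous_interval continuous_on_power cc)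
    finally show ?thesis unfolding J_def integral_mult_right .
  qed
  have e: "indicator {0<..} t *\<^sub>R (LBINT \<theta>:{0<..<2*pi}. exp (-2*t) * ?f (pol t \<theta>)) = indicator {0<..} t *\<^sub>R J \<phi> t" for t
    using inner[of t] by (auto simp: indicator_def)
  show "set_integrable lborel {0<..} (J \<phi>)"
    using polar_iterated(1)[OF i] unfolding set_integrable_def e .
  have "integral\<^sup>L MB ?f = (LBINT t:{0<..}. J \<phi> t)"
    using polar_iterated(2)[OF i] unfolding set_lebesgue_integral_def[of lborel "{0<..}"] e .
  then show "(\<integral>x. (norm (cgrad \<phi> x))\<^sup>2 \<partial>MB) - (\<integral>x. pot x * (\<phi> x)\<^sup>2 \<partial>MB) = (LBINT t:{0<..}. J \<phi> t)"
    unfolding Bochner_Integration.integral_diff[OF i1 i2] .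
qed

end

section \<open>Radial test functions\<close>

text \<open>H is constant for t \<ge> b, that is, near the origin, so smoothness there is trivial.
  The value k at 0 has to be prescribed separately because \<open>ln 0\<close> is 0, which would
  produce H 0.\<close>

lemma radial_test_fun:
  fixes H H' :: "real \<Rightarrow> real"
  assumes d: "\<And>t. (H has_real_derivative H' t) (at t)" and c: "continuous_on UNIV H'"
    and a: "a > 0" "\<And>t. t \<le> a \<Longrightarrow> H t = 0"
    and b: "\<And>t. t \<ge> b \<Longrightarrow> H t = k" "\<And>t. t \<ge> b \<Longrightarrow> H' t = 0"
  shows "test_fun (\<lambda>x. if x = 0 then k else H (- ln (norm x)))"
    and "cgrad (\<lambda>x. if x = 0 then k else H (- ln (norm x))) x = (- H' (- ln (norm x)) / (norm x)\<^sup>2) *\<^sub>R x"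
proof -
  let ?f = "\<lambda>x::real^2. if x = 0 then k else H (- ln (norm x))"
  let ?g = "\<lambda>x::real^2. (- H' (- ln (norm x)) / (norm x)\<^sup>2) *\<^sub>R x"
  have small: "- ln (norm x) \<ge> b" if "x \<in> ball 0 (exp (-b))" "x \<noteq> 0" for x :: "real^2"
  proof -
    have "norm x < exp (-b)" "norm x > 0" using that by auto
    then have "ln (norm x) < ln (exp (-b))" by (subst ln_less_cancel_iff) auto
    then show ?thesis by simp
  qed
  have der: "(?f has_derivative (\<lambda>h. ?g x \<bullet> h)) (at x)" for x
  proof (cases "x = 0")
    case True
    have "((\<lambda>x::real^2. k) has_derivative (\<lambda>h. 0 \<bullet> h)) (at x)" by simp
    then have "(?f has_derivative (\<lambda>h. 0 \<bullet> h)) (at x)"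
      by (rule has_derivative_transform_within_open[of _ _ _ _ "ball 0 (exp (-b))"])
         (use True small b(1) in auto)
    then show ?thesis using True by simp
  next
    case False
    then have n: "x \<bullet> x > 0" by simp
    \<comment> \<open>The logarithm of the norm is half the logarithm of the inner product, which is
      easier to differentiate.\<close>
    have "((\<lambda>x. - ln (x \<bullet> x) / 2) has_derivative (\<lambda>h. - ((x \<bullet> h) / (x \<bullet> x)))) (at x)"
      using n by (auto intro!: derivative_eq_intros simp: inner_commute field_simps)
    from has_derivative_compose[OF this d[unfolded has_field_derivative_def]]
    have "((\<lambda>x. H (- ln (x \<bullet> x) / 2)) has_derivative (\<lambda>h. H' (- ln (x \<bullet> x) / 2) * - ((x \<bullet> h) / (x \<bullet> x)))) (at x)" .
    moreover have ln: "- ln (norm y) = - ln (y \<bullet> y) / 2" if "y \<noteq> 0" for y :: "real^2"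
      using that by (simp add: norm_eq_sqrt_inner ln_sqrt)
    moreover have "(\<lambda>h. H' (- ln (x \<bullet> x) / 2) * - ((x \<bullet> h) / (x \<bullet> x))) = (\<lambda>h. ?g x \<bullet> h)"
      using False by (simp add: fun_eq_iff ln power2_norm_eq_inner)
    ultimately have "((\<lambda>x. H (- ln (x \<bullet> x) / 2)) has_derivative (\<lambda>h. ?g x \<bullet> h)) (at x)" by simp
    note f = this
    have eqf: "H (- ln (y \<bullet> y) / 2) = ?f y" if "y \<in> - {0}" for y
    proof -
      have y0: "y \<noteq> 0" using that by simp
      show ?thesis unfolding ln[OF y0, symmetric] using y0 by (simp only: if_False)
    qed
    show ?thesis
    proof (rule has_derivative_transform_within_open[OF f])
      show "open (- {0::real^2})" by (rule open_Compl[OF closed_singleton])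
      show "x \<in> - {0}" using False by simp
    qed (rule eqf)
  qed
  have gc: "continuous_on UNIV ?g"
    unfolding continuous_on_eq_continuous_at[OF open_UNIV]
  proof
    fix x :: "real^2"
    show "isCont ?g x"
    proof (cases "x = 0")
      case True
      have "\<forall>\<^sub>F y in nhds x. y \<in> ball 0 (exp (-b))" using True by (intro eventually_nhds_in_open) auto
      then have "\<forall>\<^sub>F y in nhds x. ?g y = 0"
      proof eventually_elim
        case (elim y)
        then show ?case using small[of y] b(2) by (cases "y = 0") auto
      qed
      then show ?thesis using isCont_cong[of ?g "\<lambda>_. 0" x] by simp
    next
      case False
      have "isCont H' (- ln (norm x))" using c by (simp add: continuous_on_eq_continuous_at)
      moreover have "isCont (\<lambda>x. - ln (norm x)) x"
        by (intro isCont_minus isCont_ln' isCont_norm continuous_ident) (use False in simp)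
      ultimately have h: "isCont (\<lambda>x. H' (- ln (norm x))) x" by (rule isCont_o2[rotated])
      show ?thesis
        by (intro isCont_scaleR isCont_divide isCont_minus h isCont_power isCont_norm continuous_ident) (use False in simp)
    qed
  qed
  show "cgrad ?f x = ?g x" by (rule cgrad_eqI[OF der])
  have "?f x = 0" if "norm x \<ge> exp (-a)" for x
  proof -
    have "0 < exp (-a)" by simp
    then have "0 < norm x" using that by linarith
    then have "x \<noteq> 0" by auto
    have "ln (exp (-a)) \<le> ln (norm x)" using that \<open>0 < norm x\<close> by (subst ln_le_cancel_iff) auto
    then show ?thesis using a(2) \<open>x \<noteq> 0\<close> by simp
  qed
  then show "test_fun ?f"
    unfolding test_fun_iff using a(1) by (intro conjI C1I[OF der gc] bexI[of _ "exp (-a)"]) auto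
qed

text \<open>The square of the positive part is continuously differentiable across 0; this is all the
  regularity that test functions ask for.\<close>

definition sqp :: "real \<Rightarrow> real" where "sqp s = (max 0 s)\<^sup>2"

lemma sqp_deriv: "(sqp has_real_derivative 2 * max 0 s) (at s)"
proof -
  consider "s < 0" | "s > 0" | "s = 0" by linarith
  then show ?thesis
  proof cases
    case 1
    have "((\<lambda>s::real. 0) has_real_derivative 0) (at s)" by simp
    then have "(sqp has_real_derivative 0) (at s)"
      by (rule has_field_derivative_transform_within_open[of _ _ _ "{..<0}"]) (use 1 in \<open>auto simp: sqp_def\<close>)
    then show ?thesis using 1 by simp
  next
    case 2
    have "((\<lambda>s::real. s\<^sup>2) has_real_derivative 2 * s) (at s)" by (auto intro!: derivative_eq_intros)
    then have "(sqp has_real_derivative 2 * s) (at s)"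
      by (rule has_field_derivative_transform_within_open[of _ _ _ "{0<..}"]) (use 2 in \<open>auto simp: sqp_def\<close>)
    then show ?thesis using 2 by simp
  next
    case 3
    have "((\<lambda>h. max 0 h :: real) \<longlongrightarrow> max 0 0) (at 0)" by (intro tendsto_intros)
    then have "((\<lambda>h. max 0 h :: real) \<longlongrightarrow> 0) (at 0)" by simp
    moreover have "\<forall>\<^sub>F h in at 0. max 0 h = (sqp (0 + h) - sqp 0) / h"
      unfolding eventually_at_filter by (auto simp: sqp_def max_def power2_eq_square)
    ultimately have "((\<lambda>h. (sqp (0 + h) - sqp 0) / h) \<longlongrightarrow> 0) (at 0)"
      by (rule Lim_transform_eventually)
    then show ?thesis using 3 by (simp add: DERIV_def)
  qed
qed

text \<open>ramp is a continuously differentiable regularisation of the positive part.\<close>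
definition ramp :: "real \<Rightarrow> real \<Rightarrow> real" where "ramp e s = (sqp s - sqp (s - e)) / (2*e)"
definition dramp :: "real \<Rightarrow> real \<Rightarrow> real" where "dramp e s = (max 0 s - max 0 (s - e)) / e"

lemma ramp_deriv: "e > 0 \<Longrightarrow> (ramp e has_real_derivative dramp e s) (at s)"
proof -
  assume e: "e > 0"
  have "((\<lambda>s. sqp (s - e)) has_real_derivative 2 * max 0 (s - e) * 1) (at s)"
    by (rule DERIV_chain2[OF sqp_deriv]) (auto intro!: derivative_eq_intros)
  then have "((\<lambda>s. (sqp s - sqp (s - e)) / (2*e)) has_real_derivative (2 * max 0 s - 2 * max 0 (s - e) * 1) / (2*e)) (at s)"
    by (intro DERIV_cdivide DERIV_diff sqp_deriv)
  then show ?thesis unfolding ramp_def[abs_def] dramp_def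
    by (rule DERIV_cong) (use e in \<open>simp add: field_simps\<close>)
qed

lemma dramp_continuous: "continuous_on S (dramp e)"
  unfolding dramp_def[abs_def] divide_inverse by (intro continuous_intros)

lemma ramp_values:
  assumes e: "e > 0"
  shows "s \<le> 0 \<Longrightarrow> ramp e s = 0" "s \<ge> e \<Longrightarrow> ramp e s = s - e/2"
    "s \<le> 0 \<Longrightarrow> dramp e s = 0" "s \<ge> e \<Longrightarrow> dramp e s = 1" "0 \<le> dramp e s" "dramp e s \<le> 1"
    "max 0 s - e/2 \<le> ramp e s" "ramp e s \<le> max 0 s"
proof -
  show "s \<le> 0 \<Longrightarrow> ramp e s = 0" "s \<le> 0 \<Longrightarrow> dramp e s = 0" using e by (auto simp: ramp_def dramp_def sqp_def)
  show r: "s \<ge> e \<Longrightarrow> ramp e s = s - e/2" 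
    using e by (simp add: ramp_def sqp_def power2_eq_square field_simps)
  show "s \<ge> e \<Longrightarrow> dramp e s = 1" using e by (simp add: dramp_def)
  show "0 \<le> dramp e s" "dramp e s \<le> 1" using e by (auto simp: dramp_def divide_simps)
  consider "s \<le> 0" | "0 < s" "s < e" | "s \<ge> e" by linarith
  then have "max 0 s - e/2 \<le> ramp e s \<and> ramp e s \<le> max 0 s"
  proof cases
    case 2
    have r2: "ramp e s = s\<^sup>2 / (2*e)" using 2 by (simp add: ramp_def sqp_def)
    have "0 \<le> (s - e)\<^sup>2" by simp
    then have "(s - e/2) * (2*e) \<le> s\<^sup>2" by (simp add: power2_eq_square algebra_simps)
    then have 1: "s - e/2 \<le> ramp e s" unfolding r2 using e by (subst pos_le_divide_eq) auto
    have "s * s \<le> s * (2 * e)" using 2 by (intro mult_left_mono) auto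
    then have "ramp e s \<le> s" unfolding r2 using e by (subst pos_divide_le_eq) (auto simp: power2_eq_square)
    then show ?thesis using 1 2 by simp
  qed (use e r in \<open>auto simp: ramp_def sqp_def\<close>)
  then show "max 0 s - e/2 \<le> ramp e s" "ramp e s \<le> max 0 s" by auto
qed

text \<open>In polar form 1/|x| contributes exp (-2 t) exp t, which is integrable. Truncation at
  height k makes the integrand bounded and monotone convergence removes it. The function 1/|x| will
  dominate the source term of the equation.\<close>

lemma integrable_inverse_norm: "integrable MB (\<lambda>x. 1 / norm x)"
proof -
  interpret finite_measure MB by (rule finite_measure_MB)
  define f where "f = (\<lambda>(k::nat) (x::real^2). min (1 / norm x) (real k))"
  have fm [measurable]: "f k \<in> borel_measurable borel" for k unfolding f_def by measurable
  have f0: "0 \<le> f k x" for k x by (simp add: f_def)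
  have fi: "integrable MB (f k)" for k
    by (rule integrable_const_bound[of _ "real k"])
       (auto simp: f_def intro!: measurable_restrict_space1)
  have ei: "set_integrable lborel {0<..} (\<lambda>t::real. 2*pi * exp (-t))"
  proof -
    have "set_integrable lebesgue {0..} (\<lambda>t::real. exp (- 1 * t))"
      by (intro nonnegative_absolutely_integrable_1 integrable_on_exp_minus_to_infinity) auto
    then have "integrable lebesgue (\<lambda>t::real. indicator {0..} t *\<^sub>R exp (- 1 * t))" by (simp add: set_integrable_def)
    then have "set_integrable lborel {0..} (\<lambda>t::real. exp (- 1 * t))"
      unfolding set_integrable_def by (subst (asm) integrable_completion) auto
    then have "set_integrable lborel {0<..} (\<lambda>t::real. exp (- 1 * t))" by (rule set_integrable_subset) auto
    then show ?thesis by simp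
  qed
  define D where "D = (LBINT t:{0<..}. 2*pi * exp (-t::real))"
  have bound: "integral\<^sup>L MB (f k) \<le> D" for k
    unfolding polar_iterated(2)[OF fi] D_def
  proof (rule set_integral_mono[OF polar_iterated(1)[OF fi] ei])
    fix t :: real assume "t \<in> {0<..}"
    have "(LBINT \<theta>:{0<..<2*pi}. exp (-2*t) * f k (pol t \<theta>)) = IT (\<lambda>\<theta>. exp (-2*t) * f k (pol t \<theta>))"
      unfolding f_def norm_pol by (intro set_integral_open_interval continuous_on_const)
    also have "\<dots> = 2*pi * (exp (-2*t) * min (exp t) (real k))"
      unfolding f_def norm_pol by (simp add: exp_minus inverse_eq_divide)
    also have "\<dots> \<le> 2*pi * (exp (-2*t) * exp t)" by (intro mult_left_mono) auto
    also have "\<dots> = 2*pi * exp (-t)" by (simp flip: exp_add)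
    finally show "(LBINT \<theta>:{0<..<2*pi}. exp (-2*t) * f k (pol t \<theta>)) \<le> 2*pi * exp (-t)" .
  qed
  have mono: "integral\<^sup>L MB (f i) \<le> integral\<^sup>L MB (f j)" if "i \<le> j" for i j
    by (rule integral_mono[OF fi fi]) (use that in \<open>auto simp: f_def\<close>)
  have inc: "incseq (\<lambda>k. integral\<^sup>L MB (f k))" using mono by (simp add: incseq_def)
  have "\<forall>k. integral\<^sup>L MB (f k) \<le> D" using bound by simp
  with inc obtain L where L: "(\<lambda>k. integral\<^sup>L MB (f k)) \<longlonglongrightarrow> L"
    by (rule incseq_convergent)
  show ?thesis
  proof (rule integrable_monotone_convergence[OF fi _ _ L])
    show "AE x in MB. mono (\<lambda>n. f n x)" by (auto simp: f_def mono_def)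
    show "AE x in MB. (\<lambda>i. f i x) \<longlonglongrightarrow> 1 / norm x"
    proof (rule AE_I2)
      fix x :: "real^2"
      obtain N :: nat where N: "1 / norm x \<le> real N" using real_arch_simple by blast
      have "\<forall>\<^sub>F i in sequentially. f i x = 1 / norm x"
        using eventually_ge_at_top[of N] by eventually_elim (use N in \<open>auto simp: f_def min_def\<close>)
      then show "(\<lambda>i. f i x) \<longlonglongrightarrow> 1 / norm x" by (rule tendsto_eventually)
    qed
    show "(\<lambda>x. 1 / norm x) \<in> borel_measurable MB" by (rule measurable_restrict_space1) simp
  qed
qed

lemma radial_integral:
  fixes R :: "real \<Rightarrow> real"
  assumes "integrable MB (\<lambda>x. R (- ln (norm x)))"
  shows "set_integrable lborel {0<..} (\<lambda>t. exp (-2*t) * R t)"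
    and "(\<integral>x. R (- ln (norm x)) \<partial>MB) = 2*pi * (LBINT t:{0<..}. exp (-2*t) * R t)"
proof -
  have e: "(LBINT \<theta>:{0<..<2*pi}. exp (-2*t) * R (- ln (norm (pol t \<theta>)))) = 2*pi * (exp (-2*t) * R t)" for t
  proof -
    have "(LBINT \<theta>:{0<..<2*pi}. exp (-2*t) * R (- ln (norm (pol t \<theta>)))) = IT (\<lambda>\<theta>. exp (-2*t) * R t)"
      unfolding norm_pol by (simp only: ln_exp minus_minus) (intro set_integral_open_interval continuous_on_const)
    moreover have "IT (\<lambda>\<theta>. c) = 2*pi * c" for c by simp
    ultimately show ?thesis by (simp only:)
  qed
  have "set_integrable lborel {0<..} (\<lambda>t. 2*pi * (exp (-2*t) * R t))"
    using polar_iterated(1)[OF assms] unfolding e .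
  then have "integrable lborel (\<lambda>t. 1/(2*pi) * (indicator {0<..} t *\<^sub>R (2*pi * (exp (-2*t) * R t))))"
    unfolding set_integrable_def by (rule integrable_mult_right)
  moreover have "(\<lambda>t. 1/(2*pi) * (indicator {0<..} t *\<^sub>R (2*pi * (exp (-2*t) * R t)))) = (\<lambda>t. indicator {0<..} t *\<^sub>R (exp (-2*t) * R t))"
    by (simp add: fun_eq_iff)
  ultimately show "set_integrable lborel {0<..} (\<lambda>t. exp (-2*t) * R t)"
    unfolding set_integrable_def by (simp only:)
  show "(\<integral>x. R (- ln (norm x)) \<partial>MB) = 2*pi * (LBINT t:{0<..}. exp (-2*t) * R t)"
    using polar_iterated(2)[OF assms] unfolding e by (simp only: set_integral_mult_right)
qed

text \<open>From ln x \<le> x at x = t / (2 s), multiplied by s and exponentiated. Stopping at exp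
  (t/2) leaves another factor exp (t/2) to absorb a linear term.\<close>

lemma powr_le_exp:
  assumes s: "s > (0::real)"
  obtains C where "C > 0" "\<And>t. t \<ge> 0 \<Longrightarrow> t powr s \<le> C * exp (t/2)"
proof -
  define C where "C = (2 * s) powr s"
  have C: "C > 0" using s by (simp add: C_def)
  have "t powr s \<le> C * exp (t/2)" if t: "t \<ge> 0" for t
  proof (cases "t = 0")
    case False
    then have t0: "t > 0" using t by simp
    have "ln (t / (2 * s)) \<le> t / (2 * s)" using ln_le_minus_one[of "t/(2 * s)"] t0 s by simp
    then have "s * ln (t / (2 * s)) \<le> s * (t / (2 * s))" using s by (intro mult_left_mono) auto
    then have "s * ln (t / (2 * s)) \<le> t / 2" using s by simp
    then have "(t / (2 * s)) powr s \<le> exp (t/2)" using t0 s by (simp add: powr_def)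
    then have "C * (t / (2 * s)) powr s \<le> C * exp (t/2)" using C by (intro mult_left_mono) auto
    moreover have "C * (t / (2 * s)) powr s = ((2 * s) * (t / (2 * s))) powr s"
      unfolding C_def using s t0 by (intro powr_mult[symmetric])
    ultimately show ?thesis using s by simp
  qed (use C in simp)
  with C show thesis by (rule that)
qed

section \<open>Circular means and the radial profile\<close>

text \<open>Integrating a gradient against this field yields the circular mean over |x| = exp(-a).\<close>
definition Fld :: "real \<Rightarrow> real^2 \<Rightarrow> real^2" where
  "Fld a x = (if exp (-a) \<le> norm x then (- 1 / (norm x)\<^sup>2) *\<^sub>R x else 0)"

lemma Fld_measurable [measurable]: "Fld a \<in> borel_measurable borel"
  unfolding Fld_def[abs_def] by measurable

lemma Fld_norm: "norm (Fld a x) \<le> exp a"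
proof (cases "exp (-a) \<le> norm x")
  case True
  have "0 < exp (-a)" by simp
  then have n: "norm x > 0" using True by linarith
  have "norm (Fld a x) = 1 / norm x" using True n by (simp add: Fld_def power2_eq_square)
  also have "\<dots> \<le> 1 / exp (-a)" using True n by (intro divide_left_mono) auto
  finally show ?thesis by (simp add: exp_minus inverse_eq_divide)
qed (simp add: Fld_def)

lemma Fld_L2: "L2 MB (Fld a)"
proof -
  interpret finite_measure MB by (rule finite_measure_MB)
  have "integrable MB (\<lambda>x. (norm (Fld a x))\<^sup>2)"
  proof (rule integrable_const_bound[of _ "(exp a)\<^sup>2"])
    show "AE x in MB. norm ((norm (Fld a x))\<^sup>2) \<le> (exp a)\<^sup>2"
    proof (rule AE_I2)
      fix x show "norm ((norm (Fld a x))\<^sup>2) \<le> (exp a)\<^sup>2"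
        using power_mono[OF Fld_norm[of a x] norm_ge_zero, of 2] by simp
    qed
    show "(\<lambda>x. (norm (Fld a x))\<^sup>2) \<in> borel_measurable MB" by (rule measurable_restrict_space1) simp
  qed
  moreover have "Fld a \<in> borel_measurable MB" by (rule measurable_restrict_space1) simp
  ultimately show ?thesis by (simp add: L2_def)
qed

lemma Fld_pol: "Fld a (pol t \<theta>) = (if t \<le> a then (- exp (2*t)) *\<^sub>R pol t \<theta> else 0)"
proof -
  have "- 1 / (exp (-t))\<^sup>2 = - exp (2*t)" by (simp add: exp_minus power_inverse field_simps flip: exp_double)
  then show ?thesis by (simp add: Fld_def)
qed

lemma Fld_norm_integral:
  assumes "a > 0" shows "(\<integral>x. (norm (Fld a x))\<^sup>2 \<partial>MB) = 2 * pi * a"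
proof -
  have i: "integrable MB (\<lambda>x. (norm (Fld a x))\<^sup>2)" using Fld_L2[of a] by (simp add: L2_def)
  have e: "exp (-2*t) * (norm (Fld a (pol t \<theta>)))\<^sup>2 = (if t \<le> a then 1 else 0)" for t \<theta>
    unfolding Fld_pol by (simp add: power_mult_distrib flip: exp_double exp_add)
  have "(LBINT \<theta>:{0<..<2*pi}. exp (-2*t) * (norm (Fld a (pol t \<theta>)))\<^sup>2) = 2 * pi * (if t \<le> a then 1 else 0)" for t
    unfolding e by (subst set_integral_open_interval) (auto intro: continuous_on_const)
  then have "(\<integral>x. (norm (Fld a x))\<^sup>2 \<partial>MB) = (LBINT t:{0<..}. 2 * pi * (if t \<le> a then 1 else 0))"
    unfolding polar_iterated(2)[OF i] by (simp only:)
  also have "\<dots> = (LBINT t:{0<..a}. 2 * pi)"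
    unfolding set_lebesgue_integral_def by (intro Bochner_Integration.integral_cong) (auto simp: indicator_def)
  also have "\<dots> = 2 * pi * a" using assms by (simp add: set_integral_const)
  finally show ?thesis .
qed

text \<open>In polar coordinates the integrand is the t-derivative of \<phi> for t \<le> a and 0
  beyond. The fundamental theorem in t leaves the values on the circle t = a, because \<phi>
  vanishes on the circle t = 0.\<close>

lemma Fld_flux:
  assumes \<phi>: "test_fun \<phi>"
  shows "(\<integral>x. cgrad \<phi> x \<bullet> Fld a x \<partial>MB) = IT (Ph \<phi> a)"
proof -
  have C1: "C1 \<phi>" by (rule test_fun_C1[OF \<phi>])
  note cont = polar_continuous[OF C1]
  obtain r where r: "0 < r" "r < 1" "\<And>x. norm x \<ge> r \<Longrightarrow> \<phi> x = 0" "\<And>x. norm x \<ge> r \<Longrightarrow> cgrad \<phi> x = 0"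
    using test_fun_vanish[OF \<phi>] by blast
  have i: "integrable MB (\<lambda>x. cgrad \<phi> x \<bullet> Fld a x)" by (rule L2_inner[OF test_fun_L2(2)[OF \<phi>] Fld_L2])
  have e: "exp (-2*t) * (cgrad \<phi> (pol t \<theta>) \<bullet> Fld a (pol t \<theta>)) = (if t \<le> a then Pt \<phi> t \<theta> else 0)" for t \<theta>
    unfolding Fld_pol Pt_def by (simp add: mult.assoc[symmetric] flip: exp_add)
  have van: "Ph \<phi> t \<theta> = 0" if "t \<le> 0" for t \<theta>
  proof -
    have "1 \<le> norm (pol t \<theta>)" using that by simp
    then show ?thesis using r unfolding Ph_def by (intro r(3)) linarith
  qed
  have inner: "(LBINT \<theta>:{0<..<2*pi}. exp (-2*t) * (cgrad \<phi> (pol t \<theta>) \<bullet> Fld a (pol t \<theta>))) = (if t \<le> a then IT (Pt \<phi> t) else 0)" for t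
    unfolding e using set_integral_open_interval[OF continuous_on_sections(1)[OF cont(2)], of 0 "2*pi" t]
    by (cases "t \<le> a") (simp_all add: set_lebesgue_integral_def)
  show ?thesis
  proof (cases "a \<le> 0")
    case True
    have "(\<integral>x. cgrad \<phi> x \<bullet> Fld a x \<partial>MB) = (LBINT t:{0<..}. if t \<le> a then IT (Pt \<phi> t) else 0)"
      unfolding polar_iterated(2)[OF i] inner ..
    also have "\<dots> = (\<integral>t. 0 \<partial>(lborel :: real measure))"
      unfolding set_lebesgue_integral_def by (intro Bochner_Integration.integral_cong) (use True in \<open>auto simp: indicator_def\<close>)
    finally have "(\<integral>x. cgrad \<phi> x \<bullet> Fld a x \<partial>MB) = 0" by simp
    moreover have "Ph \<phi> a = (\<lambda>\<theta>. 0)" using van[OF True] by blast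
    ultimately show ?thesis by simp
  next
    case False
    then have a: "0 < a" by simp
    have c: "continuous_on {0..a} (\<lambda>t. IT (Pt \<phi> t))" by (rule continuous_IT[OF cont(2)])
    have "(\<integral>x. cgrad \<phi> x \<bullet> Fld a x \<partial>MB) = (LBINT t:{0<..}. if t \<le> a then IT (Pt \<phi> t) else 0)"
      unfolding polar_iterated(2)[OF i] inner ..
    also have "\<dots> = (LBINT t:{0<..<a}. IT (Pt \<phi> t))"
      unfolding set_lebesgue_integral_def
    proof (rule integral_cong_AE)
      show "AE t in lborel. indicator {0<..} t *\<^sub>R (if t \<le> a then IT (Pt \<phi> t) else 0) = indicator {0<..<a} t *\<^sub>R IT (Pt \<phi> t)"
        using AE_lborel_singleton[of a] by eventually_elim (auto simp: indicator_def)
      have "set_integrable lborel {0..a} (\<lambda>t. IT (Pt \<phi> t))" by (rule borel_integrable_atLeastAtMost'[OF c])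
      then have "set_integrable lborel {0<..<a} (\<lambda>t. IT (Pt \<phi> t))" by (rule set_integrable_subset) auto
      then show "(\<lambda>t. indicator {0<..<a} t *\<^sub>R IT (Pt \<phi> t)) \<in> borel_measurable lborel"
        unfolding set_integrable_def by (rule borel_measurable_integrable)
      show "(\<lambda>t. indicator {0<..} t *\<^sub>R (if t \<le> a then IT (Pt \<phi> t) else 0)) \<in> borel_measurable lborel"
        using polar_iterated(1)[OF i] unfolding inner set_integrable_def by (rule borel_measurable_integrable)
    qed
    also have "\<dots> = integral {0..a} (\<lambda>t. IT (Pt \<phi> t))" by (rule set_integral_open_interval[OF c])
    also have "\<dots> = IT (Ph \<phi> a) - IT (Ph \<phi> 0)"
    proof (rule integral_unique, rule fundamental_theorem_of_calculus)
      fix t show "((\<lambda>t. IT (Ph \<phi> t)) has_vector_derivative IT (Pt \<phi> t)) (at t within {0..a})"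
        unfolding has_real_derivative_iff_has_vector_derivative[symmetric]
        by (rule has_field_derivative_at_within, rule IT_deriv[OF cont(1) cont(2)], rule Ph_deriv(1)[OF C1])
    qed (use a in simp)
    finally have "(\<integral>x. cgrad \<phi> x \<bullet> Fld a x \<partial>MB) = IT (Ph \<phi> a) - IT (Ph \<phi> 0)" .
    moreover have "Ph \<phi> 0 = (\<lambda>\<theta>. 0)" using van[of 0] by blast
    ultimately show ?thesis by simp
  qed
qed

text \<open>Bessel's inequality for the constant mode alone.\<close>

lemma IT_jensen:
  assumes "continuous_on {0..2*pi} g"
  shows "(IT g)\<^sup>2 \<le> 2 * pi * IT (\<lambda>\<theta>. (g \<theta>)\<^sup>2)"
proof -
  have "(cf g 0)\<^sup>2 \<le> IT (\<lambda>\<theta>. (g \<theta>)\<^sup>2)" using bessel[OF assms, of 1] by simp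
  moreover have "cf g 0 = IT g / sqrt (2*pi)" unfolding cf_def tb_0 by simp
  ultimately show ?thesis by (simp add: power_divide field_simps)
qed

locale radial_limit =
  fixes u :: "real^2 \<Rightarrow> real" and G :: "real^2 \<Rightarrow> real^2" and \<phi> :: "nat \<Rightarrow> real^2 \<Rightarrow> real"
  assumes rad: "radial u" and test: "\<And>n. test_fun (\<phi> n)"
    and Lu: "L2lim MB \<phi> u" and LG: "L2lim MB (\<lambda>n. cgrad (\<phi> n)) G"
begin

text \<open>The circular mean of u over |x| = exp (-a), expressed through the gradient: a mean over
  a single circle has no meaning for a function given up to null sets, whereas this pairing is
  defined for every a.\<close>

definition W :: "real \<Rightarrow> real" where "W a = (\<integral>x. G x \<bullet> Fld a x \<partial>MB) / (2*pi)"

lemma W_lim: "(\<lambda>n. IT (Ph (\<phi> n) a) / (2*pi)) \<longlonglongrightarrow> W a"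
proof -
  have "(\<lambda>n. \<integral>x. cgrad (\<phi> n) x \<bullet> Fld a x \<partial>MB) \<longlonglongrightarrow> (\<integral>x. G x \<bullet> Fld a x \<partial>MB)"
    by (rule L2lim_inner[OF LG L2lim_const[OF Fld_L2]])
  then show ?thesis unfolding Fld_flux[OF test] W_def by (intro tendsto_divide tendsto_const) auto
qed

lemma W_measurable [measurable]: "W \<in> borel_measurable borel"
proof (rule borel_measurable_LIMSEQ_real[OF W_lim])
  show "(\<lambda>x. IT (Ph (\<phi> n) x) / (2*pi)) \<in> borel_measurable borel" for n
    by (intro borel_measurable_continuous_onI continuous_on_divide continuous_on_const
       continuous_IT[OF polar_continuous(1)[OF test_fun_C1[OF test]]]) simp
qed

text \<open>Cauchy-Schwarz against \<open>Fld a\<close>, whose squared norm is 2 pi a. The growth of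
  an H^1_0 radial function at the origin is thus at most the square root of -ln |x|.\<close>

lemma W_bound: obtains C where "C > 0" "\<And>a. a > 0 \<Longrightarrow> \<bar>W a\<bar> \<le> C * sqrt a"
proof -
  have LG2: "L2 MB G" by (rule L2limD(1)[OF LG])
  define N where "N = (\<integral>x. (norm (G x))\<^sup>2 \<partial>MB)"
  have N: "N \<ge> 0" by (simp add: N_def)
  have "\<bar>W a\<bar> \<le> sqrt (N + 1) * sqrt a" if a: "a > 0" for a
  proof -
    have "(2*pi * W a)\<^sup>2 \<le> N * (2*pi*a)"
      using L2_cauchy_schwarz[OF LG2 Fld_L2[of a]] unfolding Fld_norm_integral[OF a] N_def W_def by simp
    then have "(2*pi) * (2*pi * (W a)\<^sup>2) \<le> (2*pi) * (N * a)" by (simp add: power_mult_distrib power2_eq_square algebra_simps)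
    then have 1: "2*pi * (W a)\<^sup>2 \<le> N * a" by simp
    have "1 * (W a)\<^sup>2 \<le> 2*pi * (W a)\<^sup>2" by (rule mult_right_mono) (use pi_gt3 in auto)
    also note 1
    also have "N * a \<le> (N + 1) * a" using a by simp
    finally have "(W a)\<^sup>2 \<le> (N + 1) * a" by simp
    then have "sqrt ((W a)\<^sup>2) \<le> sqrt ((N + 1) * a)" by (rule real_sqrt_le_mono)
    then show ?thesis by (simp add: real_sqrt_mult)
  qed
  then show thesis using that[of "sqrt (N + 1)"] N by simp
qed

lemma u_pol: "t > 0 \<Longrightarrow> u (pol t \<theta>) = u (pol t 0)"
  using rad pol_in_B[of t] unfolding radial_def by simp

text \<open>Jensen bounds the deviation of the means of \<phi> n from u by a density g n whose
  integral is the squared L2 distance. A subsequence of g tends to 0 almost everywhere, while the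
  means themselves converge to W for every t.\<close>

lemma u_eq_W_t: "AE t in lborel. t > 0 \<longrightarrow> u (pol t 0) = W t"
proof -
  define g where "g = (\<lambda>n t. indicator {0<..} t *\<^sub>R (LBINT \<theta>:{0<..<2*pi}. exp (-2*t) * (\<phi> n (pol t \<theta>) - u (pol t \<theta>))\<^sup>2))"
  have i: "integrable MB (\<lambda>x. (\<phi> n x - u x)\<^sup>2)" for n
    using L2_diff[OF L2limD(2)[OF Lu, of n] L2limD(1)[OF Lu]] by (simp add: L2_def)
  have gi: "integrable lborel (g n)" for n
    using polar_iterated(1)[OF i] unfolding set_integrable_def g_def .
  have gI: "integral\<^sup>L lborel (g n) = (\<integral>x. (\<phi> n x - u x)\<^sup>2 \<partial>MB)" for n
    using polar_iterated(2)[OF i[of n]] unfolding set_lebesgue_integral_def[of lborel "{0<..}"] g_def by simp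
  have low: "indicator {0<..} t * (exp (-2*t) * (2*pi) * (IT (Ph (\<phi> n) t) / (2*pi) - u (pol t 0))\<^sup>2) \<le> g n t" for n t
  proof (cases "t > 0")
    case True
    let ?U = "u (pol t 0)"
    have c: "continuous_on {0..2*pi} (Ph (\<phi> n) t)"
      by (rule continuous_on_sections(1)[OF polar_continuous(1)[OF test_fun_C1[OF test]]])
    then have c2: "continuous_on {0..2*pi} (\<lambda>\<theta>. Ph (\<phi> n) t \<theta> - ?U)" by (intro continuous_on_diff continuous_on_const)
    have "IT (\<lambda>\<theta>. Ph (\<phi> n) t \<theta> - ?U) = IT (Ph (\<phi> n) t) - IT (\<lambda>\<theta>. ?U)"
      by (intro integral_diff integrable_continuous_interval c continuous_on_const)
    then have I: "IT (\<lambda>\<theta>. Ph (\<phi> n) t \<theta> - ?U) = 2*pi * (IT (Ph (\<phi> n) t) / (2*pi) - ?U)"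
      by (simp add: right_diff_distrib)
    have "(2*pi) * ((2*pi) * (IT (Ph (\<phi> n) t) / (2*pi) - ?U)\<^sup>2) \<le> (2*pi) * IT (\<lambda>\<theta>. (Ph (\<phi> n) t \<theta> - ?U)\<^sup>2)"
      using IT_jensen[OF c2] unfolding I power_mult_distrib by (simp add: power2_eq_square mult.assoc)
    then have 1: "(2*pi) * (IT (Ph (\<phi> n) t) / (2*pi) - ?U)\<^sup>2 \<le> IT (\<lambda>\<theta>. (Ph (\<phi> n) t \<theta> - ?U)\<^sup>2)" by simp
    have "g n t = (LBINT \<theta>:{0<..<2*pi}. exp (-2*t) * (Ph (\<phi> n) t \<theta> - ?U)\<^sup>2)"
    proof -
      have "(\<phi> n (pol t \<theta>) - u (pol t \<theta>))\<^sup>2 = (Ph (\<phi> n) t \<theta> - ?U)\<^sup>2" for \<theta>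
        unfolding Ph_def u_pol[OF True, of \<theta>] ..
      then show ?thesis using True by (simp add: g_def)
    qed
    also have "\<dots> = IT (\<lambda>\<theta>. exp (-2*t) * (Ph (\<phi> n) t \<theta> - ?U)\<^sup>2)"
      by (intro set_integral_open_interval continuous_on_mult continuous_on_const continuous_on_power c2)
    also have "\<dots> = exp (-2*t) * IT (\<lambda>\<theta>. (Ph (\<phi> n) t \<theta> - ?U)\<^sup>2)" by (rule integral_mult_right)
    finally show ?thesis using True mult_left_mono[OF 1, of "exp (-2*t)"] by (simp add: mult.assoc)
  qed (simp add: g_def)
  have g0: "0 \<le> g n t" for n t
    by (rule order_trans[OF _ low]) simp
  have gl: "(\<lambda>n. \<integral>t. norm (g n t) \<partial>lborel) \<longlonglongrightarrow> 0"
    using Lu g0 unfolding L2lim_def by (simp add: gI)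
  obtain r where r: "strict_mono r" "AE t in lborel. (\<lambda>n. g (r n) t) \<longlonglongrightarrow> 0"
    using tendsto_L1_AE_subseq[of lborel g, OF gi gl] by blast
  from r(2) show ?thesis
  proof eventually_elim
    case (elim t)
    show ?case
    proof
      assume t: "t > 0"
      define c where "c = exp (-2*t) * (2*pi)"
      have c: "c > 0" by (simp add: c_def)
      have "(\<lambda>n. c * (IT (Ph (\<phi> (r n)) t) / (2*pi) - u (pol t 0))\<^sup>2) \<longlonglongrightarrow> 0"
        by (rule tendsto_zero_squeeze[OF elim]) (use low[of t] t c in \<open>auto simp: c_def\<close>)
      moreover have "(\<lambda>n. IT (Ph (\<phi> (r n)) t) / (2*pi)) \<longlonglongrightarrow> W t"
        using LIMSEQ_subseq_LIMSEQ[OF W_lim r(1)] by (simp add: o_def)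
      then have "(\<lambda>n. c * (IT (Ph (\<phi> (r n)) t) / (2*pi) - u (pol t 0))\<^sup>2) \<longlonglongrightarrow> c * (W t - u (pol t 0))\<^sup>2"
        by (intro tendsto_mult tendsto_power tendsto_diff tendsto_const)
      ultimately have "c * (W t - u (pol t 0))\<^sup>2 = 0" by (rule LIMSEQ_unique[rotated])
      then show "u (pol t 0) = W t" using c by simp
    qed
  qed
qed

text \<open>The exceptional set is transported from t to x by integrating its indicator function in
  polar coordinates.\<close>

lemma u_eq_W: "AE x in MB. u x = W (- ln (norm x))"
proof -
  interpret finite_measure MB by (rule finite_measure_MB)
  have um [measurable]: "u \<in> borel_measurable MB" using L2limD(1)[OF Lu] by (simp add: L2_def)
  define D where "D = (\<lambda>x. if u x = W (- ln (norm x)) then 0 else 1 :: real)"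
  have "(\<lambda>x::real^2. W (- ln (norm x))) \<in> borel_measurable borel" by measurable
  then have [measurable]: "(\<lambda>x. W (- ln (norm x))) \<in> borel_measurable MB"
    by (intro measurable_restrict_space1) simp
  have Dm [measurable]: "D \<in> borel_measurable MB" unfolding D_def by measurable
  have Di: "integrable MB D" by (rule integrable_const_bound[of _ 1]) (auto simp: D_def)
  have "AE t in lborel. indicator {0<..} t *\<^sub>R (LBINT \<theta>:{0<..<2*pi}. exp (-2*t) * D (pol t \<theta>)) = 0"
    using u_eq_W_t
  proof eventually_elim
    case (elim t)
    show ?case
    proof (cases "t > 0")
      case True
      then have "D (pol t \<theta>) = 0" for \<theta> using elim u_pol[OF True] by (simp add: D_def)
      then show ?thesis by (simp add: set_lebesgue_integral_def)
    qed simp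
  qed
  then have "integral\<^sup>L MB D = 0"
    unfolding polar_iterated(2)[OF Di] set_lebesgue_integral_def[of lborel "{0<..}"] by (rule integral_eq_zero_AE)
  then have "AE x in MB. D x = 0"
    by (subst (asm) integral_nonneg_eq_0_iff_AE[OF Di]) (auto simp: D_def)
  then show ?thesis by eventually_elim (auto simp: D_def split: if_splits)
qed

end

section \<open>The profile solves the radial equation\<close>

lemma L2_MB_integrable_norm:
  assumes "L2 MB f" shows "integrable MB (\<lambda>x. norm (f x))"
proof -
  have 1: "L2 MB (\<lambda>x. norm (f x))" using assms by (auto simp: L2_def intro!: borel_measurable_norm)
  have 2: "L2 MB (\<lambda>x. 1::real)" by (rule L2_MB_continuous) (rule continuous_on_const)
  show ?thesis using L2_inner[OF 1 2] by simp
qed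

lemma AE_MB_nonzero: "AE x in MB. x \<noteq> 0"
  unfolding AE_MB using AE_lborel_singleton[of "0::real^2"] by eventually_elim simp

text \<open>He a e tends to min(t, a) as e tends to 0; thus He a e (- ln |x|) approximates the radial Green function.\<close>
definition He :: "real \<Rightarrow> real \<Rightarrow> real \<Rightarrow> real" where "He a e t = ramp e (t - e) - ramp e (t - a)"
definition dHe :: "real \<Rightarrow> real \<Rightarrow> real \<Rightarrow> real" where "dHe a e t = dramp e (t - e) - dramp e (t - a)"

lemma He_deriv: "e > 0 \<Longrightarrow> (He a e has_real_derivative dHe a e t) (at t)"
proof -
  assume e: "e > 0"
  have "((\<lambda>t. ramp e (t - c)) has_real_derivative dramp e (t - c) * 1) (at t)" for c
    by (rule DERIV_chain2[OF ramp_deriv[OF e]]) (auto intro!: derivative_eq_intros)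
  then have "((\<lambda>t. ramp e (t - e) - ramp e (t - a)) has_real_derivative dramp e (t - e) * 1 - dramp e (t - a) * 1) (at t)"
    by (intro DERIV_diff)
  then show ?thesis unfolding He_def[abs_def] dHe_def by simp
qed

lemma dHe_continuous: "continuous_on S (dHe a e)"
proof -
  have "continuous_on S (\<lambda>t. dramp e (t - c))" for c
    by (rule continuous_on_compose2[OF dramp_continuous[of UNIV]]) (auto intro!: continuous_intros)
  then show ?thesis unfolding dHe_def[abs_def] by (intro continuous_on_diff)
qed

lemma He_values:
  assumes e: "e > 0" "e \<le> a/2"
  shows "t \<le> e \<Longrightarrow> He a e t = 0" "t \<ge> 2*a \<Longrightarrow> He a e t = a - e" "t \<ge> 2*a \<Longrightarrow> dHe a e t = 0"
    "\<bar>dHe a e t\<bar> \<le> 1" "t \<ge> 0 \<Longrightarrow> \<bar>He a e t - min t a\<bar> \<le> 2*e" "t \<ge> 0 \<Longrightarrow> \<bar>He a e t\<bar> \<le> 2*a"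
proof -
  note r = ramp_values[OF e(1)]
  show "t \<le> e \<Longrightarrow> He a e t = 0" using r(1)[of "t - e"] r(1)[of "t - a"] e by (simp add: He_def)
  show "t \<ge> 2*a \<Longrightarrow> He a e t = a - e" using r(2)[of "t - e"] r(2)[of "t - a"] e by (simp add: He_def)
  show "t \<ge> 2*a \<Longrightarrow> dHe a e t = 0" using r(4)[of "t - e"] r(4)[of "t - a"] e by (simp add: dHe_def)
  show "\<bar>dHe a e t\<bar> \<le> 1" using r(5,6)[of "t - e"] r(5,6)[of "t - a"] unfolding dHe_def by linarith
  show 1: "\<bar>He a e t - min t a\<bar> \<le> 2*e" if "t \<ge> 0"
    using r(7,8)[of "t - e"] r(7,8)[of "t - a"] that e unfolding He_def by linarith
  show "t \<ge> 0 \<Longrightarrow> \<bar>He a e t\<bar> \<le> 2*a" using 1 e by linarith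
qed

locale radial_solution = radial_limit +
  fixes \<alpha> p :: real
  assumes alpha: "\<alpha> \<ge> 0" and p1: "p > 1"
    and pos: "AE x in MB. u x > 0"
    and weak: "\<And>\<psi>. test_fun \<psi> \<Longrightarrow> (\<integral>x. G x \<bullet> cgrad \<psi> x \<partial>MB) =
      (\<integral>x. norm x powr \<alpha> * \<bar>u x\<bar> powr (p-1) * u x * \<psi> x \<partial>MB)"
begin

text \<open>Positivity of W is known only almost everywhere at this point, so the positive part is
  put under the power; \<open>Wp_eq\<close> removes it later. \<open>Rr\<close> is then the source
  |x|^\<alpha> u^p as a function of t = -ln |x|.\<close>

definition Wp :: "real \<Rightarrow> real" where "Wp t = max 0 (W t)"
definition Rr :: "real \<Rightarrow> real" where "Rr t = exp (- \<alpha> * t) * Wp t powr p"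

lemma Rr_measurable [measurable]: "Rr \<in> borel_measurable borel"
  unfolding Rr_def[abs_def] Wp_def by measurable

lemma Rr_nonneg: "Rr t \<ge> 0" by (simp add: Rr_def)

text \<open>By \<open>W_bound\<close> the source grows at most like t^(p/2). Any such power is
  beaten by exp (t/2), and so is the factor t + 1; the product exp t is 1/|x|, which is integrable
  on the disc.\<close>

lemma Rr_bound: obtains D where "D > 0" "\<And>t. t > 0 \<Longrightarrow> Rr t * (t + 1) \<le> D * exp t"
proof -
  obtain C where C: "C > 0" "\<And>a. a > 0 \<Longrightarrow> \<bar>W a\<bar> \<le> C * sqrt a" using W_bound by blast
  have "p/2 > 0" using p1 by simp
  then obtain E where E: "E > 0" "\<And>t. t \<ge> 0 \<Longrightarrow> t powr (p/2) \<le> E * exp (t/2)" using powr_le_exp by blast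
  have "Rr t * (t + 1) \<le> (C powr p * E * 2) * exp t" if t: "t > 0" for t
  proof -
    have "Wp t \<le> C * sqrt t" using C(2)[OF t] C(1) t unfolding Wp_def by auto
    then have "Wp t powr p \<le> (C * sqrt t) powr p" using p1 by (intro powr_mono2) (auto simp: Wp_def)
    also have "\<dots> = C powr p * t powr (p/2)"
      using C(1) t by (simp add: powr_mult powr_half_sqrt[symmetric] powr_powr)
    also have "\<dots> \<le> C powr p * (E * exp (t/2))" using E(2)[of t] t by (intro mult_left_mono) auto
    finally have 1: "Wp t powr p \<le> C powr p * E * exp (t/2)" by (simp add: mult.assoc)
    have "1 + t/2 \<le> exp (t/2)" by (rule exp_ge_add_one_self)
    then have 2: "t + 1 \<le> 2 * exp (t/2)" using t by linarith
    have "exp (- \<alpha> * t) \<le> 1" using alpha t by simp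
    then have "Rr t \<le> 1 * (C powr p * E * exp (t/2))" unfolding Rr_def using 1 by (intro mult_mono) auto
    then have "Rr t * (t + 1) \<le> (C powr p * E * exp (t/2)) * (2 * exp (t/2))"
      using 2 t Rr_nonneg[of t] C E by (intro mult_mono) auto
    also have "\<dots> = (C powr p * E * 2) * (exp (t/2) * exp (t/2))" by simp
    also have "exp (t/2) * exp (t/2) = exp t" by (simp flip: exp_add)
    finally show ?thesis .
  qed
  then show thesis using that[of "C powr p * E * 2"] C E by simp
qed

lemma Rr_integrable:
  assumes [measurable]: "h \<in> borel_measurable borel" and h: "\<And>t. t > 0 \<Longrightarrow> \<bar>h t\<bar> \<le> c * (t + 1)"
  shows "integrable MB (\<lambda>x. Rr (- ln (norm x)) * h (- ln (norm x)))"
proof -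
  obtain D where D: "D > 0" "\<And>t. t > 0 \<Longrightarrow> Rr t * (t + 1) \<le> D * exp t" using Rr_bound by blast
  show ?thesis
  proof (rule Bochner_Integration.integrable_bound[where f="\<lambda>x. \<bar>c\<bar> * D * (1 / norm x)"])
    show "integrable MB (\<lambda>x. \<bar>c\<bar> * D * (1 / norm x))" by (intro integrable_mult_right integrable_inverse_norm)
    have "(\<lambda>x::real^2. Rr (- ln (norm x)) * h (- ln (norm x))) \<in> borel_measurable borel" by measurable
    then show "(\<lambda>x. Rr (- ln (norm x)) * h (- ln (norm x))) \<in> borel_measurable MB"
      by (intro measurable_restrict_space1) simp
    show "AE x in MB. norm (Rr (- ln (norm x)) * h (- ln (norm x))) \<le> norm (\<bar>c\<bar> * D * (1 / norm x))"
      using AE_MB_nonzero AE_space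
    proof eventually_elim
      case (elim x)
      define t where "t = - ln (norm x)"
      have t: "t > 0" using elim by (simp add: t_def B_def)
      have et: "exp t = 1 / norm x" using elim by (simp add: t_def exp_minus inverse_eq_divide)
      have "\<bar>h t\<bar> \<le> \<bar>c\<bar> * (t + 1)" by (rule order_trans[OF h[OF t] mult_right_mono]) (use t in simp_all)
      then have "Rr t * \<bar>h t\<bar> \<le> Rr t * (\<bar>c\<bar> * (t + 1))" by (rule mult_left_mono[OF _ Rr_nonneg])
      also have "\<dots> = \<bar>c\<bar> * (Rr t * (t + 1))" by simp
      also have "\<dots> \<le> \<bar>c\<bar> * (D * exp t)" by (intro mult_left_mono D t) simp
      finally show ?case unfolding t_def[symmetric] et using D(1) Rr_nonneg[of t] by (simp add: abs_mult)
    qed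
  qed
qed

lemma source_AE:
  "AE x in MB. norm x powr \<alpha> * \<bar>u x\<bar> powr (p-1) * u x = Rr (- ln (norm x))"
  using u_eq_W pos AE_MB_nonzero
proof eventually_elim
  case (elim x)
  have Wp: "Wp (- ln (norm x)) = u x" using elim by (simp add: Wp_def)
  have "norm x powr \<alpha> = exp (- \<alpha> * - ln (norm x))" using elim by (simp add: powr_def)
  moreover have "u x powr p = u x powr (p-1) * u x" using elim powr_add[of "u x" "p-1" 1] by simp
  ultimately show ?case using elim unfolding Rr_def Wp by simp
qed

text \<open>The weak equation is tested with C1 regularisations of min (-ln |x|, a), the Green
  function averaged over a circle. In the limit the gradients become \<open>Fld a\<close>, and the
  functions the truncated logarithm.\<close>

lemma weak_green:
  assumes a: "a > 0"
  shows "(\<integral>x. G x \<bullet> Fld a x \<partial>MB) = (\<integral>x. Rr (- ln (norm x)) * min (- ln (norm x)) a \<partial>MB)"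
proof -
  have um [measurable]: "u \<in> borel_measurable MB" using L2limD(1)[OF Lu] by (simp add: L2_def)
  have Gm [measurable]: "G \<in> borel_measurable MB" using L2limD(1)[OF LG] by (simp add: L2_def)
  \<comment> \<open>Positive parameters tending to 0 that respect the bound a/2 required by
    \<open>He_values\<close>.\<close>
  define e where "e = (\<lambda>j. a / 2 / real (Suc j))"
  have e: "e j > 0" "e j \<le> a / 2" for j using a by (auto simp: e_def divide_simps)
  have e0: "e \<longlonglongrightarrow> 0" unfolding e_def using LIMSEQ_inverse_real_of_nat
    by (intro tendsto_divide_0[OF tendsto_const] filterlim_compose[OF filterlim_real_sequentially] filterlim_at_top_imp_at_infinity filterlim_Suc)
  define \<psi> where "\<psi> = (\<lambda>j (x::real^2). if x = 0 then a - e j else He a (e j) (- ln (norm x)))"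
  have t\<psi>: "test_fun (\<psi> j)" and g\<psi>: "cgrad (\<psi> j) x = (- dHe a (e j) (- ln (norm x)) / (norm x)\<^sup>2) *\<^sub>R x" for j x
    unfolding \<psi>_def
    using radial_test_fun[of "He a (e j)" "dHe a (e j)" "e j" "2*a" "a - e j", OF He_deriv[OF e(1)] dHe_continuous e(1)
      He_values(1)[OF e] He_values(2)[OF e] He_values(3)[OF e]] by auto
  have [measurable]: "\<psi> j \<in> borel_measurable borel" "cgrad (\<psi> j) \<in> borel_measurable borel" for j
    by (intro borel_measurable_continuous_onI C1_continuous C1_cgrad_continuous test_fun_C1 t\<psi>)+
  have [measurable]: "\<psi> j \<in> borel_measurable MB" "cgrad (\<psi> j) \<in> borel_measurable MB" for j
    by (intro measurable_restrict_space1, simp)+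
  have lim1: "(\<lambda>j. \<integral>x. G x \<bullet> cgrad (\<psi> j) x \<partial>MB) \<longlonglongrightarrow> (\<integral>x. G x \<bullet> Fld a x \<partial>MB)"
  proof (rule integral_dominated_convergence[where w="\<lambda>x. exp (2*a) * norm (G x)"])
    show "integrable MB (\<lambda>x. exp (2*a) * norm (G x))"
      by (intro integrable_mult_right L2_MB_integrable_norm L2limD(1)[OF LG])
    show "(\<lambda>x. G x \<bullet> Fld a x) \<in> borel_measurable MB"
      by (rule borel_measurable_integrable, rule L2_inner[OF L2limD(1)[OF LG] Fld_L2])
    show "(\<lambda>x. G x \<bullet> cgrad (\<psi> j) x) \<in> borel_measurable MB" for j by measurable
    show "AE x in MB. (\<lambda>j. G x \<bullet> cgrad (\<psi> j) x) \<longlonglongrightarrow> G x \<bullet> Fld a x"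
      using AE_MB_nonzero AE_space
    proof eventually_elim
      case (elim x)
      define t where "t = - ln (norm x)"
      have t: "t > 0" using elim by (simp add: t_def B_def)
      have nx: "norm x = exp (-t)" using elim by (simp add: t_def)
      \<comment> \<open>For fixed t the derivative is eventually equal to its limit, including at
        the corner t = a, because the second ramp starts only beyond a.\<close>
      have "\<forall>\<^sub>F j in sequentially. dHe a (e j) t = (if t \<le> a then 1 else 0)"
      proof (cases "t \<le> a")
        case True
        have "\<forall>\<^sub>F j in sequentially. e j < t/2" by (rule order_tendstoD(2)[OF e0]) (use t in simp)
        then show ?thesis
        proof eventually_elim
          case (elim j)
          then show ?case using True ramp_values(3)[OF e(1)[of j], of "t - a"] ramp_values(4)[OF e(1)[of j], of "t - e j"]
            by (simp add: dHe_def)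
        qed
      next
        case False
        have "\<forall>\<^sub>F j in sequentially. e j < t - a" by (rule order_tendstoD(2)[OF e0]) (use False in simp)
        then show ?thesis
        proof eventually_elim
          case (elim j)
          then show ?case using False a e(2)[of j] ramp_values(4)[OF e(1)[of j], of "t - a"] ramp_values(4)[OF e(1)[of j], of "t - e j"]
            by (simp add: dHe_def)
        qed
      qed
      then have "\<forall>\<^sub>F j in sequentially. G x \<bullet> cgrad (\<psi> j) x = G x \<bullet> Fld a x"
      proof eventually_elim
        case (elim j)
        show ?case using elim unfolding g\<psi> Fld_def nx by simp
      qed
      then show ?case by (rule tendsto_eventually)
    qed
    show "AE x in MB. norm (G x \<bullet> cgrad (\<psi> j) x) \<le> exp (2*a) * norm (G x)" for j
      using AE_MB_nonzero AE_space
    proof eventually_elim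
      case (elim x)
      define t where "t = - ln (norm x)"
      have nx: "norm x = exp (-t)" using elim by (simp add: t_def)
      \<comment> \<open>The factor exp t is unbounded near the origin, but the derivative vanishes
        for t \<ge> 2a, which gives the uniform bound exp (2a).\<close>
      have "norm (cgrad (\<psi> j) x) = \<bar>dHe a (e j) t\<bar> * exp t"
      proof -
        have "cgrad (\<psi> j) x = (- dHe a (e j) t / (exp (-t))\<^sup>2) *\<^sub>R x"
          using g\<psi>[of j x] unfolding nx by simp
        then show ?thesis by (simp add: nx power2_eq_square exp_minus field_simps abs_mult)
      qed
      also have "\<dots> \<le> exp (2*a)"
      proof (cases "t \<ge> 2*a")
        case True then show ?thesis using He_values(3)[OF e] by simp
      next
        case False
        then have "\<bar>dHe a (e j) t\<bar> * exp t \<le> 1 * exp (2*a)"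
          using He_values(4)[OF e, of j t] by (intro mult_mono) auto
        then show ?thesis by simp
      qed
      finally have "norm (G x) * norm (cgrad (\<psi> j) x) \<le> norm (G x) * exp (2*a)" by (rule mult_left_mono) simp
      then show ?case using Cauchy_Schwarz_ineq2[of "G x" "cgrad (\<psi> j) x"] by (simp add: mult.commute)
    qed
  qed
  have He_m [measurable]: "He a c \<in> borel_measurable borel" if "c > 0" for c
    using He_deriv[OF that, of a] by (intro borel_measurable_continuous_onI) (meson DERIV_isCont continuous_at_imp_continuous_on)
  have mm: "(\<lambda>x. Rr (- ln (norm x)) * h (- ln (norm x))) \<in> borel_measurable MB" if "h \<in> borel_measurable borel" for h
  proof -
    have "(\<lambda>x::real^2. Rr (- ln (norm x)) * h (- ln (norm x))) \<in> borel_measurable borel" using that by measurable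
    then show ?thesis by (intro measurable_restrict_space1) simp
  qed
  have Rm: "(\<lambda>x. Rr (- ln (norm x)) * \<psi> j x) \<in> borel_measurable MB" for j
  proof -
    have "(\<lambda>x. Rr (- ln (norm x)) * \<psi> j x) \<in> borel_measurable borel" by measurable
    then show ?thesis by (intro measurable_restrict_space1) simp
  qed
  have rhs: "(\<integral>x. norm x powr \<alpha> * \<bar>u x\<bar> powr (p-1) * u x * \<psi> j x \<partial>MB) = (\<integral>x. Rr (- ln (norm x)) * \<psi> j x \<partial>MB)" for j
  proof (rule integral_cong_AE)
    have [measurable]: "(\<lambda>x::real^2. norm x powr \<alpha>) \<in> borel_measurable MB"
      by (rule measurable_restrict_space1) simp
    show "(\<lambda>x. norm x powr \<alpha> * \<bar>u x\<bar> powr (p-1) * u x * \<psi> j x) \<in> borel_measurable MB" by measurable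
    show "AE x in MB. norm x powr \<alpha> * \<bar>u x\<bar> powr (p-1) * u x * \<psi> j x = Rr (- ln (norm x)) * \<psi> j x"
      using source_AE by eventually_elim simp
  qed (rule Rm)
  have lim2: "(\<lambda>j. \<integral>x. Rr (- ln (norm x)) * \<psi> j x \<partial>MB) \<longlonglongrightarrow> (\<integral>x. Rr (- ln (norm x)) * min (- ln (norm x)) a \<partial>MB)"
  proof (rule integral_dominated_convergence[where w="\<lambda>x. Rr (- ln (norm x)) * (2*a)"])
    show "integrable MB (\<lambda>x. Rr (- ln (norm x)) * (2*a))"
      by (rule Rr_integrable[of "\<lambda>_. 2*a" "2*a"]) (use a in auto)
    show "(\<lambda>x. Rr (- ln (norm x)) * min (- ln (norm x)) a) \<in> borel_measurable MB"
      by (rule mm[of "\<lambda>t. min t a"]) measurable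
    show "AE x in MB. (\<lambda>j. Rr (- ln (norm x)) * \<psi> j x) \<longlonglongrightarrow> Rr (- ln (norm x)) * min (- ln (norm x)) a"
      using AE_MB_nonzero AE_space
    proof eventually_elim
      case (elim x)
      define t where "t = - ln (norm x)"
      have t: "t > 0" using elim by (simp add: t_def B_def)
      have "(\<lambda>j. 2 * e j) \<longlonglongrightarrow> 2 * 0" by (intro tendsto_mult tendsto_const e0)
      then have "(\<lambda>j. 2 * e j) \<longlonglongrightarrow> 0" by simp
      then have "(\<lambda>j. \<bar>He a (e j) t - min t a\<bar>) \<longlonglongrightarrow> 0"
        by (rule tendsto_zero_squeeze) (use He_values(5)[OF e] t in auto)
      then have "(\<lambda>j. He a (e j) t - min t a) \<longlonglongrightarrow> 0" by (simp add: tendsto_rabs_zero_iff)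
      then have "(\<lambda>j. He a (e j) t) \<longlonglongrightarrow> min t a" by (simp add: LIM_zero_iff)
      then show ?case unfolding \<psi>_def t_def[symmetric] using elim by (simp add: tendsto_mult_left)
    qed
    show "AE x in MB. norm (Rr (- ln (norm x)) * \<psi> j x) \<le> Rr (- ln (norm x)) * (2*a)" for j
      using AE_MB_nonzero AE_space
    proof eventually_elim
      case (elim x)
      define t where "t = - ln (norm x)"
      have t: "t > 0" using elim by (simp add: t_def B_def)
      have "Rr t * \<bar>He a (e j) t\<bar> \<le> Rr t * (2*a)"
        using He_values(6)[OF e, of t j] t by (intro mult_left_mono Rr_nonneg) simp
      then show ?case unfolding \<psi>_def t_def[symmetric] using elim Rr_nonneg[of t] by (simp add: abs_mult)
    qed
  qed (rule Rm)
  have "(\<integral>x. G x \<bullet> cgrad (\<psi> j) x \<partial>MB) = (\<integral>x. Rr (- ln (norm x)) * \<psi> j x \<partial>MB)" for j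
    unfolding weak[OF t\<psi>] rhs ..
  then show ?thesis using LIMSEQ_unique[OF lim1] lim2 by simp
qed

section \<open>From the Green representation to the differential equation\<close>

definition M0 :: real where "M0 = 1 + \<alpha> / 2"
definition f0 :: "real \<Rightarrow> real" where "f0 t = exp (-2*M0*t) * Wp t powr p"

lemma f0_eq: "exp (-2*t) * (Rr t * c) = f0 t * c"
proof -
  have "exp (-2*M0*t) = exp (-2*t) * exp (-\<alpha>*t)" by (simp add: M0_def algebra_simps flip: exp_add)
  then show ?thesis by (simp add: f0_def Rr_def)
qed

lemma f0_nonneg: "f0 t \<ge> 0" by (simp add: f0_def)

lemma f0_integrable:
  assumes [measurable]: "h \<in> borel_measurable borel" and h: "\<And>t. t > 0 \<Longrightarrow> \<bar>h t\<bar> \<le> c * (t + 1)"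
  shows "set_integrable lborel {0<..} (\<lambda>t. f0 t * h t)"
    and "(\<integral>x. Rr (- ln (norm x)) * h (- ln (norm x)) \<partial>MB) = 2*pi * (LBINT t:{0<..}. f0 t * h t)"
  using radial_integral[of "\<lambda>t. Rr t * h t", OF Rr_integrable[OF assms]] unfolding f0_eq by auto

lemma W_0: "W 0 = 0"
proof -
  have "IT (Ph (\<phi> n) 0) / (2*pi) = 0" for n
  proof -
    obtain r where r: "0 < r" "r < 1" "\<And>x. norm x \<ge> r \<Longrightarrow> \<phi> n x = 0"
      "\<And>x. norm x \<ge> r \<Longrightarrow> cgrad (\<phi> n) x = 0"
      using test_fun_vanish[OF test[of n]] by blast
    have "Ph (\<phi> n) 0 \<theta> = 0" for \<theta> unfolding Ph_def by (rule r(3)) (use r(2) in simp)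
    then have "Ph (\<phi> n) 0 = (\<lambda>\<theta>. 0)" by (rule ext)
    then show ?thesis by simp
  qed
  then have "(\<lambda>n::nat. 0) \<longlonglongrightarrow> W 0" using W_lim[of 0] by (simp only:)
  from LIMSEQ_unique[OF this tendsto_const] show ?thesis .
qed

text \<open>min t a is the Green function of -d^2/dt^2 on the half line with value 0 at t = 0 and
  slope 0 at infinity. All regularity of W is derived from this formula.\<close>

lemma W_green: "a \<ge> 0 \<Longrightarrow> W a = (LBINT t:{0<..}. f0 t * min t a)"
proof (cases "a = 0")
  case True
  have "(LBINT t:{0<..}. f0 t * min t 0) = (\<integral>t. 0 \<partial>(lborel :: real measure))"
    unfolding set_lebesgue_integral_def by (intro Bochner_Integration.integral_cong) (auto simp: indicator_def)
  then show ?thesis using True W_0 by simp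
next
  case False
  assume "a \<ge> 0"
  then have a: "a > 0" using False by simp
  have "(\<integral>x. Rr (- ln (norm x)) * min (- ln (norm x)) a \<partial>MB) = 2*pi * (LBINT t:{0<..}. f0 t * min t a)"
    by (rule f0_integrable(2)[of "\<lambda>t. min t a" 1]) (use a in auto)
  then show ?thesis unfolding W_def weak_green[OF a] by simp
qed

lemma f0_min_integrable: "a \<ge> 0 \<Longrightarrow> set_integrable lborel {0<..} (\<lambda>t. f0 t * min t a)"
  by (rule f0_integrable(1)[of "\<lambda>t. min t a" 1]) auto

lemma f0_set_integrable: "set_integrable lborel {0<..} f0"
  using f0_integrable(1)[of "\<lambda>t. 1" 1] by simp

lemma W_nonneg: "a \<ge> 0 \<Longrightarrow> W a \<ge> 0"
  unfolding W_green set_lebesgue_integral_def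
  by (intro Bochner_Integration.integral_nonneg) (auto simp: indicator_def f0_nonneg)

lemma Wp_eq: "t \<ge> 0 \<Longrightarrow> Wp t = W t" using W_nonneg[of t] by (simp add: Wp_def)

definition I0 :: real where "I0 = (LBINT t:{0<..}. f0 t)"

text \<open>The kernel is 1-Lipschitz in a, so mere integrability of f0 suffices. This starts the
  bootstrap: W is continuous, hence f0 is, hence W is differentiable.\<close>

lemma W_lipschitz:
  assumes "a \<ge> 0" "b \<ge> 0" shows "\<bar>W a - W b\<bar> \<le> \<bar>a - b\<bar> * I0"
proof -
  have "W a - W b = (LBINT t:{0<..}. f0 t * min t a - f0 t * min t b)"
    unfolding W_green[OF assms(1)] W_green[OF assms(2)]
    by (rule set_integral_diff(2)[OF f0_min_integrable[OF assms(1)] f0_min_integrable[OF assms(2)], symmetric])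
  also have "\<bar>\<dots>\<bar> \<le> (LBINT t:{0<..}. \<bar>a - b\<bar> * f0 t)"
    unfolding set_lebesgue_integral_def
  proof (rule integral_abs_bound[THEN order_trans], rule integral_mono)
    have i: "set_integrable lborel {0<..} (\<lambda>t. f0 t * min t a - f0 t * min t b)"
      by (rule set_integral_diff(1)[OF f0_min_integrable[OF assms(1)] f0_min_integrable[OF assms(2)]])
    show "integrable lborel (\<lambda>t. \<bar>indicator {0<..} t *\<^sub>R (f0 t * min t a - f0 t * min t b)\<bar>)"
      using i unfolding set_integrable_def by (rule integrable_abs)
    have "integrable lborel (\<lambda>t. \<bar>a - b\<bar> * (indicator {0<..} t *\<^sub>R f0 t))"
      using f0_set_integrable unfolding set_integrable_def by (rule integrable_mult_right)
    then show "integrable lborel (\<lambda>t. indicator {0<..} t *\<^sub>R (\<bar>a - b\<bar> * f0 t))" by (simp add: mult_ac)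
    fix t :: real
    have "\<bar>min t a - min t b\<bar> \<le> \<bar>a - b\<bar>" by linarith
    then have "f0 t * \<bar>min t a - min t b\<bar> \<le> f0 t * \<bar>a - b\<bar>" by (rule mult_left_mono[OF _ f0_nonneg])
    moreover have "\<bar>f0 t * min t a - f0 t * min t b\<bar> = f0 t * \<bar>min t a - min t b\<bar>"
      unfolding right_diff_distrib[symmetric] abs_mult using f0_nonneg[of t] by simp
    ultimately show "\<bar>indicator {0<..} t *\<^sub>R (f0 t * min t a - f0 t * min t b)\<bar> \<le> indicator {0<..} t *\<^sub>R (\<bar>a - b\<bar> * f0 t)"
      by (simp add: indicator_def mult.commute)
  qed
  also have "\<dots> = \<bar>a - b\<bar> * I0" unfolding I0_def by (rule set_integral_mult_right)
  finally show ?thesis .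
qed

lemma I0_nonneg: "I0 \<ge> 0"
  unfolding I0_def set_lebesgue_integral_def
  by (intro Bochner_Integration.integral_nonneg) (auto simp: indicator_def f0_nonneg)

lemma W_continuous: "continuous_on {0..} W"
proof (rule continuous_onI)
  fix x e :: real assume x: "x \<in> {0..}" and e: "e > 0"
  show "\<exists>d>0. \<forall>x'\<in>{0..}. dist x' x < d \<longrightarrow> dist (W x') (W x) \<le> e"
  proof (intro exI conjI ballI impI)
    show "0 < e / (I0 + 1)" using e I0_nonneg by simp
    fix y :: real assume y: "y \<in> {0..}" "dist y x < e / (I0 + 1)"
    have "\<bar>W y - W x\<bar> \<le> \<bar>y - x\<bar> * I0" using x y by (intro W_lipschitz) auto
    also have "\<dots> \<le> \<bar>y - x\<bar> * (I0 + 1)" by (intro mult_left_mono) auto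
    also have "\<dots> \<le> e" using y I0_nonneg by (simp add: dist_real_def field_simps)
    finally show "dist (W y) (W x) \<le> e" by (simp add: dist_real_def)
  qed
qed

lemma f0_W: "t \<ge> 0 \<Longrightarrow> f0 t = exp (-2*M0*t) * W t powr p"
  by (simp add: f0_def Wp_eq)

lemma f0_continuous: "0 \<le> a \<Longrightarrow> continuous_on {a..b} f0"
proof -
  assume a: "0 \<le> a"
  have "continuous_on {0..} (\<lambda>t. W t powr p)"
    by (rule continuous_on_powr'[OF W_continuous continuous_on_const]) (use W_nonneg p1 in auto)
  then have "continuous_on {0..} (\<lambda>t. exp (-2*M0*t) * W t powr p)"
    by (intro continuous_on_mult continuous_on_exp continuous_on_const continuous_on_id)
  then have "continuous_on {0..} f0" by (rule continuous_on_eq) (simp add: f0_W)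
  then show ?thesis by (rule continuous_on_subset) (use a in auto)
qed

text \<open>The tail integral of f0 from s on, which will be W'. Written as a total minus an initial
  piece it can be differentiated directly.\<close>

definition K :: "real \<Rightarrow> real" where "K s = I0 - integral {0..s} f0"

lemma K_tail:
  assumes "a > 0" shows "(LBINT t:{a..}. f0 t) = K a"
proof -
  have "I0 = (LBINT t:{0<..<a} \<union> {a..}. f0 t)"
    unfolding I0_def using assms by (intro arg_cong[where f="\<lambda>A. LBINT t:A. f0 t"]) auto
  also have "\<dots> = (LBINT t:{0<..<a}. f0 t) + (LBINT t:{a..}. f0 t)"
    by (rule set_integral_Un) (use assms in \<open>auto intro: set_integrable_subset[OF f0_set_integrable]\<close>)
  also have "(LBINT t:{0<..<a}. f0 t) = integral {0..a} f0" by (rule set_integral_open_interval[OF f0_continuous]) simp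
  finally show ?thesis by (simp add: K_def)
qed

text \<open>Cutting the Green formula where min t a changes its form leaves an expression that the
  fundamental theorem can differentiate.\<close>

lemma W_split:
  assumes "a > 0" shows "W a = integral {0..a} (\<lambda>t. f0 t * t) + a * K a"
proof -
  have i: "set_integrable lborel {0<..} (\<lambda>t. f0 t * min t a)" using f0_min_integrable assms by simp
  have "W a = (LBINT t:{0<..<a} \<union> {a..}. f0 t * min t a)"
    using W_green[of a] assms by (simp add: ivl_disj_un)
  also have "\<dots> = (LBINT t:{0<..<a}. f0 t * min t a) + (LBINT t:{a..}. f0 t * min t a)"
    by (rule set_integral_Un) (use assms in \<open>auto intro: set_integrable_subset[OF i]\<close>)
  also have "(LBINT t:{0<..<a}. f0 t * min t a) = (LBINT t:{0<..<a}. f0 t * t)"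
    by (rule set_lebesgue_integral_cong) auto
  also have "\<dots> = integral {0..a} (\<lambda>t. f0 t * t)"
    by (intro set_integral_open_interval continuous_on_mult f0_continuous continuous_on_id) simp
  also have "(LBINT t:{a..}. f0 t * min t a) = (LBINT t:{a..}. a * f0 t)"
    by (rule set_lebesgue_integral_cong) auto
  also have "\<dots> = a * (LBINT t:{a..}. f0 t)" by (rule set_integral_mult_right)
  finally show ?thesis unfolding K_tail[OF assms] .
qed

lemma integral_deriv:
  fixes g :: "real \<Rightarrow> real"
  assumes "\<And>b. continuous_on {0..b} g" "t > 0"
  shows "((\<lambda>s. integral {0..s} g) has_real_derivative g t) (at t)"
proof -
  have "((\<lambda>s. integral {0..s} g) has_real_derivative g t) (at t within {0..t+1})"
    by (rule integral_has_real_derivative[OF assms(1)]) (use assms in auto)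
  moreover have "at t within {0..t+1} = at t" using assms by (intro at_within_Icc_at) auto
  ultimately show ?thesis by simp
qed

lemma emden_W: "emden M0 p W K"
proof
  have f0c: "continuous_on {0..b} f0" for b by (rule f0_continuous) simp
  show "M0 \<ge> 1" using alpha by (simp add: M0_def)
  show "p > 1" by (rule p1)
  show Kd: "(K has_real_derivative - (exp (-2*M0*t) * W t powr p)) (at t)" if t: "t > 0" for t
  proof -
    have "((\<lambda>s. I0 - integral {0..s} f0) has_real_derivative 0 - f0 t) (at t)"
      by (intro DERIV_diff DERIV_const integral_deriv f0c t)
    then show ?thesis unfolding K_def[abs_def] using f0_W[of t] t by simp
  qed
  show "(W has_real_derivative K t) (at t)" if t: "t > 0" for t
  proof -
    have Kd': "(K has_real_derivative - f0 t) (at t)" using Kd[OF t] f0_W[of t] t by simp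
    \<comment> \<open>The contributions f0 t * t of the two terms cancel and only K t
      survives.\<close>
    have "((\<lambda>a. integral {0..a} (\<lambda>t. f0 t * t) + a * K a) has_real_derivative (f0 t * t + (1 * K t + - f0 t * t))) (at t)"
      by (intro DERIV_add DERIV_mult DERIV_ident Kd' integral_deriv continuous_on_mult f0c continuous_on_id t)
    then have "((\<lambda>a. integral {0..a} (\<lambda>t. f0 t * t) + a * K a) has_real_derivative K t) (at t)" by simp
    then show ?thesis
      by (rule has_field_derivative_transform_within_open[of _ _ _ "{0<..}"]) (use t W_split in auto)
  qed
  show "W 0 = 0" by (rule W_0)
  show "continuous_on {0..} W" by (rule W_continuous)
  show "continuous_on {0..} K"
    unfolding continuous_on_eq_continuous_within
  proof
    fix x :: real assume x: "x \<in> {0..}"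
    have "continuous_on {0..x+1} (\<lambda>s. I0 - integral {0..s} f0)"
      by (intro continuous_on_diff continuous_on_const indefinite_integral_continuous_1 integrable_continuous_interval f0c)
    then have "continuous (at x within {0..x+1}) K"
      unfolding K_def[abs_def] continuous_on_eq_continuous_within using x by auto
    moreover have "at x within {0..x+1} = at x within {0..}"
      by (rule at_within_nhd[of _ "{..<x+1}"]) auto
    ultimately show "continuous (at x within {0..}) K" by (simp add: continuous_within)
  qed
  \<comment> \<open>The bound is the first moment of f0, finite because f0 is integrable against
    functions of linear growth.\<close>
  show "\<exists>M. \<forall>t\<ge>0. W t \<le> M"
  proof (intro exI allI impI)
    fix a :: real assume a: "a \<ge> 0"
    have "W a = (LBINT t:{0<..}. f0 t * min t a)" by (rule W_green[OF a])
    also have "\<dots> \<le> (LBINT t:{0<..}. f0 t * t)"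
    proof (rule set_integral_mono)
      show "set_integrable lborel {0<..} (\<lambda>t. f0 t * t)" by (rule f0_integrable(1)[of "\<lambda>t. t" 1]) auto
    qed (auto intro!: f0_min_integrable a mult_left_mono f0_nonneg)
    finally show "W a \<le> (LBINT t:{0<..}. f0 t * t)" .
  qed
  show "(K \<longlongrightarrow> 0) at_top"
  proof -
    have i1: "set_integrable lborel {1..} f0" by (rule set_integrable_subset[OF f0_set_integrable]) auto
    have "((\<lambda>b. LBINT t:{1..b}. f0 t) \<longlongrightarrow> (LBINT t:{1..}. f0 t)) at_top"
      by (rule tendsto_set_lebesgue_integral_at_top[OF _ i1]) simp
    then have "((\<lambda>b. K 1 - (LBINT t:{1..b}. f0 t)) \<longlongrightarrow> K 1 - K 1) at_top"
      unfolding K_tail[OF zero_less_one] by (intro tendsto_diff tendsto_const)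
    then have l: "((\<lambda>b. K 1 - (LBINT t:{1..b}. f0 t)) \<longlongrightarrow> 0) at_top" by simp
    have e: "\<forall>\<^sub>F b in at_top. K 1 - (LBINT t:{1..b}. f0 t) = K b"
      using eventually_ge_at_top[of 1]
    proof eventually_elim
      case (elim b)
      have "(LBINT t:{1..b}. f0 t) = integral {1..b} f0"
        by (rule set_borel_integral_eq_integral(2)[OF borel_integrable_atLeastAtMost'[OF f0_continuous]]) simp
      moreover have "integral {0..1} f0 + integral {1..b} f0 = integral {0..b} f0"
        by (rule Henstock_Kurzweil_Integration.integral_combine[OF zero_le_one elim integrable_continuous_interval[OF f0c]])
      ultimately show ?case unfolding K_def by linarith
    qed
    show ?thesis by (rule Lim_transform_eventually[OF l e])
  qed
  \<comment> \<open>A zero of W at one positive a makes f0 vanish almost everywhere, since the Green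
    kernel is positive. Then W is identically 0, contradicting u > 0 almost everywhere on a disc of
    positive measure.\<close>
  show "W a > 0" if a: "a > 0" for a
  proof (rule ccontr)
    assume "\<not> W a > 0"
    then have "W a = 0" using W_nonneg[of a] a by simp
    have i: "integrable lborel (\<lambda>t. indicator {0<..} t *\<^sub>R (f0 t * min t a))"
      using f0_min_integrable[of a] a unfolding set_integrable_def by simp
    have "(\<integral>t. indicator {0<..} t *\<^sub>R (f0 t * min t a) \<partial>lborel) = 0"
      using W_green[of a] a \<open>W a = 0\<close> unfolding set_lebesgue_integral_def by simp
    then have "AE t in lborel. indicator {0<..} t *\<^sub>R (f0 t * min t a) = 0"
      by (subst (asm) integral_nonneg_eq_0_iff_AE[OF i]) (use a in \<open>auto simp: indicator_def f0_nonneg\<close>)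
    then have ae: "AE t in lborel. t > 0 \<longrightarrow> f0 t = 0"
      by eventually_elim (use a in \<open>auto simp: indicator_def split: if_splits\<close>)
    have "W b = 0" if b: "b \<ge> 0" for b
      unfolding W_green[OF b] set_lebesgue_integral_def
    proof (rule integral_eq_zero_AE)
      show "AE t in lborel. indicator {0<..} t *\<^sub>R (f0 t * min t b) = 0"
        using ae by eventually_elim (auto simp: indicator_def)
    qed
    then have z: "W (- ln (norm x)) = 0" if "x \<in> B" for x :: "real^2"
      using that by (cases "x = 0") (auto simp: B_def)
    have "AE x in MB. False"
      using u_eq_W pos AE_space by eventually_elim (use z in auto)
    then have "AE x in lborel. x \<notin> B" unfolding AE_MB by simp
    then have "B \<in> null_sets lborel" by (subst AE_iff_null_sets[OF sets_B(2)])
    then have "negligible B" unfolding negligible_iff_null_sets by (rule null_sets_completionI)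
    then show False unfolding B_def using open_not_negligible[of "ball (0::real^2) 1"] by simp
  qed
qed

end

section \<open>A profile with negative energy\<close>

text \<open>The real and imaginary part of (x1 + i x2)^k, as a pair of real polynomials.\<close>

primrec cpw :: "nat \<Rightarrow> real^2 \<Rightarrow> real \<times> real" where
  "cpw 0 x = (1, 0)"
| "cpw (Suc k) x = (x$1 * fst (cpw k x) - x$2 * snd (cpw k x), x$1 * snd (cpw k x) + x$2 * fst (cpw k x))"

lemma cpw_polynomial: "real_polynomial_function (\<lambda>x. fst (cpw k x)) \<and> real_polynomial_function (\<lambda>x. snd (cpw k x))"
proof (induction k)
  case (Suc k)
  have c: "real_polynomial_function (\<lambda>x::real^2. x $ i)" for i
    by (rule real_polynomial_function.intros(1)) (rule bounded_linear_vec_nth)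
  show ?case unfolding cpw.simps fst_conv snd_conv
    using Suc c by (intro conjI real_polynomial_function_diff real_polynomial_function.intros(3) real_polynomial_function.intros(4)) auto
qed (simp add: real_polynomial_function.intros(2))

lemma cpw_pol: "cpw k (pol t \<theta>) = (exp (- (real k * t)) * cos (real k * \<theta>), exp (- (real k * t)) * sin (real k * \<theta>))"
proof (induction k)
  case (Suc k)
  have e: "exp (- (real (Suc k) * t)) = exp (-t) * exp (- (real k * t))" by (simp add: algebra_simps flip: exp_add)
  have c: "cos (real (Suc k) * \<theta>) = cos \<theta> * cos (real k * \<theta>) - sin \<theta> * sin (real k * \<theta>)"
    "sin (real (Suc k) * \<theta>) = cos \<theta> * sin (real k * \<theta>) + sin \<theta> * cos (real k * \<theta>)"
    unfolding of_nat_Suc distrib_right mult_1 cos_add sin_add by simp_all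
  show ?case unfolding cpw.simps Suc e c fst_conv snd_conv pol_nth by (simp add: algebra_simps)
qed simp

text \<open>The homogeneous harmonic polynomials restricting to the trigonometric basis on the unit circle.\<close>
definition tbp :: "nat \<Rightarrow> real^2 \<Rightarrow> real" where
  "tbp j x = (if j = 0 then 1 / sqrt (2*pi)
     else if odd j then fst (cpw (freq j) x) * (1 / sqrt pi) else snd (cpw (freq j) x) * (1 / sqrt pi))"

lemma tbp_C1: "C1 (tbp j)"
proof -
  have "real_polynomial_function (tbp j)" unfolding tbp_def[abs_def]
    using cpw_polynomial by (cases "j = 0"; cases "odd j") (auto intro!: real_polynomial_function.intros(4) real_polynomial_function.intros(2))
  then show ?thesis by (rule C1_polynomial)
qed

lemma tbp_pol: "tbp j (pol t \<theta>) = exp (- (real (freq j) * t)) * tb j \<theta>"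
  unfolding tbp_def tb_def cpw_pol by (simp add: freq_def)

text \<open>Differentiation exchanges the two coefficients of each frequency, so a combination of
  the modes below 2n+1 stays one.\<close>

lemma dtb_combination:
  obtains d where "\<And>\<theta>. (\<Sum>j<2*n+1. c j * dtb j \<theta>) = (\<Sum>j<2*n+1. d j * tb j \<theta>)"
    "(\<Sum>j<2*n+1. (d j)\<^sup>2) = (\<Sum>j<2*n+1. (real (freq j) * c j)\<^sup>2)"
proof -
  define d where "d = (\<lambda>j. if j = 0 then 0 else if odd j then real (freq j) * c (j + 1) else - (real (freq j) * c (j - 1)))"
  have d: "d (2*k + 1) = real (k+1) * c (2*k+2)" "d (2*k + 2) = - (real (k+1) * c (2*k+1))" for k
    by (simp_all add: d_def freq_def)
  have 1: "(\<Sum>j<2*n+1. c j * dtb j \<theta>) = (\<Sum>j<2*n+1. d j * tb j \<theta>)" for \<theta>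
  proof (induction n)
    case 0 show ?case by (simp add: d_def dtb_def)
  next
    case (Suc n)
    have "c (2*n+1) * dtb (2*n+1) \<theta> + c (2*n+2) * dtb (2*n+2) \<theta> = d (2*n+1) * tb (2*n+1) \<theta> + d (2*n+2) * tb (2*n+2) \<theta>"
      unfolding dtb_odd dtb_even d by (simp only: mult_ac mult_minus_left mult_minus_right add.commute)
    then show ?case unfolding sum_lessThan_add_two by (rule arg_cong2[where f="(+)", OF Suc])
  qed
  have 2: "(\<Sum>j<2*n+1. (d j)\<^sup>2) = (\<Sum>j<2*n+1. (real (freq j) * c j)\<^sup>2)"
  proof (induction n)
    case 0 show ?case by (simp add: d_def freq_def)
  next
    case (Suc n)
    have "(d (2*n+1))\<^sup>2 + (d (2*n+2))\<^sup>2 = (real (freq (2*n+1)) * c (2*n+1))\<^sup>2 + (real (freq (2*n+2)) * c (2*n+2))\<^sup>2"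
      unfolding d freq_simps by (simp only: power2_minus add.commute)
    then show ?case unfolding sum_lessThan_add_two by (rule arg_cong2[where f="(+)", OF Suc])
  qed
  show thesis by (rule that[OF 1 2])
qed

lemma IT_combination:
  "IT (\<lambda>\<theta>. (\<Sum>j<N. d j * tb j \<theta>)\<^sup>2) = (\<Sum>j<N. (d j)\<^sup>2)"
proof -
  have c: "continuous_on {0..2*pi} (\<lambda>\<theta>. 0::real)" by (rule continuous_on_const)
  have "cf (\<lambda>\<theta>. 0) j = 0" for j by (simp add: cf_def)
  then show ?thesis using bessel_identity[OF c, of d N] by simp
qed

text \<open>The reverse of Wirtinger, valid because all frequencies are at most n: a Bernstein
  inequality in L2.\<close>

lemma IT_combination_deriv:
  "IT (\<lambda>\<theta>. (\<Sum>j<2*n+1. c j * dtb j \<theta>)\<^sup>2) \<le> (real n)\<^sup>2 * (\<Sum>j<2*n+1. (c j)\<^sup>2)"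
proof -
  obtain d where d: "\<And>\<theta>. (\<Sum>j<2*n+1. c j * dtb j \<theta>) = (\<Sum>j<2*n+1. d j * tb j \<theta>)"
    "(\<Sum>j<2*n+1. (d j)\<^sup>2) = (\<Sum>j<2*n+1. (real (freq j) * c j)\<^sup>2)" using dtb_combination by blast
  have "IT (\<lambda>\<theta>. (\<Sum>j<2*n+1. c j * dtb j \<theta>)\<^sup>2) = (\<Sum>j<2*n+1. (real (freq j) * c j)\<^sup>2)"
    unfolding d(1) IT_combination d(2) ..
  also have "\<dots> \<le> (\<Sum>j<2*n+1. (real n)\<^sup>2 * (c j)\<^sup>2)"
    unfolding power_mult_distrib
  proof (intro sum_mono mult_right_mono power_mono)
    fix j assume "j \<in> {..<2*n+1}"
    then have "freq j \<le> n" by (auto simp: freq_def)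
    then show "real (freq j) \<le> real n" by simp
  qed auto
  finally show ?thesis unfolding sum_distrib_left .
qed

lemma integral_le_const:
  fixes f :: "real \<Rightarrow> real"
  assumes "continuous_on {a..b} f" "a \<le> b" "\<And>t. a \<le> t \<Longrightarrow> t \<le> b \<Longrightarrow> f t \<le> c"
  shows "integral {a..b} f \<le> c * (b - a)"
proof -
  have "integral {a..b} f \<le> integral {a..b} (\<lambda>_. c)"
    by (intro integral_le integrable_continuous_interval assms(1) continuous_on_const) (use assms(3) in auto)
  then show ?thesis using assms(2) by (simp add: mult.commute)
qed

definition stp :: "real \<Rightarrow> real" where "stp s = ramp 1 s - ramp 1 (s - 1)"
definition dstp :: "real \<Rightarrow> real" where "dstp s = dramp 1 s - dramp 1 (s - 1)"

lemma stp_deriv: "(stp has_real_derivative dstp s) (at s)"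
proof -
  have "((\<lambda>s. ramp 1 (s - 1)) has_real_derivative dramp 1 (s - 1) * 1) (at s)"
    by (rule DERIV_chain2[OF ramp_deriv]) (auto intro!: derivative_eq_intros)
  then have "((\<lambda>s. ramp 1 s - ramp 1 (s - 1)) has_real_derivative dramp 1 s - dramp 1 (s - 1) * 1) (at s)"
    by (intro DERIV_diff ramp_deriv) simp_all
  then show ?thesis unfolding stp_def[abs_def] dstp_def by simp
qed

lemma dstp_continuous: "continuous_on UNIV dstp"
  unfolding dstp_def[abs_def]
  by (intro continuous_on_diff dramp_continuous continuous_on_compose2[OF dramp_continuous[of UNIV]]
      continuous_on_id continuous_on_const) auto

lemma stp_values:
  "s \<le> 0 \<Longrightarrow> stp s = 0" "s \<ge> 2 \<Longrightarrow> stp s = 1" "s \<le> 0 \<Longrightarrow> dstp s = 0" "s \<ge> 2 \<Longrightarrow> dstp s = 0" "\<bar>dstp s\<bar> \<le> 1"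
proof -
  have e: "(1::real) > 0" by simp
  note r = ramp_values[OF e]
  show "s \<le> 0 \<Longrightarrow> stp s = 0" using r(1)[of s] r(1)[of "s - 1"] by (simp add: stp_def)
  show "s \<ge> 2 \<Longrightarrow> stp s = 1" using r(2)[of s] r(2)[of "s - 1"] by (simp add: stp_def)
  show "s \<le> 0 \<Longrightarrow> dstp s = 0" using r(3)[of s] r(3)[of "s - 1"] by (simp add: dstp_def)
  show "s \<ge> 2 \<Longrightarrow> dstp s = 0" using r(4)[of s] r(4)[of "s - 1"] by (simp add: dstp_def)
  show "\<bar>dstp s\<bar> \<le> 1" using r(5,6)[of s] r(5,6)[of "s - 1"] unfolding dstp_def by linarith
qed

text \<open>Rises from 0 to 1 on [1, 3] and falls back on [R, R+2], both times with slope at most 1;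
  each ramp has length 2 because the slope of \<open>stp\<close> is a tent.\<close>

definition cutoff :: "real \<Rightarrow> real \<Rightarrow> real" where "cutoff R t = stp (t - 1) - stp (t - R)"
definition dcutoff :: "real \<Rightarrow> real \<Rightarrow> real" where "dcutoff R t = dstp (t - 1) - dstp (t - R)"

lemma cutoff_deriv: "(cutoff R has_real_derivative dcutoff R t) (at t)"
proof -
  have "((\<lambda>t. stp (t - c)) has_real_derivative dstp (t - c) * 1) (at t)" for c
    by (rule DERIV_chain2[OF stp_deriv]) (auto intro!: derivative_eq_intros)
  then have "((\<lambda>t. stp (t - 1) - stp (t - R)) has_real_derivative dstp (t - 1) * 1 - dstp (t - R) * 1) (at t)"
    by (intro DERIV_diff)
  then show ?thesis unfolding cutoff_def[abs_def] dcutoff_def by simp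
qed

lemma dcutoff_continuous: "continuous_on UNIV (dcutoff R)"
proof -
  have "continuous_on UNIV (\<lambda>t. dstp (t - c))" for c
    by (rule continuous_on_compose2[OF dstp_continuous]) (auto intro!: continuous_intros)
  then show ?thesis unfolding dcutoff_def[abs_def] by (intro continuous_on_diff)
qed

lemma cutoff_values:
  assumes R: "R \<ge> 3"
  shows "t \<le> 1 \<Longrightarrow> cutoff R t = 0" "t \<ge> R + 2 \<Longrightarrow> cutoff R t = 0" "t \<le> 1 \<Longrightarrow> dcutoff R t = 0" "t \<ge> R + 2 \<Longrightarrow> dcutoff R t = 0"
    "3 \<le> t \<Longrightarrow> t \<le> R \<Longrightarrow> cutoff R t = 1" "3 \<le> t \<Longrightarrow> t \<le> R \<Longrightarrow> dcutoff R t = 0" "\<bar>dcutoff R t\<bar> \<le> 1"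
proof -
  show "t \<le> 1 \<Longrightarrow> cutoff R t = 0" using R stp_values(1)[of "t-1"] stp_values(1)[of "t-R"] by (simp add: cutoff_def)
  show "t \<ge> R + 2 \<Longrightarrow> cutoff R t = 0" using R stp_values(2)[of "t-1"] stp_values(2)[of "t-R"] by (simp add: cutoff_def)
  show "t \<le> 1 \<Longrightarrow> dcutoff R t = 0" using R stp_values(3)[of "t-1"] stp_values(3)[of "t-R"] by (simp add: dcutoff_def)
  show "t \<ge> R + 2 \<Longrightarrow> dcutoff R t = 0" using R stp_values(4)[of "t-1"] stp_values(4)[of "t-R"] by (simp add: dcutoff_def)
  show "3 \<le> t \<Longrightarrow> t \<le> R \<Longrightarrow> cutoff R t = 1" using stp_values(2)[of "t-1"] stp_values(1)[of "t-R"] by (simp add: cutoff_def)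
  show "3 \<le> t \<Longrightarrow> t \<le> R \<Longrightarrow> dcutoff R t = 0" using stp_values(4)[of "t-1"] stp_values(3)[of "t-R"] by (simp add: dcutoff_def)
  show "\<bar>dcutoff R t\<bar> \<le> 1"
  proof (cases "t \<le> R")
    case True
    then show ?thesis using stp_values(3)[of "t-R"] stp_values(5)[of "t-1"] by (simp add: dcutoff_def)
  next
    case False
    then show ?thesis using R stp_values(4)[of "t-1"] stp_values(5)[of "t-R"] by (simp add: dcutoff_def)
  qed
qed

section \<open>Negative directions of the quadratic form\<close>

context emden
begin

definition z :: "real \<Rightarrow> real" where "z t = exp (m * t) * K t"

lemma z_deriv:
  assumes "t > 0" shows "(z has_real_derivative z t * q t) (at t)"
proof -
  have "K t \<noteq> 0" using K_pos[OF assms] by simp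
  have "((\<lambda>t. exp (m * t)) has_real_derivative exp (m * t) * m) (at t)" by (auto intro!: derivative_eq_intros)
  from DERIV_mult[OF this K_deriv[OF assms]]
  have "(z has_real_derivative exp (m * t) * m * K t + - (exp (-2*m*t) * w t powr p) * exp (m * t)) (at t)"
    unfolding z_def[abs_def] .
  then show ?thesis
    by (rule DERIV_cong) (use \<open>K t \<noteq> 0\<close> in \<open>simp add: z_def q_def right_diff_distrib\<close>)
qed

lemma z_nonneg: "t \<ge> 0 \<Longrightarrow> z t \<ge> 0"
  using K_pos[of t] K0_pos by (cases "t = 0") (auto simp: z_def)

text \<open>Take \<psi> = \<chi> z with a cutoff \<chi>. Since q solves the Riccati equation, the
  integrand equals (q \<psi>^2)' + z^2 (\<chi>'^2 - (m^2 - n^2) \<chi>^2), so only the two ramps of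
  \<chi> cost anything. With A = (K 0)^2 exp (6m) they cost at most 2A and A, while the plateau
  [3, T] gains (m^2 - n^2) (T - 3) A/4 = 13A/4; this is the origin of 13.\<close>

lemma negative_profile:
  assumes n: "0 \<le> n" "n < m" and T: "T = 3 + 13 / (m\<^sup>2 - n\<^sup>2)" and p: "p - 1 \<ge> 4 * m\<^sup>2 * T\<^sup>2"
  obtains \<psi> \<psi>' b where "\<And>t. (\<psi> has_real_derivative \<psi>' t) (at t)" "continuous_on UNIV \<psi>'" "b > 1"
    "\<And>t. t \<le> 1 \<Longrightarrow> \<psi> t = 0" "\<And>t. t \<le> 1 \<Longrightarrow> \<psi>' t = 0" "\<And>t. t \<ge> b \<Longrightarrow> \<psi> t = 0" "\<And>t. t \<ge> b \<Longrightarrow> \<psi>' t = 0"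
    "integral {1..b} (\<lambda>t. (\<psi>' t)\<^sup>2 + n\<^sup>2 * (\<psi> t)\<^sup>2 - V t * (\<psi> t)\<^sup>2) < 0"
proof -
  define \<delta> where "\<delta> = m\<^sup>2 - n\<^sup>2"
  have \<delta>: "\<delta> > 0" using n unfolding \<delta>_def by (simp add: power2_strict_mono power_strict_mono)
  have T3: "T > 3" using \<delta> unfolding T \<delta>_def[symmetric] by simp
  \<comment> \<open>The square of exp (3m) K 0, which bounds z on the rising ramp; by
    \<open>K_half\<close>, a quarter of A bounds z^2 from below on [3, T].\<close>
  define A where "A = (K 0)\<^sup>2 * exp (6*m)"
  have A: "A > 0" using K0_pos by (simp add: A_def)
  obtain C where C: "C > 0" "\<And>t. t > 0 \<Longrightarrow> K t \<le> C * exp (-2*m*t)" using K_upper by blast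
  have "((\<lambda>t. C\<^sup>2 * exp (-2*m*t)) \<longlongrightarrow> 0) at_top" by (rule tendsto_mult_right_zero[OF exp_lim])
  then have "\<forall>\<^sub>F t in at_top. C\<^sup>2 * exp (-2*m*t) < A / 2" by (rule order_tendstoD(2)) (use A in simp)
  then have "\<forall>\<^sub>F t in at_top. t \<ge> T \<and> C\<^sup>2 * exp (-2*m*t) < A / 2" by (rule eventually_conj[OF eventually_ge_at_top])
  \<comment> \<open>Far enough out that z^2, which is at most C^2 exp (-2 m R) on the falling ramp,
    stays below A/2 over a length of 2.\<close>
  then obtain R where R: "R \<ge> T" "C\<^sup>2 * exp (-2*m*R) < A / 2"
    using eventually_happens[of _ "at_top :: real filter"] by auto
  have R3: "R \<ge> 3" using R T3 by simp
  note cv = cutoff_values[OF R3]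
  define \<psi> where "\<psi> = (\<lambda>t. z t * cutoff R t)"
  define \<psi>' where "\<psi>' = (\<lambda>t. z t * q t * cutoff R t + dcutoff R t * z t)"
  have d: "(\<psi> has_real_derivative \<psi>' t) (at t)" for t
  proof (cases "t > 0")
    case True
    show ?thesis unfolding \<psi>_def \<psi>'_def by (rule DERIV_mult[OF z_deriv[OF True] cutoff_deriv])
  next
    case False
    \<comment> \<open>The derivative of z is available only for t > 0, but \<psi> is locally 0 here
      because the cutoff vanishes up to t = 1.\<close>
    have "((\<lambda>t::real. 0) has_real_derivative 0) (at t)" by simp
    then have "(\<psi> has_real_derivative 0) (at t)"
      by (rule has_field_derivative_transform_within_open[of _ _ _ "{..<1}"]) (use False cv(1) in \<open>auto simp: \<psi>_def\<close>)
    moreover have "\<psi>' t = 0" using cv(1,3)[of t] False by (simp add: \<psi>'_def)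
    ultimately show ?thesis by simp
  qed
  have qc: "continuous_on {a..b} q" if "a > 0" for a b
    by (intro continuous_at_imp_continuous_on ballI DERIV_isCont[OF q_deriv]) (use that in auto)
  have zc: "continuous_on {a..b} z" if "a > 0" for a b
    by (intro continuous_at_imp_continuous_on ballI DERIV_isCont[OF z_deriv]) (use that in auto)
  have cc: "continuous_on S (cutoff R)" "continuous_on S (dcutoff R)" for S
    by (intro continuous_at_imp_continuous_on ballI DERIV_isCont[OF cutoff_deriv],
        rule continuous_on_subset[OF dcutoff_continuous], simp)
  have c': "continuous_on UNIV \<psi>'"
    unfolding continuous_on_eq_continuous_at[OF open_UNIV]
  proof
    fix t :: real
    show "isCont \<psi>' t"
    proof (cases "t > 0")
      case True
      have "isCont z t" "isCont q t" using z_deriv[OF True] q_deriv[OF True] by (auto intro: DERIV_isCont)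
      moreover have "isCont (cutoff R) t" by (rule DERIV_isCont[OF cutoff_deriv])
      moreover have "isCont (dcutoff R) t" using dcutoff_continuous by (simp add: continuous_on_eq_continuous_at)
      ultimately show ?thesis unfolding \<psi>'_def by (intro isCont_add isCont_mult)
    next
      case False
      have "\<forall>\<^sub>F s in nhds t. s \<in> {..<1}" using False by (intro eventually_nhds_in_open) auto
      then have "\<forall>\<^sub>F s in nhds t. \<psi>' s = 0"
        by eventually_elim (use cv(1,3) in \<open>auto simp: \<psi>'_def\<close>)
      then show ?thesis using isCont_cong[of \<psi>' "\<lambda>_. 0" t] by simp
    qed
  qed
  define D where "D = (\<lambda>t. (z t)\<^sup>2 * (dcutoff R t)\<^sup>2 - \<delta> * ((z t)\<^sup>2 * (cutoff R t)\<^sup>2))"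
  have Dc: "continuous_on {a..b} D" if "a > 0" for a b
    unfolding D_def by (intro continuous_on_diff continuous_on_mult continuous_on_power continuous_on_const cc zc that)
  let ?L = "\<lambda>t. (\<psi>' t)\<^sup>2 + n\<^sup>2 * (\<psi> t)\<^sup>2 - V t * (\<psi> t)\<^sup>2"
  have "integral {1..R+2} ?L = integral {1..R+2} D"
  proof -
    \<comment> \<open>The total derivative (q \<psi>^2)' integrates to 0, since \<psi> vanishes at
      both ends; D is what remains.\<close>
    have "((\<lambda>t. ?L t - D t) has_integral (q (R+2) * (\<psi> (R+2))\<^sup>2 - q 1 * (\<psi> 1)\<^sup>2)) {1..R+2}"
    proof (rule fundamental_theorem_of_calculus)
      show "1 \<le> R + 2" using R3 by simp
      fix t assume t: "t \<in> {1..R+2}"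
      then have t0: "t > 0" by simp
      have "((\<lambda>t. q t * (\<psi> t * \<psi> t)) has_real_derivative
          (m\<^sup>2 - V t - (q t)\<^sup>2) * (\<psi> t * \<psi> t) + (\<psi>' t * \<psi> t + \<psi>' t * \<psi> t) * q t) (at t)"
        by (rule DERIV_mult[OF q_deriv[OF t0] DERIV_mult[OF d d]])
      moreover have "(m\<^sup>2 - V t - (q t)\<^sup>2) * (\<psi> t * \<psi> t) + (\<psi>' t * \<psi> t + \<psi>' t * \<psi> t) * q t = ?L t - D t"
        unfolding D_def \<psi>_def \<psi>'_def \<delta>_def by algebra
      ultimately have "((\<lambda>t. q t * (\<psi> t)\<^sup>2) has_real_derivative ?L t - D t) (at t)"
        unfolding power2_eq_square by simp
      then show "((\<lambda>t. q t * (\<psi> t)\<^sup>2) has_vector_derivative ?L t - D t) (at t within {1..R+2})"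
        unfolding has_real_derivative_iff_has_vector_derivative[symmetric] by (rule has_field_derivative_at_within)
    qed
    moreover have "\<psi> (R+2) = 0" "\<psi> 1 = 0" using cv(1)[of 1] cv(2)[of "R+2"] by (simp_all add: \<psi>_def)
    ultimately have "integral {1..R+2} (\<lambda>t. ?L t - D t) = 0" by (simp add: integral_unique)
    moreover have "continuous_on {1..R+2} ?L"
    proof -
      have "continuous_on {1..R+2} \<psi>'" by (rule continuous_on_subset[OF c']) simp
      moreover have "continuous_on {1..R+2} \<psi>" by (intro continuous_at_imp_continuous_on ballI DERIV_isCont[OF d])
      moreover have "continuous_on {1..R+2} V" by (rule continuous_on_subset[OF V_cont]) auto
      ultimately show ?thesis by (intro continuous_on_diff continuous_on_add continuous_on_mult continuous_on_power continuous_on_const)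
    qed
    ultimately show ?thesis
      using integral_diff[OF integrable_continuous_interval integrable_continuous_interval, of 1 "R+2" ?L D] Dc[of 1 "R+2"] by simp
  qed
  also have "\<dots> = integral {1..3} D + integral {3..T} D + integral {T..R} D + integral {R..R+2} D"
  proof -
    have i: "D integrable_on {a..b}" if "a > 0" for a b by (rule integrable_continuous_interval[OF Dc[OF that]])
    have "integral {1..3} D + integral {3..R+2} D = integral {1..R+2} D"
      by (rule Henstock_Kurzweil_Integration.integral_combine) (use R3 i in auto)
    moreover have "integral {3..T} D + integral {T..R+2} D = integral {3..R+2} D"
      by (rule Henstock_Kurzweil_Integration.integral_combine) (use R3 R T3 i in auto)
    moreover have "integral {T..R} D + integral {R..R+2} D = integral {T..R+2} D"
      by (rule Henstock_Kurzweil_Integration.integral_combine) (use R3 R T3 i in auto)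
    ultimately show ?thesis by linarith
  qed
  also have "\<dots> < 0"
  proof -
    have D1: "D t \<le> (z t)\<^sup>2" for t
    proof -
      have "(dcutoff R t)\<^sup>2 \<le> 1" using cv(7)[of t] by (simp add: abs_square_le_1)
      then have "(z t)\<^sup>2 * (dcutoff R t)\<^sup>2 \<le> (z t)\<^sup>2 * 1" by (intro mult_left_mono) auto
      moreover have "0 \<le> \<delta> * ((z t)\<^sup>2 * (cutoff R t)\<^sup>2)" using \<delta> by simp
      ultimately show ?thesis unfolding D_def by linarith
    qed
    have e6: "(exp (m * 3))\<^sup>2 = exp (6*m)" by (simp flip: exp_double)
    have I1: "integral {1..3} D \<le> A * (3 - 1)"
    proof (rule integral_le_const[OF Dc])
      fix t :: real assume t: "1 \<le> t" "t \<le> 3"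
      have "z t \<le> exp (m * 3) * K 0" unfolding z_def
        using t m1 K_antimono[of 0 t] K_pos[of t] by (intro mult_mono) auto
      then have "(z t)\<^sup>2 \<le> (exp (m * 3) * K 0)\<^sup>2" using z_nonneg[of t] t by (intro power_mono) auto
      also have "\<dots> = A" unfolding power_mult_distrib e6 A_def by simp
      finally show "D t \<le> A" using D1[of t] by linarith
    qed auto
    have I2: "integral {3..T} D \<le> - (\<delta> * A / 4) * (T - 3)"
    proof (rule integral_le_const[OF Dc])
      fix t assume t: "3 \<le> t" "t \<le> T"
      have "K 0 / 2 \<le> K T" by (rule K_half) (use T3 p in auto)
      also have "K T \<le> K t" using t by (intro K_antimono) auto
      finally have "exp (m * 3) * (K 0 / 2) \<le> z t" unfolding z_def
        using t m1 K0_pos by (intro mult_mono) auto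
      then have "(exp (m * 3) * (K 0 / 2))\<^sup>2 \<le> (z t)\<^sup>2" using K0_pos by (intro power_mono) auto
      then have "A / 4 \<le> (z t)\<^sup>2" unfolding power_mult_distrib e6 A_def by (simp add: power_divide mult.commute)
      then have "\<delta> * (A / 4) \<le> \<delta> * (z t)\<^sup>2" using \<delta> by (intro mult_left_mono) auto
      moreover have "D t = - (\<delta> * (z t)\<^sup>2)" using cv(5,6)[of t] t R by (simp add: D_def)
      ultimately show "D t \<le> - (\<delta> * A / 4)" by simp
    qed (use T3 in auto)
    have I3: "integral {T..R} D \<le> 0 * (R - T)"
    proof (rule integral_le_const[OF Dc])
      fix t assume t: "T \<le> t" "t \<le> R"
      have "D t = - (\<delta> * (z t)\<^sup>2)" using cv(5,6)[of t] t T3 by (simp add: D_def)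
      then show "D t \<le> 0" using \<delta> by simp
    qed (use T3 R in auto)
    have I4: "integral {R..R+2} D \<le> (C\<^sup>2 * exp (-2*m*R)) * ((R + 2) - R)"
    proof (rule integral_le_const[OF Dc])
      fix t assume t: "R \<le> t" "t \<le> R + 2"
      then have t0: "t > 0" using R3 by simp
      have "z t \<le> exp (m * t) * (C * exp (-2*m*t))" unfolding z_def by (intro mult_left_mono C t0) simp
      also have "\<dots> = C * exp (- (m * t))" by (simp flip: exp_add)
      also have "\<dots> \<le> C * exp (- (m * R))" using C(1) t m1 by simp
      finally have "(z t)\<^sup>2 \<le> (C * exp (- (m * R)))\<^sup>2" using z_nonneg[of t] t0 by (intro power_mono) auto
      also have "\<dots> = C\<^sup>2 * exp (-2*m*R)" unfolding power_mult_distrib by (simp add: mult.assoc flip: exp_double)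
      finally show "D t \<le> C\<^sup>2 * exp (-2*m*R)" using D1[of t] by linarith
    qed (use R3 in auto)
    have eT: "- (\<delta> * A / 4) * (T - 3) = - (13/4 * A)" unfolding T \<delta>_def[symmetric] using \<delta> by simp
    have eR: "(C\<^sup>2 * exp (-2*m*R)) * ((R + 2) - R) = (C\<^sup>2 * exp (-2*m*R)) + (C\<^sup>2 * exp (-2*m*R))" by simp
    have "a + b + c + d < 0" if "a \<le> A * (3 - 1)" "b \<le> - (13/4 * A)" "c \<le> 0" "d \<le> e + e" "e < A / 2" for a b c d e :: real
      using that A by simp
    from this[OF I1 I2[unfolded eT] I3[unfolded mult_zero_left] I4[unfolded eR] R(2)] show ?thesis .
  qed
  finally have neg: "integral {1..R+2} ?L < 0" .
  show thesis
  proof (rule that[OF d c' _ _ _ _ _ neg])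
    show "R + 2 > 1" using R3 by simp
  qed (use cv(1-4) in \<open>auto simp: \<psi>_def \<psi>'_def\<close>)
qed

text \<open>The trial functions are \<psi>(t) times the basis functions of frequency at most n, with
  one profile for all of them. Orthonormality decouples the t-part, and the angular energy is at
  most n^2 times the norm, so the profile of the worst frequency n serves every combination.\<close>

lemma lower_core:
  assumes d: "\<And>t. (\<psi> has_real_derivative \<psi>' t) (at t)" and c': "continuous_on UNIV \<psi>'" and b: "b > 1"
    and v: "\<And>t. t \<le> 1 \<Longrightarrow> \<psi> t = 0" "\<And>t. t \<le> 1 \<Longrightarrow> \<psi>' t = 0" "\<And>t. t \<ge> b \<Longrightarrow> \<psi> t = 0" "\<And>t. t \<ge> b \<Longrightarrow> \<psi>' t = 0"
    and neg: "integral {1..b} (\<lambda>t. (\<psi>' t)\<^sup>2 + (real n)\<^sup>2 * (\<psi> t)\<^sup>2 - V t * (\<psi> t)\<^sup>2) < 0"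
  obtains f where "\<And>j. test_fun (f j)"
    "\<And>c. \<exists>j<2*n+1. c j \<noteq> 0 \<Longrightarrow> (LBINT t:{0<..}. J (\<lambda>x. \<Sum>j<2*n+1. c j * f j x) t) < 0"
proof -
  \<comment> \<open>The factor exp (k t) compensates the factor exp (-k t) of the harmonic
    polynomial. Building the product from a polynomial and a radial test function makes it visibly
    C1, also at the origin.\<close>
  define H where "H = (\<lambda>k t. \<psi> t * exp (real k * t))"
  define H' where "H' = (\<lambda>k t. \<psi>' t * exp (real k * t) + exp (real k * t) * real k * \<psi> t)"
  have dH: "(H k has_real_derivative H' k t) (at t)" for k t
    unfolding H_def H'_def by (rule DERIV_mult[OF d]) (auto intro!: derivative_eq_intros)
  have \<psi>c: "continuous_on UNIV \<psi>" using d by (intro continuous_at_imp_continuous_on ballI) (rule DERIV_isCont)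
  have cH: "continuous_on UNIV (H' k)" for k unfolding H'_def
    by (intro continuous_on_add continuous_on_mult c' \<psi>c continuous_on_exp continuous_on_const continuous_on_id)
  define f where "f = (\<lambda>j x. tbp j x * (if x = 0 then 0 else H (freq j) (- ln (norm x))))"
  have tf: "test_fun (f j)" for j unfolding f_def
    by (intro test_fun_mult tbp_C1 radial_test_fun(1)[where a=1 and b=b and H="H (freq j)" and H'="H' (freq j)"] dH cH)
       (auto simp: H_def H'_def v)
  have Pf: "f j (pol t \<theta>) = \<psi> t * tb j \<theta>" for j t \<theta>
  proof -
    have "norm (pol t \<theta>) \<noteq> 0" by simp
    then have "pol t \<theta> \<noteq> 0" by (metis norm_zero)
    then have "f j (pol t \<theta>) = (exp (- (real (freq j) * t)) * tb j \<theta>) * (\<psi> t * exp (real (freq j) * t))"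
      unfolding f_def tbp_pol H_def by simp
    also have "\<dots> = \<psi> t * tb j \<theta> * (exp (- (real (freq j) * t)) * exp (real (freq j) * t))" by simp
    finally show ?thesis by (simp flip: exp_add)
  qed
  have "(LBINT t:{0<..}. J (\<lambda>x. \<Sum>j<2*n+1. c j * f j x) t) < 0" if c: "\<exists>j<2*n+1. c j \<noteq> 0" for c
  proof -
    let ?F = "\<lambda>x. \<Sum>j<2*n+1. c j * f j x"
    have tF: "test_fun ?F" by (rule test_fun_lincomb(1)) (rule tf)
    have C1F: "C1 ?F" by (rule test_fun_C1[OF tF])
    define E where "E = (\<lambda>\<theta>. \<Sum>j<2*n+1. c j * tb j \<theta>)"
    define E' where "E' = (\<lambda>\<theta>. \<Sum>j<2*n+1. c j * dtb j \<theta>)"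
    define s where "s = (\<Sum>j<2*n+1. (c j)\<^sup>2)"
    have s: "s > 0"
    proof -
      obtain j where "j < 2*n+1" "c j \<noteq> 0" using c by blast
      then show ?thesis unfolding s_def by (intro sum_pos2[of _ j]) auto
    qed
    have Ph: "Ph ?F t \<theta> = \<psi> t * E \<theta>" for t \<theta>
      unfolding Ph_def Pf E_def sum_distrib_left by (intro sum.cong) auto
    have Pt: "Pt ?F t \<theta> = \<psi>' t * E \<theta>" for t \<theta>
    proof (rule DERIV_unique)
      show "((\<lambda>t. Ph ?F t \<theta>) has_real_derivative Pt ?F t \<theta>) (at t)" by (rule Ph_deriv(1)[OF C1F])
      show "((\<lambda>t. Ph ?F t \<theta>) has_real_derivative \<psi>' t * E \<theta>) (at t)" unfolding Ph by (rule DERIV_cmult_right[OF d])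
    qed
    have Pa: "Pa ?F t \<theta> = \<psi> t * E' \<theta>" for t \<theta>
    proof (rule DERIV_unique)
      show "((\<lambda>\<theta>. Ph ?F t \<theta>) has_real_derivative Pa ?F t \<theta>) (at \<theta>)" by (rule Ph_deriv(2)[OF C1F])
      have "(E has_real_derivative E' \<theta>) (at \<theta>)" unfolding E_def E'_def
        by (rule DERIV_sum) (rule DERIV_cmult[OF tb_deriv])
      then show "((\<lambda>\<theta>. Ph ?F t \<theta>) has_real_derivative \<psi> t * E' \<theta>) (at \<theta>)" unfolding Ph by (rule DERIV_cmult)
    qed
    have J: "J ?F t = (\<psi>' t)\<^sup>2 * s + (\<psi> t)\<^sup>2 * IT (\<lambda>\<theta>. (E' \<theta>)\<^sup>2) - V t * ((\<psi> t)\<^sup>2 * s)" for t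
      unfolding J_def Ph Pt Pa power_mult_distrib integral_mult_right
      unfolding E_def IT_combination s_def ..
    have J0: "J ?F t = 0" if "t \<le> 1 \<or> t \<ge> b" for t using that v unfolding J by auto
    have E'le: "IT (\<lambda>\<theta>. (E' \<theta>)\<^sup>2) \<le> (real n)\<^sup>2 * s" unfolding E'_def s_def by (rule IT_combination_deriv)
    have "(LBINT t:{0<..}. J ?F t) = (LBINT t:{1..b}. J ?F t)"
      unfolding set_lebesgue_integral_def
      by (intro Bochner_Integration.integral_cong) (use J0 b in \<open>auto simp: indicator_def\<close>)
    also have "\<dots> = integral {1..b} (J ?F)"
      by (rule set_borel_integral_eq_integral(2)[OF borel_integrable_atLeastAtMost'[OF J_continuous[OF C1F]]]) simp
    also have "\<dots> \<le> integral {1..b} (\<lambda>t. s * ((\<psi>' t)\<^sup>2 + (real n)\<^sup>2 * (\<psi> t)\<^sup>2 - V t * (\<psi> t)\<^sup>2))"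
    proof (intro integral_le integrable_continuous_interval J_continuous C1F)
      have "continuous_on {1..b} V" by (rule continuous_on_subset[OF V_cont]) auto
      then show "continuous_on {1..b} (\<lambda>t. s * ((\<psi>' t)\<^sup>2 + (real n)\<^sup>2 * (\<psi> t)\<^sup>2 - V t * (\<psi> t)\<^sup>2))"
        by (intro continuous_on_diff continuous_on_add continuous_on_mult continuous_on_power continuous_on_const
            continuous_on_subset[OF c'] continuous_on_subset[OF \<psi>c]) auto
      fix t
      have "(\<psi> t)\<^sup>2 * IT (\<lambda>\<theta>. (E' \<theta>)\<^sup>2) \<le> (\<psi> t)\<^sup>2 * ((real n)\<^sup>2 * s)" by (intro mult_left_mono E'le) simp
      then show "J ?F t \<le> s * ((\<psi>' t)\<^sup>2 + (real n)\<^sup>2 * (\<psi> t)\<^sup>2 - V t * (\<psi> t)\<^sup>2)"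
        unfolding J by (simp add: algebra_simps)
    qed simp
    also have "\<dots> = s * integral {1..b} (\<lambda>t. (\<psi>' t)\<^sup>2 + (real n)\<^sup>2 * (\<psi> t)\<^sup>2 - V t * (\<psi> t)\<^sup>2)" by (rule integral_mult_right)
    also have "\<dots> < 0" using s neg by (simp add: mult_pos_neg)
    finally show ?thesis .
  qed
  with tf show thesis by (rule that)
qed

end

section \<open>The Morse index\<close>

text \<open>Fewer equations than unknowns: induction on the number of equations, with Gaussian
  elimination of one unknown.\<close>

lemma homogeneous_solution:
  fixes A :: "nat \<Rightarrow> 'a \<Rightarrow> real"
  assumes "finite I" "M < card I"
  shows "\<exists>c. (\<exists>i\<in>I. c i \<noteq> 0) \<and> (\<forall>l<M. (\<Sum>i\<in>I. c i * A l i) = 0)"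
  using assms
proof (induction M arbitrary: I A)
  case 0
  then have "I \<noteq> {}" by auto
  then show ?case by (intro exI[of _ "\<lambda>_. 1"]) auto
next
  case (Suc M)
  show ?case
  proof (cases "\<forall>i\<in>I. A M i = 0")
    case True
    obtain c where c: "\<exists>i\<in>I. c i \<noteq> 0" "\<forall>l<M. (\<Sum>i\<in>I. c i * A l i) = 0"
      using Suc.IH[of I A] Suc.prems by auto
    have "(\<Sum>i\<in>I. c i * A M i) = 0" by (intro sum.neutral) (use True in auto)
    then show ?thesis using c by (intro exI[of _ c]) (auto simp: less_Suc_eq)
  next
    case False
    \<comment> \<open>Equation M is solved for the unknown i0 and substituted into the remaining
      ones, which leaves one equation and one unknown fewer.\<close>
    then obtain i0 where i0: "i0 \<in> I" "A M i0 \<noteq> 0" by auto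
    define I' where "I' = I - {i0}"
    have I: "I = insert i0 I'" "i0 \<notin> I'" "finite I'" using i0 Suc.prems by (auto simp: I'_def)
    have "M < card I'" using Suc.prems I by simp
    then obtain c where c: "\<exists>i\<in>I'. c i \<noteq> 0" "\<forall>l<M. (\<Sum>i\<in>I'. c i * (A l i - A l i0 * A M i / A M i0)) = 0"
      using Suc.IH[OF I(3), of "\<lambda>l i. A l i - A l i0 * A M i / A M i0"] by auto
    define s where "s = (\<Sum>i\<in>I'. c i * A M i)"
    define c' where "c' = (\<lambda>i. if i = i0 then - s / A M i0 else c i)"
    have sum': "(\<Sum>i\<in>I. c' i * A l i) = - s / A M i0 * A l i0 + (\<Sum>i\<in>I'. c i * A l i)" for l
    proof -
      have "(\<Sum>i\<in>I'. c' i * A l i) = (\<Sum>i\<in>I'. c i * A l i)"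
        using I(2) by (intro sum.cong) (auto simp: c'_def)
      then show ?thesis unfolding I(1) using I by (simp add: c'_def)
    qed
    have "(\<Sum>i\<in>I. c' i * A l i) = 0" if "l < Suc M" for l
    proof (cases "l = M")
      case True
      then show ?thesis unfolding sum' using i0 by (simp add: s_def)
    next
      case False
      then have "l < M" using that by simp
      then have "(\<Sum>i\<in>I'. c i * (A l i - A l i0 * A M i / A M i0)) = 0" using c by blast
      moreover have "(\<Sum>i\<in>I'. c i * (A l i - A l i0 * A M i / A M i0)) = (\<Sum>i\<in>I'. c i * A l i) - (A l i0 / A M i0) * s"
        unfolding s_def sum_distrib_left sum_subtractf[symmetric] by (intro sum.cong) (auto simp: algebra_simps)
      ultimately show ?thesis unfolding sum' by simp
    qed
    moreover have "\<exists>i\<in>I. c' i \<noteq> 0" using c(1) I by (auto simp: c'_def)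
    ultimately show ?thesis by blast
  qed
qed

text \<open>Scaling to maximum norm 1 keeps the coefficients in a compact set and prevents their
  limits from being all 0.\<close>

lemma homogeneous_solution_normalized:
  fixes A :: "nat \<Rightarrow> nat \<Rightarrow> real"
  assumes "M < N"
  shows "\<exists>c. (\<forall>i. \<bar>c i\<bar> \<le> 1) \<and> (\<exists>i<N. \<bar>c i\<bar> = 1) \<and> (\<forall>l<M. (\<Sum>i<N. c i * A l i) = 0)"
proof -
  obtain c where c: "\<exists>i<N. c i \<noteq> 0" "\<forall>l<M. (\<Sum>i<N. c i * A l i) = 0"
    using homogeneous_solution[of "{..<N}" M A] assms by auto
  define x where "x = Max ((\<lambda>i. \<bar>c i\<bar>) ` {..<N})"
  have fin: "finite ((\<lambda>i. \<bar>c i\<bar>) ` {..<N})" "(\<lambda>i. \<bar>c i\<bar>) ` {..<N} \<noteq> {}" using assms by auto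
  have le: "\<bar>c i\<bar> \<le> x" if "i < N" for i unfolding x_def using fin that by (intro Max_ge) auto
  obtain i where i: "i < N" "c i \<noteq> 0" using c by blast
  have x: "x > 0" using le[OF i(1)] i(2) by simp
  have "x \<in> (\<lambda>i. \<bar>c i\<bar>) ` {..<N}" unfolding x_def by (rule Max_in[OF fin])
  then obtain k where k: "k < N" "x = \<bar>c k\<bar>" by auto
  define c' where "c' = (\<lambda>i. if i < N then c i / x else 0)"
  have "(\<Sum>i<N. c' i * A l i) = 0" if "l < M" for l
  proof -
    have "(\<Sum>i<N. c' i * A l i) = (\<Sum>i<N. c i * A l i) / x"
      unfolding sum_divide_distrib by (intro sum.cong) (auto simp: c'_def)
    then show ?thesis using c that by simp
  qed
  moreover have "\<bar>c' i\<bar> \<le> 1" for i using le[of i] x by (simp add: c'_def)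
  moreover have "\<bar>c' k\<bar> = 1" using k x by (simp add: c'_def)
  ultimately show ?thesis using k by blast
qed

lemma bounded_sequences_subseq:
  fixes c :: "nat \<Rightarrow> nat \<Rightarrow> real"
  assumes "\<And>j i. \<bar>c j i\<bar> \<le> 1"
  shows "\<exists>r l. strict_mono r \<and> (\<forall>i<N. (\<lambda>j. c (r j) i) \<longlonglongrightarrow> l i)"
proof (induction N)
  case 0
  show ?case by (intro exI[of _ id]) (auto simp: strict_mono_def)
next
  case (Suc N)
  then obtain r l where r: "strict_mono r" "\<forall>i<N. (\<lambda>j. c (r j) i) \<longlonglongrightarrow> l i" by blast
  have m: "\<forall>j. c (r j) N \<in> {-1..1}" using assms[of _ N] by (auto simp: abs_le_iff)
  obtain x s where "x \<in> {-1..1}" and s: "strict_mono s" "((\<lambda>j. c (r j) N) \<circ> s) \<longlonglongrightarrow> x"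
    by (rule seq_compactE[OF compact_imp_seq_compact[OF compact_Icc] m])
  have "(\<lambda>j. c ((r \<circ> s) j) i) \<longlonglongrightarrow> (l(N := x)) i" if "i < Suc N" for i
  proof (cases "i = N")
    case True then show ?thesis using s(2) by (simp add: o_def)
  next
    case False
    then have "(\<lambda>j. c (r j) i) \<longlonglongrightarrow> l i" using r that by simp
    from LIMSEQ_subseq_LIMSEQ[OF this s(1)] show ?thesis using False by (simp add: o_def)
  qed
  moreover have "strict_mono (r \<circ> s)" by (rule strict_mono_o[OF r(1) s(1)])
  ultimately show ?case by blast
qed

lemma L2lim_subseq: "L2lim M F f \<Longrightarrow> strict_mono r \<Longrightarrow> L2lim M (\<lambda>n. F (r n)) f"
  unfolding L2lim_def using LIMSEQ_subseq_LIMSEQ[of "\<lambda>n. \<integral>x. (norm (F n x - f x))\<^sup>2 \<partial>M" 0 r]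
  by (simp add: o_def)

lemma cf_lincomb:
  fixes N :: nat
  assumes "\<And>i. i < N \<Longrightarrow> C1 (f i)"
  shows "cf (Ph (\<lambda>x. \<Sum>i<N. c i * f i x) t) l = (\<Sum>i<N. c i * cf (Ph (f i) t) l)"
proof -
  have "cf (Ph (\<lambda>x. \<Sum>i<N. c i * f i x) t) l = IT (\<lambda>\<theta>. \<Sum>i<N. c i * (Ph (f i) t \<theta> * tb l \<theta>))"
    unfolding cf_def Ph_def sum_distrib_right by (simp only: mult.assoc)
  also have "\<dots> = (\<Sum>i<N. IT (\<lambda>\<theta>. c i * (Ph (f i) t \<theta> * tb l \<theta>)))"
  proof (rule integral_sum)
    fix i assume "i \<in> {..<N}"
    then have "continuous_on {0..2*pi} (Ph (f i) t)"
      by (intro continuous_on_sections(1)[OF polar_continuous(1)] assms) simp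
    then show "(\<lambda>\<theta>. c i * (Ph (f i) t \<theta> * tb l \<theta>)) integrable_on {0..2*pi}"
      by (intro integrable_continuous_interval continuous_on_mult continuous_on_const tb_continuous)
  qed simp
  finally show ?thesis unfolding integral_mult_right cf_def .
qed

context emden
begin

text \<open>The quadratic form with the gradient as a separate argument, so that limits can be taken
  in the pair without going through \<open>wgrad\<close>.\<close>

definition QQ :: "(real^2 \<Rightarrow> real) \<Rightarrow> (real^2 \<Rightarrow> real^2) \<Rightarrow> real" where
  "QQ \<psi> G = (\<integral>x. (norm (G x))\<^sup>2 \<partial>MB) - (\<integral>x. pot x * (\<psi> x)\<^sup>2 \<partial>MB)"

lemma QQ_lim:
  assumes "L2lim MB \<Psi> \<psi>" "L2lim MB \<Gamma> G"
  shows "(\<lambda>n. QQ (\<Psi> n) (\<Gamma> n)) \<longlonglongrightarrow> QQ \<psi> G"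
proof -
  obtain C where C: "\<And>x. x \<in> B \<Longrightarrow> \<bar>pot x\<bar> \<le> C" using pot_bounded by blast
  \<comment> \<open>Multiplication by the square root of the potential is bounded on L2 and turns
    the potential term into an inner product of a sequence with itself.\<close>
  define b where "b = (\<lambda>x. sqrt (pot x))"
  have bm: "b \<in> borel_measurable MB" unfolding b_def by (rule measurable_restrict_space1) simp
  have bb: "AE x in MB. \<bar>b x\<bar> \<le> sqrt C"
  proof (rule AE_I2)
    fix x assume "x \<in> space MB"
    then show "\<bar>b x\<bar> \<le> sqrt C" unfolding b_def using C[of x] pot_nonneg[of x] by simp
  qed
  have L: "L2lim MB (\<lambda>n x. b x *\<^sub>R \<Psi> n x) (\<lambda>x. b x *\<^sub>R \<psi> x)" by (rule L2lim_bounded_mult[OF assms(1) bm bb])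
  have e: "(b x *\<^sub>R y) \<bullet> (b x *\<^sub>R y) = pot x * y\<^sup>2" for x and y :: real
    using pot_nonneg[of x] by (simp add: b_def power2_eq_square mult_ac flip: mult.assoc)
  have 1: "(\<lambda>n. \<integral>x. pot x * (\<Psi> n x)\<^sup>2 \<partial>MB) \<longlonglongrightarrow> (\<integral>x. pot x * (\<psi> x)\<^sup>2 \<partial>MB)"
    using L2lim_inner[OF L L] unfolding e .
  have 2: "(\<lambda>n. \<integral>x. (norm (\<Gamma> n x))\<^sup>2 \<partial>MB) \<longlonglongrightarrow> (\<integral>x. (norm (G x))\<^sup>2 \<partial>MB)"
    using L2lim_inner[OF assms(2) assms(2)] unfolding power2_norm_eq_inner .
  show ?thesis unfolding QQ_def by (rule tendsto_diff[OF 2 1])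
qed

lemma QQ_test: "test_fun \<phi> \<Longrightarrow> QQ \<phi> (cgrad \<phi>) = (LBINT t:{0<..}. J \<phi> t)"
  unfolding QQ_def by (rule Q_polar(2))

text \<open>Against 2n+1 conditions at t0, 2n+2 functions always leave a nontrivial combination.
  Coefficients on the single circle t = t0 are taken from the approximating test functions, so the
  combination depends on the approximation step; compactness of the normalised coefficients yields a
  limit combination, and the form is continuous along it.\<close>

lemma not_negative_definite:
  assumes n: "m \<le> real n + 1" and f: "\<And>i. i < 2*n+2 \<Longrightarrow> H10 (f i)"
  obtains c G where "\<exists>i<2*n+2. c i \<noteq> 0" "H10_grad (\<lambda>x. \<Sum>i<2*n+2. c i * f i x) G"
    "0 \<le> QQ (\<lambda>x. \<Sum>i<2*n+2. c i * f i x) G"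
proof -
  define N where "N = 2*n+2"
  obtain t0 where t0: "t0 > 0" "y t0 = 0" by (rule y_zero)
  have "\<forall>i. \<exists>\<phi> G. i < N \<longrightarrow> (\<forall>k. test_fun (\<phi> k)) \<and> L2lim MB \<phi> (f i) \<and> L2lim MB (\<lambda>k. cgrad (\<phi> k)) G"
    using f unfolding N_def H10_def H10_grad_iff by blast
  then obtain \<phi> G where \<phi>: "\<And>i k. i < N \<Longrightarrow> test_fun (\<phi> i k)" "\<And>i. i < N \<Longrightarrow> L2lim MB (\<phi> i) (f i)"
      "\<And>i. i < N \<Longrightarrow> L2lim MB (\<lambda>k. cgrad (\<phi> i k)) (G i)" by metis
  have "\<forall>k. \<exists>c. (\<forall>i. \<bar>c i\<bar> \<le> 1) \<and> (\<exists>i<N. \<bar>c i\<bar> = 1) \<and> (\<forall>l<2*n+1. (\<Sum>i<N. c i * cf (Ph (\<phi> i k) t0) l) = 0)"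
    by (intro allI homogeneous_solution_normalized) (simp add: N_def)
  from choice[OF this] obtain c where cc: "\<forall>k. (\<forall>i. \<bar>c k i\<bar> \<le> 1) \<and> (\<exists>i<N. \<bar>c k i\<bar> = 1) \<and>
      (\<forall>l<2*n+1. (\<Sum>i<N. c k i * cf (Ph (\<phi> i k) t0) l) = 0)" by (elim exE)
  have c: "\<bar>c k i\<bar> \<le> 1" "\<exists>i<N. \<bar>c k i\<bar> = 1"
      "l < 2*n+1 \<Longrightarrow> (\<Sum>i<N. c k i * cf (Ph (\<phi> i k) t0) l) = 0" for k i l
    using spec[OF cc, of k] by simp_all
  define \<Psi> where "\<Psi> = (\<lambda>k x. \<Sum>i<N. c k i * \<phi> i k x)"
  have t\<Psi>: "test_fun (\<Psi> k)" and g\<Psi>: "cgrad (\<Psi> k) = (\<lambda>x. \<Sum>i<N. c k i *\<^sub>R cgrad (\<phi> i k) x)" for k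
    unfolding \<Psi>_def using test_fun_lincomb[of N "\<lambda>i. \<phi> i k" "c k"] \<phi>(1) by (auto simp: fun_eq_iff)
  have Q0: "0 \<le> QQ (\<Psi> k) (cgrad (\<Psi> k))" for k
    unfolding QQ_test[OF t\<Psi>]
  proof (rule upper_core[OF t\<Psi> n t0 _ Q_polar(1)[OF t\<Psi>]])
    fix l assume "l < 2*n+1"
    have "cf (Ph (\<Psi> k) t0) l = (\<Sum>i<N. c k i * cf (Ph (\<phi> i k) t0) l)"
      unfolding \<Psi>_def by (rule cf_lincomb) (rule test_fun_C1[OF \<phi>(1)])
    then show "cf (Ph (\<Psi> k) t0) l = 0" using c(3)[OF \<open>l < 2*n+1\<close>] by simp
  qed
  obtain r l where r: "strict_mono r" "\<And>i. i < N \<Longrightarrow> (\<lambda>k. c (r k) i) \<longlonglongrightarrow> l i"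
    using bounded_sequences_subseq[of c N, OF c(1)] by blast
  \<comment> \<open>Which coefficient has modulus 1 may change with k; the sum of the moduli is a
    lower bound that passes to the limit.\<close>
  have "1 \<le> (\<Sum>i<N. \<bar>c k i\<bar>)" for k
  proof -
    obtain i where i: "i < N" "\<bar>c k i\<bar> = 1" using c(2) by blast
    have "\<bar>c k i\<bar> \<le> (\<Sum>i<N. \<bar>c k i\<bar>)" by (rule member_le_sum) (use i in auto)
    then show ?thesis using i by simp
  qed
  moreover have "(\<lambda>k. \<Sum>i<N. \<bar>c (r k) i\<bar>) \<longlonglongrightarrow> (\<Sum>i<N. \<bar>l i\<bar>)"
    by (intro tendsto_sum tendsto_rabs r(2)) simp
  ultimately have "1 \<le> (\<Sum>i<N. \<bar>l i\<bar>)" by (intro LIMSEQ_le_const) auto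
  then have l0: "\<exists>i<N. l i \<noteq> 0"
    by (rule contrapos_pp) (simp add: not_le)
  let ?\<psi> = "\<lambda>x. \<Sum>i<N. l i * f i x" and ?G = "\<lambda>x. \<Sum>i<N. l i *\<^sub>R G i x"
  have L1: "L2lim MB (\<lambda>k. \<Psi> (r k)) ?\<psi>"
  proof -
    have "L2lim MB (\<lambda>k x. \<Sum>i<N. c (r k) i *\<^sub>R \<phi> i (r k) x) (\<lambda>x. \<Sum>i<N. l i *\<^sub>R f i x)"
      by (rule L2lim_sum, rule L2lim_bounded_coeff[OF L2lim_subseq[OF \<phi>(2) r(1)] r(2)]) simp_all
    then show ?thesis unfolding \<Psi>_def by simp
  qed
  have L2: "L2lim MB (\<lambda>k. cgrad (\<Psi> (r k))) ?G"
    unfolding g\<Psi> by (rule L2lim_sum, rule L2lim_bounded_coeff[OF L2lim_subseq[OF \<phi>(3) r(1)] r(2)]) simp_all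
  have H: "H10_grad ?\<psi> ?G" unfolding H10_grad_iff
    by (rule exI[of _ "\<lambda>k. \<Psi> (r k)"]) (use t\<Psi> L1 L2 in auto)
  have "0 \<le> QQ ?\<psi> ?G"
    by (rule LIMSEQ_le_const[OF QQ_lim[OF L1 L2]]) (use Q0 in auto)
  from that[OF l0[unfolded N_def] H[unfolded N_def] this[unfolded N_def]] show thesis .
qed

end

theorem theorem1p3:
  fixes \<alpha> :: real
  assumes "\<alpha> \<ge> 0"
  shows "\<exists>pstar > 1. \<forall>p > pstar. \<forall>u. pos_least_energy_radial \<alpha> p u \<longrightarrow>
           morse_index \<alpha> p u = enat (nat (1 + 2 * \<lceil>\<alpha> / 2\<rceil>))"
proof -
  define n where "n = nat \<lceil>\<alpha> / 2\<rceil>"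
  define m where "m = 1 + \<alpha> / 2"
  define T where "T = 3 + 13 / (m\<^sup>2 - (real n)\<^sup>2)"
  have ceil: "\<lceil>\<alpha> / 2\<rceil> \<ge> 0" using assms by simp
  have rn: "real n = of_int \<lceil>\<alpha> / 2\<rceil>" unfolding n_def using ceil by simp
  \<comment> \<open>The strict inequality is for the negative directions, where m^2 - n^2 is a
    divisor; the weak one is for nonnegativity on the modes of frequency at least n + 1.\<close>
  have nm: "real n < m" "m \<le> real n + 1"
    unfolding rn m_def using ceiling_correct[of "\<alpha> / 2"] by linarith+
  have k: "nat (1 + 2 * \<lceil>\<alpha> / 2\<rceil>) = 2*n+1" unfolding n_def using ceil by (simp add: nat_add_distrib nat_mult_distrib)
  have "m\<^sup>2 - (real n)\<^sup>2 > 0" using nm by (simp add: power_strict_mono)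
  then have T: "T > 0" unfolding T_def by (intro add_pos_pos divide_pos_pos) auto
  have m0: "m > 0" using assms by (simp add: m_def)
  show ?thesis unfolding k
  \<comment> \<open>The threshold beyond which \<open>K_half\<close> keeps w' above half its initial
    value up to time T.\<close>
  proof (intro exI[of _ "1 + 4 * m\<^sup>2 * T\<^sup>2"] conjI allI impI)
    show "1 < 1 + 4 * m\<^sup>2 * T\<^sup>2" using T m0 by simp
    fix p u
    assume p: "1 + 4 * m\<^sup>2 * T\<^sup>2 < p" and u: "pos_least_energy_radial \<alpha> p u"
    have p1: "p > 1" using p T m0 by (smt (verit) mult_pos_pos zero_less_power)
    have ws: "weak_solution \<alpha> p u" and up: "AE x in MB. u x > 0" and ur: "radial u"
      using u unfolding pos_least_energy_radial_def AE_MB radial_nehari_def by auto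
    have "H10_grad u (wgrad u)" using ws by (intro H10_wgrad) (simp add: weak_solution_def)
    then obtain \<phi> where \<phi>: "\<And>k. test_fun (\<phi> k)" "L2lim MB \<phi> u" "L2lim MB (\<lambda>k. cgrad (\<phi> k)) (wgrad u)"
      unfolding H10_grad_iff by blast
    interpret R: radial_solution u "wgrad u" \<phi> \<alpha> p
      using \<phi> ur assms p1 up ws unfolding weak_solution_def
      by unfold_locales (simp_all add: set_integral_MB)
    have Mm: "R.M0 = m" by (simp add: R.M0_def m_def)
    interpret emden m p R.W R.K using R.emden_W unfolding Mm .
    \<comment> \<open>Positivity removes the absolute value, u equals its profile almost everywhere,
      and 2m - 2 = \<alpha> matches the weights. This is the only link between the given form and
      the one of the radial equation.\<close>
    have potu: "AE x in MB. p * (norm x powr \<alpha> * \<bar>u x\<bar> powr (p - 1)) = pot x"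
      using R.u_eq_W up AE_MB_nonzero AE_space
    proof eventually_elim
      case (elim x)
      then have "- ln (norm x) > 0" by (simp add: B_def)
      then have "max 0 (- ln (norm x)) = - ln (norm x)" by simp
      moreover have "2 * m - 2 = \<alpha>" by (simp add: m_def)
      ultimately show ?case using elim unfolding pot_def by simp
    qed
    have um: "u \<in> borel_measurable MB" using L2limD(1)[OF \<phi>(2)] by (simp add: L2_def)
    have Qf: "Qform \<alpha> p u \<psi> = QQ \<psi> G" if H: "H10_grad \<psi> G" for \<psi> G
    proof -
      have [measurable]: "\<psi> \<in> borel_measurable MB" "u \<in> borel_measurable MB"
        using H um unfolding H10_grad_iff L2lim_def L2_def by auto
      have [measurable]: "(\<lambda>x::real^2. norm x powr \<alpha>) \<in> borel_measurable MB" "pot \<in> borel_measurable MB"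
        by (rule measurable_restrict_space1, simp)+
      have "p * (\<integral>x. norm x powr \<alpha> * \<bar>u x\<bar> powr (p-1) * (\<psi> x)\<^sup>2 \<partial>MB) =
          (\<integral>x. p * (norm x powr \<alpha> * \<bar>u x\<bar> powr (p-1) * (\<psi> x)\<^sup>2) \<partial>MB)" by simp
      also have "\<dots> = (\<integral>x. pot x * (\<psi> x)\<^sup>2 \<partial>MB)"
      proof (rule integral_cong_AE)
        show "AE x in MB. p * (norm x powr \<alpha> * \<bar>u x\<bar> powr (p-1) * (\<psi> x)\<^sup>2) = pot x * (\<psi> x)\<^sup>2"
          using potu by eventually_elim (metis mult.assoc)
      qed measurable
      finally show ?thesis unfolding Qform_def QQ_def set_integral_MB integral_wgrad[OF H] by simp
    qed
    show "morse_index \<alpha> p u = enat (2*n+1)"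
      unfolding morse_index_def
    proof (rule antisym)
      show "Sup {enat k | k. \<exists>f :: nat \<Rightarrow> real^2 \<Rightarrow> real. (\<forall>i<k. H10 (f i)) \<and>
        (\<forall>c :: nat \<Rightarrow> real. (\<exists>i<k. c i \<noteq> 0) \<longrightarrow> Qform \<alpha> p u (\<lambda>x. \<Sum>i<k. c i * f i x) < 0)} \<le> enat (2*n+1)"
      proof (rule Sup_least)
        fix d
        assume "d \<in> {enat k | k. \<exists>f :: nat \<Rightarrow> real^2 \<Rightarrow> real. (\<forall>i<k. H10 (f i)) \<and>
          (\<forall>c :: nat \<Rightarrow> real. (\<exists>i<k. c i \<noteq> 0) \<longrightarrow> Qform \<alpha> p u (\<lambda>x. \<Sum>i<k. c i * f i x) < 0)}"
        then obtain k f where d: "d = enat k" and f: "\<forall>i<k. H10 (f i)"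
          and neg: "\<forall>c. (\<exists>i<k. c i \<noteq> 0) \<longrightarrow> Qform \<alpha> p u (\<lambda>x. \<Sum>i<k. c i * f i x) < 0"
          unfolding mem_Collect_eq by (elim exE conjE)
        have "\<not> 2*n+2 \<le> k"
        proof
          assume k: "2*n+2 \<le> k"
          have fH: "H10 (f i)" if "i < 2*n+2" for i using f k that by simp
          obtain c G where c: "\<exists>i<2*n+2. c i \<noteq> 0" "H10_grad (\<lambda>x. \<Sum>i<2*n+2. c i * f i x) G"
            "0 \<le> QQ (\<lambda>x. \<Sum>i<2*n+2. c i * f i x) G" using not_negative_definite[where f=f, OF nm(2) fH] by blast
          \<comment> \<open>A longer family is refuted through its first 2n+2 members; padding with
            zeros makes the combination one of the whole family.\<close>
          define c' where "c' = (\<lambda>i. if i < 2*n+2 then c i else 0)"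
          have "(\<Sum>i<k. c' i * f i x) = (\<Sum>i<2*n+2. c i * f i x)" for x
            by (rule sum.mono_neutral_cong_right) (use k in \<open>auto simp: c'_def\<close>)
          then have "Qform \<alpha> p u (\<lambda>x. \<Sum>i<k. c' i * f i x) \<ge> 0" using Qf[OF c(2)] c(3) by simp
          moreover obtain i where "i < 2*n+2" "c i \<noteq> 0" using c(1) by blast
          then have "i < k" "c' i \<noteq> 0" using k by (simp_all add: c'_def)
          then have "Qform \<alpha> p u (\<lambda>x. \<Sum>i<k. c' i * f i x) < 0" using spec[OF neg, of c'] by blast
          ultimately show False by simp
        qed
        then have "k \<le> 2*n+1" by linarith
        then show "d \<le> enat (2*n+1)" unfolding d by (simp only: enat_ord_simps)
      qed
      have pT: "p - 1 \<ge> 4 * m\<^sup>2 * T\<^sup>2" using p by simp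
      obtain \<psi> \<psi>' b where "\<And>t. (\<psi> has_real_derivative \<psi>' t) (at t)" "continuous_on UNIV \<psi>'" "b > 1"
        "\<And>t. t \<le> 1 \<Longrightarrow> \<psi> t = 0" "\<And>t. t \<le> 1 \<Longrightarrow> \<psi>' t = 0" "\<And>t. t \<ge> b \<Longrightarrow> \<psi> t = 0" "\<And>t. t \<ge> b \<Longrightarrow> \<psi>' t = 0"
        "integral {1..b} (\<lambda>t. (\<psi>' t)\<^sup>2 + (real n)\<^sup>2 * (\<psi> t)\<^sup>2 - V t * (\<psi> t)\<^sup>2) < 0"
        using negative_profile[OF of_nat_0_le_iff nm(1) T_def pT] by blast
      then obtain f where f: "\<And>j. test_fun (f j)"
        "\<And>c. \<exists>j<2*n+1. c j \<noteq> 0 \<Longrightarrow> (LBINT t:{0<..}. J (\<lambda>x. \<Sum>j<2*n+1. c j * f j x) t) < 0"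
        using lower_core[of \<psi> \<psi>' b n] by blast
      have neg: "Qform \<alpha> p u (\<lambda>x. \<Sum>j<2*n+1. c j * f j x) < 0" if "\<exists>j<2*n+1. c j \<noteq> 0" for c
      proof -
        have t: "test_fun (\<lambda>x. \<Sum>j<2*n+1. c j * f j x)" by (rule test_fun_lincomb(1)) (rule f(1))
        show ?thesis unfolding Qf[OF test_fun_H10_grad[OF t]] QQ_test[OF t] by (rule f(2)[OF that])
      qed
      have "H10 (f i)" for i unfolding H10_def using test_fun_H10_grad[OF f(1)] by blast
      then show "enat (2*n+1) \<le> Sup {enat k | k. \<exists>f :: nat \<Rightarrow> real^2 \<Rightarrow> real. (\<forall>i<k. H10 (f i)) \<and>
        (\<forall>c :: nat \<Rightarrow> real. (\<exists>i<k. c i \<noteq> 0) \<longrightarrow> Qform \<alpha> p u (\<lambda>x. \<Sum>i<k. c i * f i x) < 0)}"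
        using neg by (intro Sup_upper) blast
    qed
  qed
qed

end
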